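(* Let $m$ be a positive integer. The ring $\mathbb{Z}[x_{ijk}\mid 1\le i,j\le 2,\ k=1,\dots,m]\cap \mathcal{O}((\mathbb{Q}^{2\times 2})^m)^{SL_2\times SL_2}$ is minimally generated (as a ring) by the elements \[\det(x_k)\ (1\le k\le m),\quad \langle x_l\vert x_r\rangle\ (1\le l<r\le m),\quad \xi_q(x_{k_1},\dots,x_{k_{2q}})\ \ (2\le q\le \tfrac m2,\ 1\le k_1<\cdots<k_{2q}\le m).\]
   Context: The group $SL_2\times SL_2$ (two copies of the special linear group over $\mathbb{Q}$) acts on $(\mathbb{Q}^{2\times 2})^m$ by $(g,h)\cdot(A_1,\dots,A_m)=(gA_1h^{-1},\dots,gA_mh^{-1})$. $\mathcal{O}((\mathbb{Q}^{2\times 2})^m)=\mathbb{Q}[x_{ijk}\mid 1\le i,j\le 2,\ 1\le k\le m]$, where $x_{ijk}$ is the function sending $(A_1,\dots,A_m)$ to the $(i,j)$-entry of $A_k$, and $\mathcal{O}((\mathbb{Q}^{2\times 2})^m)^{SL_2\times SL_2}$ is the subalgebra of polynomial functions constant on $SL_2\times SL_2$-orbits. $x_k=(x_{ijk})_{i,j=1}^2$ is the $k$-th generic matrix. $\langle x_k\vert x_l\rangle$ is the coefficient of $zw$ in $\det(zx_k+wx_l)$ ($z,w$ commuting variables), i.e. $\langle x_k\vert x_l\rangle=x_{11k}x_{22l}+x_{11l}x_{22k}-x_{12k}x_{21l}-x_{12l}x_{21k}$. For $q\ge 2$ and $2\times 2$ matrices $y_1,\dots,y_{2q}$ over a commutative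 ring $A$, $\xi_q(y_1,\dots,y_{2q})\in A$ is the coefficient of $z_1\cdots z_qw_1\cdots w_q$ in the determinant of the $2q\times 2q$ matrix over $A[z_1,\dots,z_q,w_1,\dots,w_q]$ which, as a $q\times q$ block matrix with $2\times 2$ blocks, has $z_ry_r$ in position $(r,r)$ for $1\le r\le q$, $w_ry_{q+r}$ in position $(r,r+1)$ for $1\le r\le q-1$, $w_qy_{2q}$ in position $(q,1)$, and zero blocks elsewhere. "Minimally generated" means that these elements generate the ring (as a $\mathbb{Z}$-algebra) and no proper subset of them does. *)

theory Defs
  imports
    "HOL-Library.Poly_Mapping"
    "Jordan_Normal_Form.Determinant"
    "Jordan_Normal_Form.Gauss_Jordan_Elimination"
begin

type_synonym ('v, 'a) mpoly = "('v \<Rightarrow>\<^sub>0 nat) \<Rightarrow>\<^sub>0 'a"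

definition MVar :: "'v \<Rightarrow> ('v, 'a::comm_ring_1) mpoly" where
  "MVar v = Poly_Mapping.single (Poly_Mapping.single v 1) 1"

definition MConst :: "'a \<Rightarrow> ('v, 'a::comm_ring_1) mpoly" where
  "MConst c = Poly_Mapping.single 0 c"

definition meval :: "('v \<Rightarrow> 'a) \<Rightarrow> ('v, 'a::comm_ring_1) mpoly \<Rightarrow> 'a" where
  "meval f p = (\<Sum>t\<in>Poly_Mapping.keys p. Poly_Mapping.lookup p t *
     (\<Prod>v\<in>Poly_Mapping.keys t. f v ^ Poly_Mapping.lookup t v))"

text \<open>The variable \<open>(i, j, k)\<close> stands for the \<open>(i, j)\<close>-entry of the \<open>k\<close>-th matrix.
  Row and column indices start at \<open>0\<close>, as they do for the type of matrices; the index
  \<open>k\<close> runs through \<open>1, \<dots>, m\<close>.  Since the base field is infinite, polynomial functions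
  are identified with polynomials.\<close>

type_synonym xvar = "nat \<times> nat \<times> nat"

definition coord_ring :: "nat \<Rightarrow> (xvar, rat) mpoly set" where
  "coord_ring m = {p. \<forall>t\<in>Poly_Mapping.keys p.
     Poly_Mapping.keys t \<subseteq> {0..<2} \<times> {0..<2} \<times> {1..m}}"

definition int_coord_ring :: "nat \<Rightarrow> (xvar, rat) mpoly set" where
  "int_coord_ring m = {p \<in> coord_ring m. \<forall>t. Poly_Mapping.lookup p t \<in> \<int>}"

definition value_at :: "(xvar, rat) mpoly \<Rightarrow> (nat \<Rightarrow> rat mat) \<Rightarrow> rat" where
  "value_at p A = meval (\<lambda>(i, j, k). A k $$ (i, j)) p"

definition SL2 :: "rat mat set" where
  "SL2 = {g \<in> carrier_mat 2 2. det g = 1}"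

definition act :: "rat mat \<Rightarrow> rat mat \<Rightarrow> (nat \<Rightarrow> rat mat) \<Rightarrow> nat \<Rightarrow> rat mat" where
  "act g h A = (\<lambda>k. g * A k * the (mat_inverse h))"

definition invariants :: "nat \<Rightarrow> (xvar, rat) mpoly set" where
  "invariants m = {p \<in> coord_ring m. \<forall>g\<in>SL2. \<forall>h\<in>SL2. \<forall>A.
     (\<forall>k\<in>{1..m}. A k \<in> carrier_mat 2 2) \<longrightarrow> value_at p (act g h A) = value_at p A}"

definition generic_mat :: "nat \<Rightarrow> (xvar, rat) mpoly mat" where
  "generic_mat k = mat 2 2 (\<lambda>(i, j). MVar (i, j, k))"

datatype zwvar = Z nat | W nat

text \<open>The coefficient of \<open>z w\<close> in \<open>det (z a + w b)\<close>, with \<open>z = Z 1\<close> and \<open>w = W 1\<close>.\<close>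

definition polar :: "'a::comm_ring_1 mat \<Rightarrow> 'a mat \<Rightarrow> 'a" where
  "polar a b = Poly_Mapping.lookup
     (det (MVar (Z 1) \<cdot>\<^sub>m map_mat MConst a + MVar (W 1) \<cdot>\<^sub>m map_mat MConst b))
     (Poly_Mapping.single (Z 1) 1 + Poly_Mapping.single (W 1) 1)"

text \<open>The block positions \<open>r, s\<close> below are \<open>1\<close>-based, as is the sequence
  \<open>y 1, \<dots>, y (2 * q)\<close>.  For \<open>q \<ge> 2\<close> the three nonzero cases exclude each other.\<close>

definition xi_mat :: "nat \<Rightarrow> (nat \<Rightarrow> 'a::comm_ring_1 mat) \<Rightarrow> (zwvar, 'a) mpoly mat" where
  "xi_mat q y = mat (2 * q) (2 * q) (\<lambda>(a, b).
     let r = a div 2 + 1; s = b div 2 + 1; i = a mod 2; j = b mod 2 in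
     if s = r then MVar (Z r) * MConst (y r $$ (i, j))
     else if s = r + 1 then MVar (W r) * MConst (y (q + r) $$ (i, j))
     else if r = q \<and> s = 1 then MVar (W q) * MConst (y (2 * q) $$ (i, j))
     else 0)"

definition xi :: "nat \<Rightarrow> (nat \<Rightarrow> 'a::comm_ring_1 mat) \<Rightarrow> 'a" where
  "xi q y = Poly_Mapping.lookup (det (xi_mat q y))
     (\<Sum>r\<in>{1..q}. Poly_Mapping.single (Z r) 1 + Poly_Mapping.single (W r) 1)"

definition generators :: "nat \<Rightarrow> (xvar, rat) mpoly set" where
  "generators m =
     {det (generic_mat k) | k. 1 \<le> k \<and> k \<le> m} \<union>
     {polar (generic_mat l) (generic_mat r) | l r. 1 \<le> l \<and> l < r \<and> r \<le> m} \<union>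
     {xi q (\<lambda>s. generic_mat (\<kappa> s)) | q \<kappa>. 2 \<le> q \<and> 2 * q \<le> m \<and>
        strict_mono_on {1..2 * q} \<kappa> \<and> \<kappa> ` {1..2 * q} \<subseteq> {1..m}}"

definition is_subring :: "'a::comm_ring_1 set \<Rightarrow> bool" where
  "is_subring R \<longleftrightarrow> 1 \<in> R \<and> (\<forall>a\<in>R. \<forall>b\<in>R. a - b \<in> R \<and> a * b \<in> R)"

definition minimally_generates :: "'a::comm_ring_1 set \<Rightarrow> 'a set \<Rightarrow> bool" where
  "minimally_generates S R \<longleftrightarrow>
     is_subring hull S = R \<and> (\<forall>T. T \<subset> S \<longrightarrow> is_subring hull T \<noteq> R)"

end

theory Submission
  imports Defs "HOL-Library.Product_Lexorder"
begin

text \<open>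
  Why the generators generate.  Let \<open>F\<close> be an integral invariant, homogeneous in each of the matrices.  Specialise
  every matrix \<open>x\<^sub>k\<close> to \<open>u\<^sub>k v\<^sub>k\<^sup>T\<close>.  The two factors of the group then act separately on the vectors \<open>u\<^sub>k\<close> and on the
  vectors \<open>v\<^sub>k\<close>, and the specialised \<open>F\<close> is an integral combination of products of brackets \<open>[u\<^sub>a, u\<^sub>b]\<close> and
  \<open>[v\<^sub>a, v\<^sub>b]\<close> (\<open>vector_invariants\<close>), in which \<open>u\<^sub>k\<close> and \<open>v\<^sub>k\<close> occur equally often.  Regard the brackets as the
  edges of two multigraphs with the same degrees: their union splits into alternating closed walks (\<open>A_trail\<close>).  By the
  Pluecker relation, a walk changes only by its sign when two neighbouring vertices are exchanged, up to products with
  shorter walks.  So a walk with a repeated vertex reduces to shorter ones, and the other walks may be taken in one fixed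
  cyclic order (\<open>A_walk\<close>).  For two vertices a walk is, up to sign, the value of \<open>\<langle>x\<^sub>a|x\<^sub>b\<rangle>\<close> on matrices of rank
  one, and for \<open>2q\<close> vertices in a suitable order it is that of an element \<open>\<xi>\<^sub>q\<close>.  Hence on matrices of rank one
  \<open>F\<close> agrees with a polynomial in the generators.

  An invariant that vanishes when \<open>x\<^sub>j\<close> has rank one is divisible by \<open>det x\<^sub>j\<close>, with an invariant quotient of lower
  degree.  Making the matrices generic again one at a time, and inducting on the degree, one obtains \<open>F\<close> itself
  (\<open>invariants_liftable\<close>).  The same division argument, with the bracket of two vectors in place of the determinant
  of a matrix, proves the statement on vector invariants.  All divisions are by polynomials with coefficients \<open>\<plusminus>1\<close>,
  arranged so that they stay within integral polynomials (\<open>standard_form\<close>, \<open>divide_invariant\<close>).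

  The elements \<open>\<xi>\<^sub>q\<close> are handled through their values on matrices of rank one, which determine a multilinear
  polynomial (\<open>rank1_determines_multilinear\<close>).  On such matrices the block matrix factors (\<open>xi_rank_one\<close>), and it
  follows that \<open>\<xi>\<^sub>q\<close> is, up to sign, a trace of an alternating product of generic matrices and adjugates of generic
  matrices (\<open>xi_generic\<close>).

  Why no generator can be omitted.  At scalar matrices \<open>\<epsilon>\<^sub>k I\<close> the generators become monomials: \<open>det x\<^sub>k\<close> becomes
  \<open>\<epsilon>\<^sub>k\<^sup>2\<close>, while \<open>\<langle>x\<^sub>l|x\<^sub>r\<rangle>\<close> and \<open>\<xi>\<^sub>q\<close> become \<open>\<plusminus>2\<close> times the product of the variables involved.  A product of
  two or more generators that contributes to the monomial \<open>e\<close> of a given generator other than a determinant involves no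
  determinant, so that its coefficient is divisible by \<open>4\<close>; for a determinant there is no such product at all.  Thus
  every polynomial in the other generators has a coefficient at \<open>e\<close> divisible by \<open>4\<close>, but the given generator has not
  (\<open>generator_not_small_at\<close>).
\<close>

abbreviation "lookup \<equiv> Poly_Mapping.lookup"
abbreviation "keys \<equiv> Poly_Mapping.keys"
abbreviation "single \<equiv> Poly_Mapping.single"

section \<open>Evaluation and substitution of polynomials\<close>

definition eval_monomial :: "('v \<Rightarrow> 'b) \<Rightarrow> ('v \<Rightarrow>\<^sub>0 nat) \<Rightarrow> 'b::comm_ring_1" where
  "eval_monomial f t = (\<Prod>v\<in>keys t. f v ^ lookup t v)"

text \<open>The coefficients are transported by \<open>h\<close> and the variables by \<open>f\<close>, so that evaluation, substitution and a change of the coefficient ring are instances of one notion.\<close>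

definition eval_with :: "('a \<Rightarrow> 'b) \<Rightarrow> ('v \<Rightarrow> 'b) \<Rightarrow> ('v, 'a::comm_ring_1) mpoly \<Rightarrow> 'b::comm_ring_1" where
  "eval_with h f p = (\<Sum>t\<in>keys p. h (lookup p t) * eval_monomial f t)"

abbreviation subst :: "('v \<Rightarrow> ('w, 'a) mpoly) \<Rightarrow> ('v, 'a::comm_ring_1) mpoly \<Rightarrow> ('w, 'a) mpoly" where
  "subst \<equiv> eval_with MConst"

lemma meval_eq_eval_with: "meval f = eval_with (\<lambda>c. c) f"
  by (rule ext) (simp add: meval_def eval_with_def eval_monomial_def)

lemma eval_monomial_superset:
  assumes "finite S" "keys t \<subseteq> S"
  shows "eval_monomial f t = (\<Prod>v\<in>S. f v ^ lookup t v)"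
  unfolding eval_monomial_def
  by (rule prod.mono_neutral_left) (use assms in \<open>auto simp: in_keys_iff\<close>)

lemma eval_monomial_0 [simp]: "eval_monomial f 0 = 1"
  by (simp add: eval_monomial_def)

lemma eval_monomial_single [simp]: "eval_monomial f (single v n) = f v ^ n"
  by (cases "n = 0") (simp_all add: eval_monomial_def)

lemma eval_monomial_add: "eval_monomial f (s + t) = eval_monomial f s * eval_monomial f t"
proof -
  let ?S = "keys s \<union> keys t"
  have "keys (s + t) \<subseteq> ?S" by (rule keys_add)
  then show ?thesis
    by (simp add: eval_monomial_superset[of ?S] lookup_add power_add prod.distrib)
qed

lemma mpoly_single_sum: "(p :: ('v, 'a::comm_ring_1) mpoly) = (\<Sum>t\<in>keys p. single t (lookup p t))"
proof (rule poly_mapping_eqI)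
  fix s
  have "(\<Sum>t\<in>keys p. lookup (single t (lookup p t)) s) = (\<Sum>t\<in>keys p. if t = s then lookup p t else 0)"
    by (rule sum.cong) (auto simp: lookup_single when_def)
  then show "lookup p s = lookup (\<Sum>t\<in>keys p. single t (lookup p t)) s"
    by (simp add: lookup_sum sum.delta in_keys_iff)
qed

lemma mpoly_add_induct [case_names zero single add]:
  assumes "P 0" "\<And>t c. P (single t c)" "\<And>p q. P p \<Longrightarrow> P q \<Longrightarrow> P (p + q)"
  shows "P (p :: ('v, 'a::comm_ring_1) mpoly)"
proof -
  have "P (\<Sum>t\<in>A. single t (lookup p t))" if "finite A" for A
    using that by induct (simp_all add: assms)
  from this[of "keys p"] show ?thesis by (simp flip: mpoly_single_sum)
qed

lemma MConst_hom: "comm_ring_hom MConst"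
  by unfold_locales (simp_all add: MConst_def single_add mult_single)

lemma id_hom: "comm_ring_hom (\<lambda>c. c)"
  by unfold_locales simp_all

context comm_ring_hom begin

lemma eval_with_superset:
  assumes "finite S" "keys p \<subseteq> S"
  shows "eval_with hom f p = (\<Sum>t\<in>S. hom (lookup p t) * eval_monomial f t)"
  unfolding eval_with_def
  by (rule sum.mono_neutral_left) (use assms in \<open>auto simp: in_keys_iff\<close>)

lemma eval_with_single: "eval_with hom f (single t c) = hom c * eval_monomial f t"
  by (cases "c = 0") (simp_all add: eval_with_def)

lemma eval_with_add: "eval_with hom f (p + q) = eval_with hom f p + eval_with hom f q"
proof -
  let ?S = "keys p \<union> keys q"
  have "keys (p + q) \<subseteq> ?S" by (rule keys_add)
  then show ?thesis
    by (simp add: eval_with_superset[of ?S] lookup_add algebra_simps sum.distrib hom_add)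
qed

lemma eval_with_0: "eval_with hom f 0 = 0"
  by (simp add: eval_with_def)

lemma eval_with_mult: "eval_with hom f (p * q) = eval_with hom f p * eval_with hom f q"
proof (induct p rule: mpoly_add_induct)
  case (single s c)
  show ?case
    by (induct q rule: mpoly_add_induct)
      (simp_all add: eval_with_0 eval_with_single eval_with_add mult_single distrib_left eval_monomial_add hom_mult)
qed (simp_all add: eval_with_0 eval_with_add distrib_right)

lemma eval_with_hom: "comm_ring_hom (eval_with hom f)"
proof
  show "eval_with hom f 1 = 1"
    using eval_with_single[of f 0 1] by simp
qed (simp_all add: eval_with_0 eval_with_add eval_with_mult)

lemma eval_with_MConst: "eval_with hom f (MConst c) = hom c"
  by (simp add: MConst_def eval_with_single)

lemma eval_with_MVar: "eval_with hom f (MVar v) = f v"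
  by (simp add: MVar_def eval_with_single)

end

global_interpretation meval: comm_ring_hom "meval f" for f
  unfolding meval_eq_eval_with by (rule comm_ring_hom.eval_with_hom[OF id_hom])

global_interpretation subst: comm_ring_hom "subst f" for f
  by (rule comm_ring_hom.eval_with_hom[OF MConst_hom])

global_interpretation MConst: comm_ring_hom MConst
  by (rule MConst_hom)

lemma subst_MVar [simp]: "subst f (MVar v) = f v"
  by (rule MConst.eval_with_MVar)

lemma subst_MConst [simp]: "subst f (MConst c) = MConst c"
  by (rule MConst.eval_with_MConst)

lemma meval_MVar [simp]: "meval f (MVar v) = f v"
  unfolding meval_eq_eval_with by (rule comm_ring_hom.eval_with_MVar[OF id_hom])

lemma meval_MConst [simp]: "meval f (MConst c) = c"
  unfolding meval_eq_eval_with by (rule comm_ring_hom.eval_with_MConst[OF id_hom])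

lemma hom_eval_monomial:
  assumes "comm_ring_hom H" shows "H (eval_monomial f t) = eval_monomial (\<lambda>v. H (f v)) t"
proof -
  interpret comm_ring_hom H by fact
  show ?thesis by (simp add: eval_monomial_def hom_prod hom_power)
qed

lemma exponent_sum: "t = (\<Sum>v\<in>keys t. single v (lookup t v :: nat))"
proof (rule poly_mapping_eqI)
  fix w
  have "(\<Sum>v\<in>keys t. lookup (single v (lookup t v)) w) = (\<Sum>v\<in>keys t. if v = w then lookup t v else 0)"
    by (rule sum.cong) (auto simp: lookup_single when_def)
  then show "lookup t w = lookup (\<Sum>v\<in>keys t. single v (lookup t v)) w"
    by (simp add: lookup_sum sum.delta in_keys_iff)
qed

lemma eval_monomial_MVar: "eval_monomial MVar t = (single t 1 :: ('v, 'a::comm_ring_1) mpoly)"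
proof -
  have aux: "(\<Prod>v\<in>A. single (single v (lookup t v)) (1::'a)) = single (\<Sum>v\<in>A. single v (lookup t v)) 1"
    if "finite A" for A
    using that by induct (simp_all add: mult_single)
  have "MVar v ^ n = (single (single v n) 1 :: ('v, 'a) mpoly)" for v and n :: nat
    by (induct n) (simp_all add: MVar_def mult_single flip: single_add)
  then have "eval_monomial MVar t = (single (\<Sum>v\<in>keys t. single v (lookup t v)) 1 :: ('v, 'a) mpoly)"
    by (simp add: eval_monomial_def aux)
  then show ?thesis by (simp flip: exponent_sum)
qed

lemma single_eq_mon: "single t c = MConst c * eval_monomial MVar t"
  by (simp add: eval_monomial_MVar MConst_def mult_single)

text \<open>Every monomial is a product of a constant and of variables, so that two homomorphisms need only be
  compared on these.\<close>

lemma hom_cong_on: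
  assumes A: "comm_ring_hom A" and B: "comm_ring_hom B"
    and c: "\<And>c. A (MConst c) = B (MConst c)"
    and v: "\<And>t v. t \<in> keys p \<Longrightarrow> v \<in> keys t \<Longrightarrow> A (MVar v) = B (MVar v)"
  shows "A p = B p"
proof -
  interpret A: comm_ring_hom A by fact
  interpret B: comm_ring_hom B by fact
  have "A (single t (lookup p t)) = B (single t (lookup p t))" if "t \<in> keys p" for t
    unfolding single_eq_mon A.hom_mult B.hom_mult c hom_eval_monomial[OF A] hom_eval_monomial[OF B]
    using v[OF that] by (simp add: eval_monomial_def)
  then show ?thesis
    by (subst (1 2) mpoly_single_sum) (simp add: A.hom_sum B.hom_sum)
qed

lemma hom_compose:
  assumes "comm_ring_hom A" "comm_ring_hom B" shows "comm_ring_hom (\<lambda>x. A (B x))"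
proof -
  interpret A: comm_ring_hom A by fact
  interpret B: comm_ring_hom B by fact
  show ?thesis by unfold_locales (simp_all add: A.hom_add B.hom_add A.hom_mult B.hom_mult)
qed

section \<open>Gradings and integral coefficients\<close>

definition weight :: "('v \<Rightarrow> nat) \<Rightarrow> ('v \<Rightarrow>\<^sub>0 nat) \<Rightarrow> nat" where
  "weight w t = (\<Sum>v\<in>keys t. w v * lookup t v)"

definition homogeneous :: "('v \<Rightarrow> nat) \<Rightarrow> nat \<Rightarrow> ('v, 'a::comm_ring_1) mpoly \<Rightarrow> bool" where
  "homogeneous w n p \<longleftrightarrow> (\<forall>t\<in>keys p. weight w t = n)"

definition vars_in :: "'v set \<Rightarrow> ('v, 'a::comm_ring_1) mpoly \<Rightarrow> bool" where
  "vars_in V p \<longleftrightarrow> (\<forall>t\<in>keys p. keys t \<subseteq> V)"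

definition int_coeffs :: "('v, rat) mpoly \<Rightarrow> bool" where
  "int_coeffs p \<longleftrightarrow> (\<forall>t. lookup p t \<in> \<int>)"

lemma weight_superset:
  assumes "finite S" "keys t \<subseteq> S"
  shows "weight w t = (\<Sum>v\<in>S. w v * lookup t v)"
  unfolding weight_def
  by (rule sum.mono_neutral_left) (use assms in \<open>auto simp: in_keys_iff\<close>)

lemma weight_0 [simp]: "weight w 0 = 0"
  by (simp add: weight_def)

lemma weight_single [simp]: "weight w (single v n) = w v * n"
  by (cases "n = 0") (simp_all add: weight_def)

lemma weight_add [simp]: "weight w (s + t) = weight w s + weight w t"
proof -
  let ?S = "keys s \<union> keys t"
  have "keys (s + t) \<subseteq> ?S" by (rule keys_add)
  then show ?thesis
    by (simp add: weight_superset[of ?S] lookup_add sum.distrib algebra_simps)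
qed

lemma weight_eq_0_iff: "weight w t = 0 \<longleftrightarrow> (\<forall>v\<in>keys t. w v = 0)"
  by (auto simp: weight_def in_keys_iff)

text \<open>The condition on the variables is itself a grading condition.  So whatever is shown for all gradings
  (of a remainder or a quotient below) also bounds the variables that occur.\<close>

lemma vars_in_iff_homogeneous: "vars_in V p \<longleftrightarrow> homogeneous (\<lambda>v. if v \<in> V then 0 else 1) 0 p"
  by (auto simp: vars_in_def homogeneous_def weight_eq_0_iff)

lemma homogeneous_0 [simp]: "homogeneous w n 0" by (simp add: homogeneous_def)

lemma homogeneous_single: "homogeneous w n (single t c) \<longleftrightarrow> c = 0 \<or> weight w t = n"
  by (simp add: homogeneous_def)

lemma homogeneous_MConst [simp]: "homogeneous w 0 (MConst c)"
  by (simp add: MConst_def homogeneous_single)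

lemma homogeneous_1 [simp]: "homogeneous w 0 1"
  using homogeneous_MConst[of w 1] by simp

lemma homogeneous_MVar [simp]: "homogeneous w n (MVar v :: ('v, 'a::comm_ring_1) mpoly) \<longleftrightarrow> w v = n"
  by (simp add: MVar_def homogeneous_single)

lemma homogeneous_add: "homogeneous w n p \<Longrightarrow> homogeneous w n q \<Longrightarrow> homogeneous w n (p + q)"
  using keys_add[of p q] by (auto simp: homogeneous_def)

lemma keys_uminus [simp]: "keys (- p :: ('v, 'a::comm_ring_1) mpoly) = keys p"
  by (auto simp: in_keys_iff)

lemma homogeneous_uminus [simp]: "homogeneous w n (- p) \<longleftrightarrow> homogeneous w n p"
  by (simp add: homogeneous_def)

lemma homogeneous_diff: "homogeneous w n p \<Longrightarrow> homogeneous w n q \<Longrightarrow> homogeneous w n (p - q)"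
  using homogeneous_add[of w n p "- q"] by simp

lemma homogeneous_mult: "homogeneous w n p \<Longrightarrow> homogeneous w k q \<Longrightarrow> homogeneous w (n + k) (p * q)"
  using keys_mult[of p q] by (force simp: homogeneous_def)

lemma homogeneous_mult_eq: "homogeneous w n p \<Longrightarrow> homogeneous w k q \<Longrightarrow> l = n + k \<Longrightarrow> homogeneous w l (p * q)"
  by (simp add: homogeneous_mult)

lemma homogeneous_power: "homogeneous w n p \<Longrightarrow> homogeneous w (n * k) (p ^ k)"
  by (induct k) (auto intro: homogeneous_mult)

lemma homogeneous_sum: "(\<And>x. x \<in> A \<Longrightarrow> homogeneous w n (f x)) \<Longrightarrow> homogeneous w n (sum f A)"
  by (induct A rule: infinite_finite_induct) (auto intro: homogeneous_add)

lemma homogeneous_prod: "(\<And>x. x \<in> A \<Longrightarrow> homogeneous w (n x) (f x)) \<Longrightarrow> homogeneous w (sum n A) (prod f A)"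
  by (induct A rule: infinite_finite_induct) (auto intro: homogeneous_mult)

lemma homogeneous_smult: "homogeneous w n p \<Longrightarrow> homogeneous w n (MConst c * p)"
  using homogeneous_mult[OF homogeneous_MConst] by fastforce

lemma homogeneous_subst_on:
  assumes "homogeneous w n p" "vars_in V p" "\<And>v. v \<in> V \<Longrightarrow> homogeneous w' (w v) (f v)"
  shows "homogeneous w' n (subst f p)"
  unfolding eval_with_def
proof (rule homogeneous_sum)
  fix t assume t: "t \<in> keys p"
  with assms(2) have "v \<in> V" if "v \<in> keys t" for v using that by (auto simp: vars_in_def)
  with assms(3) have "homogeneous w' (\<Sum>v\<in>keys t. w v * lookup t v) (eval_monomial f t)"
    unfolding eval_monomial_def by (intro homogeneous_prod homogeneous_power) auto
  then show "homogeneous w' n (MConst (lookup p t) * eval_monomial f t)"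
    using assms(1) t by (auto simp: homogeneous_def[of w] weight_def intro!: homogeneous_smult)
qed

lemma vars_in_UNIV [simp]: "vars_in UNIV p" by (simp add: vars_in_def)

lemma homogeneous_subst: "homogeneous w n p \<Longrightarrow> (\<And>v. homogeneous w' (w v) (f v)) \<Longrightarrow> homogeneous w' n (subst f p)"
  by (rule homogeneous_subst_on[where V = UNIV]) auto

lemma vars_in_subst:
  assumes "vars_in V p" "\<And>v. v \<in> V \<Longrightarrow> vars_in V' (f v)"
  shows "vars_in V' (subst f p)"
  unfolding vars_in_iff_homogeneous
proof (rule homogeneous_subst_on[where w = "\<lambda>_. 0"])
  show "homogeneous (\<lambda>_. 0) 0 p" by (simp add: homogeneous_def weight_def)
qed (use assms in \<open>auto simp: vars_in_iff_homogeneous\<close>)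

lemma vars_in_add: "vars_in V p \<Longrightarrow> vars_in V q \<Longrightarrow> vars_in V (p + q)"
  and vars_in_diff: "vars_in V p \<Longrightarrow> vars_in V q \<Longrightarrow> vars_in V (p - q)"
  and vars_in_uminus [simp]: "vars_in V (- p) \<longleftrightarrow> vars_in V p"
  and vars_in_0 [simp]: "vars_in V 0"
  and vars_in_1 [simp]: "vars_in V 1"
  and vars_in_MConst [simp]: "vars_in V (MConst c)"
  by (auto simp: vars_in_iff_homogeneous intro: homogeneous_add homogeneous_diff)

lemma vars_in_mult: "vars_in V p \<Longrightarrow> vars_in V q \<Longrightarrow> vars_in V (p * q)"
  using homogeneous_mult[of _ 0 p 0 q] by (simp add: vars_in_iff_homogeneous)

lemma vars_in_MVar [simp]: "vars_in V (MVar v :: ('v, 'a::comm_ring_1) mpoly) \<longleftrightarrow> v \<in> V"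
  by (simp add: vars_in_iff_homogeneous)

lemma vars_in_mono: "vars_in V p \<Longrightarrow> V \<subseteq> V' \<Longrightarrow> vars_in V' p"
  by (auto simp: vars_in_def)

lemma vars_in_sum: "(\<And>x. x \<in> A \<Longrightarrow> vars_in V (f x)) \<Longrightarrow> vars_in V (sum f A)"
  by (simp add: vars_in_iff_homogeneous homogeneous_sum)

lemma subst_id_on:
  assumes "vars_in V p" "\<And>v. v \<in> V \<Longrightarrow> f v = MVar v"
  shows "subst f p = p"
  by (rule hom_cong_on[where B = "\<lambda>x. x", OF subst.comm_ring_hom_axioms id_hom])
     (use assms in \<open>auto simp: vars_in_def\<close>)

lemma subst_subst: "subst g (subst f p) = subst (\<lambda>v. subst g (f v)) p"
  by (rule hom_cong_on[OF hom_compose[OF subst.comm_ring_hom_axioms subst.comm_ring_hom_axioms]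
        subst.comm_ring_hom_axioms]) simp_all

lemma subst_commute:
  assumes "\<And>v. subst g (f v) = subst f (g v)"
  shows "subst g (subst f p) = subst f (subst g p)"
  by (simp add: subst_subst assms)

lemma meval_subst: "meval g (subst f p) = meval (\<lambda>v. meval g (f v)) p"
  by (rule hom_cong_on[OF hom_compose[OF meval.comm_ring_hom_axioms subst.comm_ring_hom_axioms]
        meval.comm_ring_hom_axioms]) simp_all

lemma meval_cong_on:
  assumes "vars_in V p" "\<And>v. v \<in> V \<Longrightarrow> f v = g v"
  shows "meval f p = meval g p"
  by (rule hom_cong_on[OF meval.comm_ring_hom_axioms meval.comm_ring_hom_axioms])
     (use assms in \<open>auto simp: vars_in_def\<close>)

lemma eval_monomial_scale: "eval_monomial (\<lambda>v. c v * f v) t = eval_monomial c t * eval_monomial f t"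
  by (simp add: eval_monomial_def power_mult_distrib prod.distrib)

lemma lookup_subst_scale:
  "lookup (subst (\<lambda>v. MConst (c v) * MVar v) p) t = lookup p t * eval_monomial c t"
proof -
  have "subst (\<lambda>v. MConst (c v) * MVar v) p = (\<Sum>s\<in>keys p. single s (lookup p s * eval_monomial c s))"
    unfolding eval_with_def
    by (rule sum.cong) (simp_all add: eval_monomial_scale eval_monomial_MVar MConst_def mult_single
         hom_eval_monomial[OF MConst_hom, unfolded MConst_def, symmetric])
  then have "lookup (subst (\<lambda>v. MConst (c v) * MVar v) p) t
      = (\<Sum>s\<in>keys p. if s = t then lookup p s * eval_monomial c s else 0)"
    by (auto simp: lookup_sum lookup_single when_def intro!: sum.cong)
  then show ?thesis by (simp add: sum.delta in_keys_iff)
qed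

lemma eval_monomial_power_weight: "eval_monomial (\<lambda>v. c ^ w v) t = c ^ weight w t"
  by (simp add: eval_monomial_def weight_def power_sum power_mult)

text \<open>The scaling multiplies the coefficient of a monomial of weight \<open>k\<close> by \<open>2 ^ k\<close>, and the powers of
  \<open>2\<close> are distinct.  This reads off the degrees of a polynomial whose coefficients are out of sight, such as
  \<open>xi\<close>, from its behaviour under scaling.\<close>

lemma homogeneous_if_scale:
  fixes p :: "('v, rat) mpoly"
  assumes "subst (\<lambda>v. MConst (2 ^ w v) * MVar v) p = MConst (2 ^ n) * p"
  shows "homogeneous w n p"
  unfolding homogeneous_def
proof
  fix t assume t: "t \<in> keys p"
  have "lookup (MConst (2 ^ n) * p) t = 2 ^ n * lookup p t"
    by (simp add: MConst_def Poly_Mapping.map.rep_eq when_def flip: mult_map_scale_conv_mult)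
  then have "lookup p t * 2 ^ weight w t = 2 ^ n * lookup p t"
    using lookup_subst_scale[of "\<lambda>v. 2 ^ w v" p t] by (simp only: assms eval_monomial_power_weight)
  moreover have "lookup p t \<noteq> 0" using t by (simp add: in_keys_iff)
  ultimately have "(2::rat) ^ weight w t = 2 ^ n" by simp
  then show "weight w t = n" by simp
qed

lemma meval_scale:
  assumes "homogeneous w n p" shows "meval (\<lambda>v. c ^ w v * f v) p = c ^ n * meval f p"
  using assms unfolding meval_eq_eval_with eval_with_def homogeneous_def
  by (simp add: eval_monomial_scale eval_monomial_power_weight sum_distrib_left mult_ac)

lemma int_coeffs_0 [simp]: "int_coeffs 0" by (simp add: int_coeffs_def)

lemma int_coeffs_single: "int_coeffs (single t c) \<longleftrightarrow> c \<in> \<int>"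
  by (auto simp: int_coeffs_def lookup_single when_def split: if_splits)

lemma int_coeffs_MVar [simp]: "int_coeffs (MVar v)"
  by (simp add: MVar_def int_coeffs_single)

lemma int_coeffs_MConst [simp]: "int_coeffs (MConst c) \<longleftrightarrow> c \<in> \<int>"
  by (simp add: MConst_def int_coeffs_single)

lemma int_coeffs_1 [simp]: "int_coeffs 1"
  using int_coeffs_MConst[of 1] by simp

lemma int_coeffs_add: "int_coeffs p \<Longrightarrow> int_coeffs q \<Longrightarrow> int_coeffs (p + q)"
  and int_coeffs_diff: "int_coeffs p \<Longrightarrow> int_coeffs q \<Longrightarrow> int_coeffs (p - q)"
  and int_coeffs_uminus [simp]: "int_coeffs (- p) \<longleftrightarrow> int_coeffs p"
  by (auto simp: int_coeffs_def lookup_add lookup_minus minus_in_Ints_iff)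

lemma int_coeffs_sum: "(\<And>x. x \<in> A \<Longrightarrow> int_coeffs (f x)) \<Longrightarrow> int_coeffs (sum f A)"
  by (induct A rule: infinite_finite_induct) (auto intro: int_coeffs_add)

lemma int_coeffs_mult:
  assumes "int_coeffs p" "int_coeffs q" shows "int_coeffs (p * q)"
proof -
  have "p * q = (\<Sum>s\<in>keys p. \<Sum>t\<in>keys q. single (s + t) (lookup p s * lookup q t))"
    by (subst mpoly_single_sum[of p], subst mpoly_single_sum[of q])
       (simp add: sum_product mult_single)
  then show ?thesis
    using assms by (auto simp: int_coeffs_def[of p] int_coeffs_def[of q] int_coeffs_single intro!: int_coeffs_sum)
qed

lemma int_coeffs_power: "int_coeffs p \<Longrightarrow> int_coeffs (p ^ n)"
  by (induct n) (auto intro: int_coeffs_mult)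

lemma int_coeffs_prod: "(\<And>x. x \<in> A \<Longrightarrow> int_coeffs (f x)) \<Longrightarrow> int_coeffs (prod f A)"
  by (induct A rule: infinite_finite_induct) (auto intro: int_coeffs_mult)

lemma int_coeffs_subst:
  assumes "int_coeffs p" "\<And>v. int_coeffs (f v)" shows "int_coeffs (subst f p)"
  unfolding eval_with_def eval_monomial_def
  by (intro int_coeffs_sum int_coeffs_mult int_coeffs_prod int_coeffs_power assms(2))
     (use assms(1) in \<open>auto simp: int_coeffs_def[of p]\<close>)

text \<open>Distinct monomials of \<open>p\<close> have distinct images, so that no cancellation can occur.  The weight of
  \<open>s\<close> in the last-but-one hypothesis is the exponent of \<open>u\<close> in the image of the monomial \<open>s\<close>.\<close>

lemma monomial_subst_eq_0:
  fixes p :: "('v, 'a::comm_ring_1) mpoly"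
  assumes f: "\<And>v. f v = single (e v) 1"
    and inj: "\<And>s t. s \<in> keys p \<Longrightarrow> t \<in> keys p \<Longrightarrow>
      (\<And>u. weight (\<lambda>v. lookup (e v) u) s = weight (\<lambda>v. lookup (e v) u) t) \<Longrightarrow> s = t"
    and z: "subst f p = 0"
  shows "p = 0"
proof (rule ccontr)
  define E where "E t = (\<Sum>v\<in>keys t. \<Sum>i<lookup t v. e v)" for t :: "'v \<Rightarrow>\<^sub>0 nat"
  have pw: "f v ^ n = single (\<Sum>i<n. e v) 1" for v n
    by (induct n) (simp_all add: f mult_single add.commute)
  have "(\<Prod>v\<in>A. f v ^ lookup t v) = single (\<Sum>v\<in>A. \<Sum>i<lookup t v. e v) 1" if "finite A" for A t
    using that by induct (simp_all add: pw mult_single)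
  then have mon: "eval_monomial f t = single (E t) 1" for t
    by (simp add: eval_monomial_def E_def)
  have E: "lookup (E t) u = weight (\<lambda>v. lookup (e v) u) t" for t u
    by (simp add: E_def weight_def lookup_sum mult.commute)
  assume "p \<noteq> 0"
  then obtain t where t: "t \<in> keys p" by (metis ex_in_conv keys_eq_empty)
  have "0 = lookup (subst f p) (E t)" using z by simp
  also have "\<dots> = (\<Sum>s\<in>keys p. if E s = E t then lookup p s else 0)"
    unfolding eval_with_def by (auto simp: lookup_sum mon MConst_def mult_single lookup_single when_def intro!: sum.cong)
  also have "\<dots> = (\<Sum>s\<in>keys p. if s = t then lookup p s else 0)"
    by (rule sum.cong) (auto intro!: inj t simp flip: E)
  also have "\<dots> = lookup p t" using t by (simp add: sum.delta)
  finally show False using t by (simp add: in_keys_iff)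
qed

section \<open>Polynomials are determined by their values\<close>

lemma poly_all_0:
  fixes c :: "nat \<Rightarrow> rat"
  assumes "\<And>s. (\<Sum>i<n. s ^ i * c i) = 0" "i < n"
  shows "c i = 0"
proof -
  let ?p = "\<Sum>i<n. monom (c i) i"
  have "poly ?p s = 0" for s
    using assms(1)[of s] by (simp add: poly_sum poly_monom mult.commute)
  then have "?p = 0" by (metis poly_all_0_iff_0)
  then have "coeff ?p i = 0" by simp
  then show ?thesis using assms(2) by (simp add: coeff_sum)
qed

lemma collect_powers:
  fixes p :: "('v, 'a::comm_ring_1) mpoly"
  assumes "vars_in (insert v V) p"
  obtains n q where "p = (\<Sum>i<n. MVar v ^ i * q i)" "\<And>i. vars_in (V - {v}) (q i)"
proof
  define r where "r t = t - single v (lookup t v)" for t :: "'v \<Rightarrow>\<^sub>0 nat"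
  define n where "n = Suc (\<Sum>t\<in>keys p. lookup t v)"
  define q where "q i = (\<Sum>t\<in>{t\<in>keys p. lookup t v = i}. single (r t) (lookup p t))" for i
  have n: "lookup t v < n" if "t \<in> keys p" for t
    using that by (auto simp: n_def less_Suc_eq_le intro!: member_le_sum)
  have r: "single v (lookup t v) + r t = t" for t
    by (rule poly_mapping_eqI) (auto simp: r_def lookup_add lookup_minus lookup_single when_def)
  have pow: "MVar v ^ i = (single (single v i) 1 :: ('v, 'a) mpoly)" for i
    by (induct i) (simp_all add: MVar_def mult_single flip: single_add)
  have "(\<Sum>i<n. MVar v ^ i * q i) =
      (\<Sum>i<n. \<Sum>t\<in>{t\<in>keys p. lookup t v = i}. single t (lookup p t))"
    unfolding q_def sum_distrib_left
    by (intro sum.cong refl) (auto simp: pow mult_single r)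
  also have "\<dots> = (\<Sum>t\<in>keys p. single t (lookup p t))"
    by (rule sum.group) (auto dest: n)
  finally show "p = (\<Sum>i<n. MVar v ^ i * q i)" by (simp flip: mpoly_single_sum)
  have "keys (r t) \<subseteq> keys t - {v}" for t
    by (auto simp: r_def in_keys_iff lookup_minus lookup_single when_def split: if_splits)
  then show "vars_in (V - {v}) (q i)" for i
    unfolding q_def using assms
    by (intro vars_in_sum) (fastforce simp: vars_in_def split: if_splits)
qed

text \<open>A nonzero polynomial in one variable has finitely many zeros; induction on the number of variables
  reduces to this case.\<close>

lemma meval_all_0:
  fixes p :: "('v, rat) mpoly"
  assumes "\<And>f. meval f p = 0"
  shows "p = 0"
proof -
  have "p = 0" if "finite V" "vars_in V p" "\<And>f. meval f p = 0" for V and p :: "('v, rat) mpoly"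
    using that
  proof (induct V arbitrary: p rule: finite_induct)
    case empty
    then have "keys t = {}" if "t \<in> keys p" for t using that by (auto simp: vars_in_def)
    then have "t = 0" if "t \<in> keys p" for t using that by simp
    then have "keys p \<subseteq> {0}" by auto
    then have "p = single 0 (lookup p 0)"
      by (intro poly_mapping_eqI) (auto simp: lookup_single when_def in_keys_iff)
    then show ?case using empty(2)[of "\<lambda>_. 0"] by (metis MConst_def meval_MConst single_zero)
  next
    case (insert v V)
    obtain n q where p: "p = (\<Sum>i<n. MVar v ^ i * q i)" and q: "\<And>i. vars_in (V - {v}) (q i)"
      using collect_powers[OF insert(4)] by blast
    have "q i = 0" if i: "i < n" for i
    proof (rule insert(3))
      show "vars_in V (q i)" using q[of i] by (rule vars_in_mono) auto
      fix f
      have "(\<Sum>i<n. s ^ i * meval f (q i)) = 0" for s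
      proof -
        have "meval (f(v := s)) (q i) = meval f (q i)" for i
          by (rule meval_cong_on[OF q]) auto
        moreover have "meval (f(v := s)) p = (\<Sum>i<n. s ^ i * meval (f(v := s)) (q i))"
          unfolding p meval.hom_sum meval.hom_mult meval.hom_power meval_MVar by simp
        ultimately show ?thesis using insert(5)[of "f(v := s)"] by simp
      qed
      then show "meval f (q i) = 0" using i by (rule poly_all_0)
    qed
    then show ?case by (simp add: p)
  qed
  moreover have "finite (\<Union>t\<in>keys p. keys t)" "vars_in (\<Union>t\<in>keys p. keys t) p"
    by (auto simp: vars_in_def)
  ultimately show ?thesis using assms by blast
qed

lemma poly_eq_if_meval_eq:
  fixes p q :: "('v, rat) mpoly"
  assumes "\<And>f. meval f p = meval f q"
  shows "p = q"
  using meval_all_0[of "p - q"] assms by (simp add: meval.hom_minus)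

section \<open>Division with remainder by a two-by-two determinant\<close>

abbreviation det4 :: "'v \<Rightarrow> 'v \<Rightarrow> 'v \<Rightarrow> 'v \<Rightarrow> ('v, 'a::comm_ring_1) mpoly" where
  "det4 a b c d \<equiv> MVar a * MVar d - MVar b * MVar c"

text \<open>Replacing one factor \<open>ad\<close> of a monomial by \<open>(ad - bc) + bc\<close> lowers the exponent of \<open>a\<close>.  This
  ends with monomials not divisible by \<open>ad\<close>, involves integers only, and respects each grading for which \<open>ad - bc\<close>
  is homogeneous.\<close>

lemma standard_form_single:
  fixes a b c d :: 'v
  assumes dist: "distinct [a, b, c, d]"
  shows "\<exists>q r. int_coeffs q \<and> int_coeffs r \<and> single t 1 = det4 a b c d * q + r
    \<and> (\<forall>s\<in>keys r. lookup s a = 0 \<or> lookup s d = 0)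
    \<and> (\<forall>w. w a + w d = w b + w c \<longrightarrow>
         homogeneous w (weight w t) r \<and> (\<forall>s\<in>keys q. weight w s + (w a + w d) = weight w t))"
proof (induct "lookup t a" arbitrary: t)
  case 0
  then show ?case
    by (intro exI[of _ 0] exI[of _ "single t 1"]) (auto simp: int_coeffs_single homogeneous_single)
next
  case (Suc n)
  show ?case
  proof (cases "lookup t d = 0")
    case True
    then show ?thesis
      by (intro exI[of _ 0] exI[of _ "single t 1"]) (auto simp: int_coeffs_single homogeneous_single)
  next
    case False
    define t0 where "t0 = t - single a 1 - single d 1"
    define t1 where "t1 = t0 + (single b 1 + single c 1)"
    have t: "t = t0 + (single a 1 + single d 1)"
      using False Suc(2) dist
      by (intro poly_mapping_eqI)
         (auto simp: t0_def lookup_add lookup_minus lookup_single when_def)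
    have "n = lookup t1 a"
      using Suc(2) dist by (auto simp: t t1_def lookup_add lookup_single when_def)
    from Suc(1)[OF this] obtain q r where
      qr: "int_coeffs q" "int_coeffs r" "single t1 1 = det4 a b c d * q + r"
      and r: "\<forall>s\<in>keys r. lookup s a = 0 \<or> lookup s d = 0"
      and w: "\<And>w. w a + w d = w b + w c \<Longrightarrow> homogeneous w (weight w t1) r"
        "\<And>w s. w a + w d = w b + w c \<Longrightarrow> s \<in> keys q \<Longrightarrow> weight w s + (w a + w d) = weight w t1"
      by blast
    have t1: "weight w t1 = weight w t" "weight w t0 + (w a + w d) = weight w t"
      if "w a + w d = w b + w c" for w
      using that by (simp_all add: t t1_def)
    have "single t 1 = single t0 1 * (MVar a * MVar d :: ('v, rat) mpoly)"
      by (simp add: t MVar_def mult_single)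
    also have "\<dots> = det4 a b c d * single t0 1 + single t1 1"
      by (simp add: t1_def MVar_def mult_single algebra_simps)
    also have "\<dots> = det4 a b c d * (single t0 1 + q) + r"
      by (simp add: qr(3) algebra_simps)
    finally have "single t 1 = det4 a b c d * (single t0 1 + q) + r" .
    moreover have "\<forall>w. w a + w d = w b + w c \<longrightarrow>
         homogeneous w (weight w t) r \<and> (\<forall>s\<in>keys (single t0 1 + q). weight w s + (w a + w d) = weight w t)"
    proof (intro allI impI conjI ballI)
      fix w :: "'v \<Rightarrow> nat" and s
      assume balanced: "w a + w d = w b + w c"
      show "homogeneous w (weight w t) r" using w(1)[OF balanced] t1(1)[OF balanced] by simp
      assume "s \<in> keys (single t0 (1::rat) + q)"
      then have "s = t0 \<or> s \<in> keys q" using keys_add[of "single t0 1" q] by auto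
      then show "weight w s + (w a + w d) = weight w t"
        using w(2)[OF balanced] t1[OF balanced] by auto
    qed
    ultimately show ?thesis
      using qr(1,2) r
      by (intro exI[of _ "single t0 1 + q"] exI[of _ r] conjI int_coeffs_add)
         (auto simp: int_coeffs_single)
  qed
qed

lemma standard_form:
  fixes p :: "('v, rat) mpoly"
  assumes dist: "distinct [a, b, c, d]" and p: "int_coeffs p"
  obtains q r where "int_coeffs q" "int_coeffs r" "p = det4 a b c d * q + r"
    "\<And>t. t \<in> keys r \<Longrightarrow> lookup t a = 0 \<or> lookup t d = 0"
    "\<And>w n. w a + w d = w b + w c \<Longrightarrow> homogeneous w n p \<Longrightarrow> homogeneous w n r"
    "\<And>w n t. w a + w d = w b + w c \<Longrightarrow> homogeneous w n p \<Longrightarrow> t \<in> keys q \<Longrightarrow> weight w t + (w a + w d) = n"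
proof -
  obtain Q R where QR: "\<And>t. int_coeffs (Q t)" "\<And>t. int_coeffs (R t)"
    "\<And>t. single t 1 = det4 a b c d * Q t + R t"
    "\<And>s t. s \<in> keys (R t) \<Longrightarrow> lookup s a = 0 \<or> lookup s d = 0"
    and w: "\<And>w t. w a + w d = w b + w c \<Longrightarrow> homogeneous w (weight w t) (R t)"
     "\<And>w s t. w a + w d = w b + w c \<Longrightarrow> s \<in> keys (Q t) \<Longrightarrow> weight w s + (w a + w d) = weight w t"
    using standard_form_single[OF dist] by metis
  define q where "q = (\<Sum>t\<in>keys p. MConst (lookup p t) * Q t)"
  define r where "r = (\<Sum>t\<in>keys p. MConst (lookup p t) * R t)"
  have keysM: "keys (MConst c * u) \<subseteq> keys u" for c :: rat and u :: "('v, rat) mpoly"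
    using keys_mult[of "MConst c" u] by (auto simp: MConst_def split: if_splits)
  have "p = (\<Sum>t\<in>keys p. MConst (lookup p t) * single t 1)"
    by (subst mpoly_single_sum) (simp add: MConst_def mult_single)
  also have "\<dots> = det4 a b c d * q + r"
    unfolding q_def r_def sum_distrib_left sum.distrib[symmetric]
    by (rule sum.cong) (simp_all add: QR(3) algebra_simps)
  finally have "p = det4 a b c d * q + r" .
  moreover have "int_coeffs q" "int_coeffs r"
    using p unfolding q_def r_def
    by (auto intro!: int_coeffs_sum int_coeffs_mult QR simp: int_coeffs_def[of p])
  moreover have "lookup s a = 0 \<or> lookup s d = 0" if "s \<in> keys r" for s
  proof -
    from that obtain t where "s \<in> keys (MConst (lookup p t) * R t)"
      using keys_sum[of "\<lambda>t. MConst (lookup p t) * R t" "keys p"] by (auto simp: r_def)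
    then show ?thesis using keysM[of "lookup p t" "R t"] QR(4)[of s t] by auto
  qed
  moreover have "homogeneous w n r" if "w a + w d = w b + w c" "homogeneous w n p" for w n
    unfolding r_def using w(1)[OF that(1)] that(2)
    by (auto intro!: homogeneous_sum homogeneous_smult simp: homogeneous_def[of w n p])
  moreover have "weight w s + (w a + w d) = n"
    if balanced: "w a + w d = w b + w c" and p: "homogeneous w n p" and s: "s \<in> keys q" for w n s
  proof -
    from s obtain t where "t \<in> keys p" "s \<in> keys (MConst (lookup p t) * Q t)"
      using keys_sum[of "\<lambda>t. MConst (lookup p t) * Q t" "keys p"] by (auto simp: q_def)
    then show ?thesis
      using keysM[of "lookup p t" "Q t"] w(2)[OF balanced, of s t] p by (auto simp: homogeneous_def)
  qed
  ultimately show thesis using that by blast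
qed

section \<open>Matrices, vectors and the two actions in one polynomial ring\<close>

text \<open>Besides the entries \<open>(i, j, k)\<close> with \<open>i, j < 2\<close> of the generic matrices, the variables
  \<open>(i, 2, k)\<close> and \<open>(2, j, k)\<close> serve as the coordinates of two vectors \<open>u\<^sub>k\<close> and \<open>v\<^sub>k\<close>.  An index \<open>2\<close> says that
  the corresponding factor of the group acts trivially.  Thus one rule describes the action on matrices and on vectors, and
  the specialisation of a matrix to \<open>u\<^sub>k v\<^sub>k\<^sup>T\<close> is an endomorphism of one ring.  A label \<open>(True, k)\<close> stands for \<open>u\<^sub>k\<close>,
  a label \<open>(False, k)\<close> for \<open>v\<^sub>k\<close>.\<close>

fun vec_var :: "bool \<times> nat \<Rightarrow> nat \<Rightarrow> xvar" where
  "vec_var (True, k) i = (i, 2, k)"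
| "vec_var (False, k) i = (2, i, k)"

definition UV :: "xvar set" where
  "UV = {vec_var y i | y i. i < 2}"

text \<open>An entry of \<open>x\<^sub>k\<close> has degree one both for \<open>(True, k)\<close> and for \<open>(False, k)\<close>,
  just as the entry of \<open>u\<^sub>k v\<^sub>k\<^sup>T\<close> to which it specialises.\<close>

fun label_weight :: "bool \<times> nat \<Rightarrow> xvar \<Rightarrow> nat" where
  "label_weight (c, k) (i, j, l) = (if l = k \<and> (if c then i else j) < 2 then 1 else 0)"

definition multihom :: "(bool \<times> nat \<Rightarrow> nat) \<Rightarrow> (xvar, rat) mpoly \<Rightarrow> bool" where
  "multihom d p \<longleftrightarrow> (\<forall>y. homogeneous (label_weight y) (d y) p)"

fun sl_subst :: "bool \<Rightarrow> rat \<Rightarrow> rat \<Rightarrow> rat \<Rightarrow> rat \<Rightarrow> xvar \<Rightarrow> (xvar, rat) mpoly" where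
  "sl_subst True \<alpha> \<beta> \<gamma> \<delta> (i, j, k) =
    (if i = 0 then MConst \<alpha> * MVar (0, j, k) + MConst \<beta> * MVar (1, j, k)
     else if i = 1 then MConst \<gamma> * MVar (0, j, k) + MConst \<delta> * MVar (1, j, k)
     else MVar (i, j, k))"
| "sl_subst False \<alpha> \<beta> \<gamma> \<delta> (i, j, k) =
    (if j = 0 then MConst \<alpha> * MVar (i, 0, k) + MConst \<beta> * MVar (i, 1, k)
     else if j = 1 then MConst \<gamma> * MVar (i, 0, k) + MConst \<delta> * MVar (i, 1, k)
     else MVar (i, j, k))"

text \<open>Invariance is required as an identity of polynomials, for each factor of the group separately.\<close>

definition sl_inv :: "(xvar, rat) mpoly \<Rightarrow> bool" where
  "sl_inv p \<longleftrightarrow> (\<forall>c \<alpha> \<beta> \<gamma> \<delta>. \<alpha> * \<delta> - \<beta> * \<gamma> = 1 \<longrightarrow> subst (sl_subst c \<alpha> \<beta> \<gamma> \<delta>) p = p)"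

definition bracket :: "bool \<times> nat \<Rightarrow> bool \<times> nat \<Rightarrow> (xvar, rat) mpoly" where
  "bracket y z = det4 (vec_var y 0) (vec_var y 1) (vec_var z 0) (vec_var z 1)"

lemma less_2_iff: "i < 2 \<longleftrightarrow> i = 0 \<or> i = (1::nat)" by auto

lemma vec_var_in_UV [simp]: "i < 2 \<Longrightarrow> vec_var y i \<in> UV" unfolding UV_def by blast

lemma UV_cases:
  assumes "v \<in> UV" obtains y where "v = vec_var y 0" | y where "v = vec_var y 1"
  using assms by (auto simp: UV_def less_2_iff)

lemma vec_var_eq_iff: "i < 2 \<Longrightarrow> j < 2 \<Longrightarrow> vec_var y i = vec_var z j \<longleftrightarrow> y = z \<and> i = j"
  by (cases y; cases z; cases "fst y"; cases "fst z") auto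

lemma label_weight_vec_var: "i < 2 \<Longrightarrow> label_weight y (vec_var z i) = of_bool (y = z)"
  by (cases y; cases z; cases "fst z") auto

lemma sl_subst_vec_var:
  "sl_subst c \<alpha> \<beta> \<gamma> \<delta> (vec_var y 0) =
    (if fst y = c then MConst \<alpha> * MVar (vec_var y 0) + MConst \<beta> * MVar (vec_var y 1) else MVar (vec_var y 0))"
  "sl_subst c \<alpha> \<beta> \<gamma> \<delta> (vec_var y 1) =
    (if fst y = c then MConst \<gamma> * MVar (vec_var y 0) + MConst \<delta> * MVar (vec_var y 1) else MVar (vec_var y 1))"
  by (cases y; cases "fst y"; cases c; simp)+

lemma homogeneous_sl_subst: "homogeneous (label_weight y) (label_weight y v) (sl_subst c \<alpha> \<beta> \<gamma> \<delta> v)"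
  by (cases y; cases v; cases c) (auto intro!: homogeneous_add homogeneous_smult)

lemma multihom_0 [simp]: "multihom d 0"
  and multihom_1 [simp]: "multihom (\<lambda>_. 0) 1"
  and multihom_add: "multihom d p \<Longrightarrow> multihom d q \<Longrightarrow> multihom d (p + q)"
  and multihom_diff: "multihom d p \<Longrightarrow> multihom d q \<Longrightarrow> multihom d (p - q)"
  and multihom_uminus [simp]: "multihom d (- p) \<longleftrightarrow> multihom d p"
  by (auto simp: multihom_def intro: homogeneous_add homogeneous_diff)

lemma multihom_mult: "multihom d p \<Longrightarrow> multihom e q \<Longrightarrow> multihom (\<lambda>y. d y + e y) (p * q)"
  by (auto simp: multihom_def intro: homogeneous_mult)

lemma multihom_sl_subst: "multihom d p \<Longrightarrow> multihom d (subst (sl_subst c \<alpha> \<beta> \<gamma> \<delta>) p)"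
  by (auto simp: multihom_def intro: homogeneous_subst homogeneous_sl_subst)

lemma sl_inv_add: "sl_inv p \<Longrightarrow> sl_inv q \<Longrightarrow> sl_inv (p + q)"
  and sl_inv_diff: "sl_inv p \<Longrightarrow> sl_inv q \<Longrightarrow> sl_inv (p - q)"
  and sl_inv_mult: "sl_inv p \<Longrightarrow> sl_inv q \<Longrightarrow> sl_inv (p * q)"
  and sl_inv_0 [simp]: "sl_inv 0"
  and sl_inv_1 [simp]: "sl_inv 1"
  by (simp_all add: sl_inv_def subst.hom_add subst.hom_mult subst.hom_minus)

lemma sl_inv_subst:
  assumes "sl_inv p" "\<And>c \<alpha> \<beta> \<gamma> \<delta> v. subst (sl_subst c \<alpha> \<beta> \<gamma> \<delta>) (f v) = subst f (sl_subst c \<alpha> \<beta> \<gamma> \<delta> v)"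
  shows "sl_inv (subst f p)"
  unfolding sl_inv_def
proof (intro allI impI)
  fix c and \<alpha> \<beta> \<gamma> \<delta> :: rat assume "\<alpha> * \<delta> - \<beta> * \<gamma> = 1"
  with assms(1) have "subst (sl_subst c \<alpha> \<beta> \<gamma> \<delta>) p = p" by (simp add: sl_inv_def)
  then show "subst (sl_subst c \<alpha> \<beta> \<gamma> \<delta>) (subst f p) = subst f p"
    by (subst subst_commute[OF assms(2)]) simp
qed

lemma MConst_diff: "MConst (a - b) = MConst a - MConst b"
  by (rule MConst.hom_minus)

lemma MConst_mult: "MConst (a * b) = MConst a * MConst b"
  by (rule MConst.hom_mult)

lemma two_by_two_det:
  fixes a b c d x y z w :: "'a::comm_ring_1"
  assumes "a * d - b * c = 1"
  shows "(a * x + b * y) * (c * z + d * w) - (c * x + d * y) * (a * z + b * w) = x * w - y * z"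
proof -
  have "(a * x + b * y) * (c * z + d * w) - (c * x + d * y) * (a * z + b * w)
      = (a * d - b * c) * (x * w - y * z)" by (simp add: algebra_simps)
  then show ?thesis using assms by simp
qed

lemma MConst_det: "\<alpha> * \<delta> - \<beta> * \<gamma> = 1 \<Longrightarrow> MConst \<alpha> * MConst \<delta> - MConst \<beta> * MConst \<gamma> = 1"
  by (metis MConst_diff MConst_mult MConst.hom_one)

lemma sl_inv_bracket: "fst y = fst z \<Longrightarrow> sl_inv (bracket y z)"
  by (auto simp: sl_inv_def bracket_def subst.hom_minus subst.hom_mult sl_subst_vec_var two_by_two_det[OF MConst_det]
      simp del: One_nat_def)

lemma multihom_bracket: "multihom (\<lambda>x. of_bool (x = y) + of_bool (x = z)) (bracket y z)"
  unfolding multihom_def bracket_def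
  by (intro allI homogeneous_diff homogeneous_mult_eq[OF iffD2[OF homogeneous_MVar refl] iffD2[OF homogeneous_MVar refl]])
     (simp_all add: label_weight_vec_var)

lemma int_coeffs_bracket: "int_coeffs (bracket y z)"
  unfolding bracket_def by (intro int_coeffs_diff int_coeffs_mult) simp_all

lemma vars_in_bracket: "vars_in UV (bracket y z)"
  unfolding bracket_def by (intro vars_in_diff vars_in_mult) simp_all

lemma bracket_swap: "bracket y z = - bracket z y"
  by (simp add: bracket_def algebra_simps)

lemma bracket_self [simp]: "bracket y y = 0"
  by (simp add: bracket_def algebra_simps)

section \<open>Division in the ring of invariants\<close>

lemma weight_support:
  assumes "finite S" "\<And>v. v \<in> keys t \<Longrightarrow> w v \<noteq> 0 \<Longrightarrow> v \<in> S"
  shows "weight w t = (\<Sum>v\<in>S. w v * lookup t v)"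
proof -
  have "weight w t = (\<Sum>v\<in>S \<union> keys t. w v * lookup t v)"
    by (rule weight_superset) (use assms in auto)
  also have "\<dots> = (\<Sum>v\<in>S. w v * lookup t v)"
    by (rule sum.mono_neutral_right) (use assms in \<open>auto simp: in_keys_iff\<close>)
  finally show ?thesis .
qed

lemma det4_nonzero:
  assumes "distinct [a, b, c, d]" shows "det4 a b c d \<noteq> (0 :: ('v, rat) mpoly)"
proof
  assume *: "det4 a b c d = (0 :: ('v, rat) mpoly)"
  have "meval (\<lambda>v. of_bool (v = a \<or> v = d)) (det4 a b c d :: ('v, rat) mpoly) = 1"
    using assms by (auto simp: meval.hom_minus meval.hom_mult)
  then show False by (simp add: *)
qed

text \<open>The remainder of \<open>p\<close> in standard form is killed by \<open>f\<close>, hence zero, because \<open>f\<close> separates the monomials in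
  standard form.  The quotient is invariant since a nonzero invariant factor can be cancelled.  This applies to a bracket
  of two vectors, with \<open>f\<close> identifying the vectors, and to the determinant of a generic matrix, with \<open>f\<close>
  specialising it to rank one.\<close>

lemma divide_invariant:
  fixes a b c d :: xvar
  assumes dist: "distinct [a, b, c, d]" and inV: "{a, b, c, d} \<subseteq> V"
    and balanced: "\<And>y. label_weight y a + label_weight y d = label_weight y b + label_weight y c"
    and inv_det: "sl_inv (det4 a b c d)"
    and p: "int_coeffs p" "sl_inv p" "multihom \<delta> p" "vars_in V p"
    and f: "\<And>v. f v = single (e v) 1"
    and f_det: "subst f (det4 a b c d) = 0" and f_p: "subst f p = 0"
    and inj: "\<And>s t. keys s \<subseteq> V \<Longrightarrow> keys t \<subseteq> V \<Longrightarrow>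
      (\<And>y. weight (label_weight y) s = \<delta> y) \<Longrightarrow> (\<And>y. weight (label_weight y) t = \<delta> y) \<Longrightarrow>
      lookup s a = 0 \<or> lookup s d = 0 \<Longrightarrow> lookup t a = 0 \<or> lookup t d = 0 \<Longrightarrow>
      (\<And>u. weight (\<lambda>v. lookup (e v) u) s = weight (\<lambda>v. lookup (e v) u) t) \<Longrightarrow> s = t"
  obtains q where "p = det4 a b c d * q" "int_coeffs q" "sl_inv q" "vars_in V q"
    "\<And>y t. t \<in> keys q \<Longrightarrow> weight (label_weight y) t + (label_weight y a + label_weight y d) = \<delta> y"
proof -
  obtain q r where q: "int_coeffs q" and r: "int_coeffs r" and pqr: "p = det4 a b c d * q + r"
    and std: "\<And>t. t \<in> keys r \<Longrightarrow> lookup t a = 0 \<or> lookup t d = 0"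
    and w_r: "\<And>w n. w a + w d = w b + w c \<Longrightarrow> homogeneous w n p \<Longrightarrow> homogeneous w n r"
    and w_q: "\<And>w n t. w a + w d = w b + w c \<Longrightarrow> homogeneous w n p \<Longrightarrow> t \<in> keys q \<Longrightarrow> weight w t + (w a + w d) = n"
    by (rule standard_form[OF dist p(1)]) blast
  let ?i = "\<lambda>v. if v \<in> V then 0 else 1 :: nat"
  have i: "?i a + ?i d = ?i b + ?i c" "?i a + ?i d = 0" using inV by auto
  have "r = 0"
  proof (rule monomial_subst_eq_0[OF f])
    show "subst f r = 0" using f_p f_det by (simp add: pqr subst.hom_add subst.hom_mult)
    fix s t assume st: "s \<in> keys r" "t \<in> keys r"
      and eq: "\<And>u. weight (\<lambda>v. lookup (e v) u) s = weight (\<lambda>v. lookup (e v) u) t"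
    have "vars_in V r" using w_r[OF i(1)] p(4) by (simp add: vars_in_iff_homogeneous)
    moreover have "homogeneous (label_weight y) (\<delta> y) r" for y
      by (rule w_r[OF balanced]) (use p(3)[unfolded multihom_def] in blast)
    then have "multihom \<delta> r" by (simp add: multihom_def)
    ultimately show "s = t"
      using st eq std by (intro inj) (auto simp: vars_in_def multihom_def homogeneous_def)
  qed
  then have pq: "p = det4 a b c d * q" by (simp add: pqr)
  have "vars_in V q"
    unfolding vars_in_iff_homogeneous homogeneous_def using w_q[OF i(1)] p(4) i(2) by (simp add: vars_in_iff_homogeneous)
  moreover have "sl_inv q"
    unfolding sl_inv_def
  proof (intro allI impI)
    fix g and \<alpha> \<beta> \<gamma> \<epsilon> :: rat assume "\<alpha> * \<epsilon> - \<beta> * \<gamma> = 1"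
    with p(2) inv_det have "subst (sl_subst g \<alpha> \<beta> \<gamma> \<epsilon>) p = p"
      "subst (sl_subst g \<alpha> \<beta> \<gamma> \<epsilon>) (det4 a b c d) = det4 a b c d" by (simp_all add: sl_inv_def)
    then have "det4 a b c d * subst (sl_subst g \<alpha> \<beta> \<gamma> \<epsilon>) q = det4 a b c d * q"
      by (simp only: pq subst.hom_mult)
    then show "subst (sl_subst g \<alpha> \<beta> \<gamma> \<epsilon>) q = q" using det4_nonzero[OF dist] by simp
  qed
  moreover have "weight (label_weight y) t + (label_weight y a + label_weight y d) = \<delta> y" if "t \<in> keys q" for y t
    by (rule w_q[OF balanced _ that]) (use p(3)[unfolded multihom_def] in blast)
  ultimately show thesis using that pq q by blast
qed

section \<open>Integral invariants of vectors are spanned by products of brackets\<close>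

text \<open>The function \<open>d\<close> records how often each vector occurs.\<close>

inductive bracket_monomial :: "(bool \<times> nat \<Rightarrow> nat) \<Rightarrow> (xvar, rat) mpoly \<Rightarrow> bool" where
  one: "bracket_monomial (\<lambda>_. 0) 1"
| mult: "fst y = fst z \<Longrightarrow> y \<noteq> z \<Longrightarrow> bracket_monomial d p \<Longrightarrow>
    bracket_monomial (\<lambda>x. d x + of_bool (x = y) + of_bool (x = z)) (bracket y z * p)"

inductive bracket_span :: "(bool \<times> nat \<Rightarrow> nat) \<Rightarrow> (xvar, rat) mpoly \<Rightarrow> bool" where
  zero: "bracket_span d 0"
| add: "bracket_monomial d b \<Longrightarrow> bracket_span d p \<Longrightarrow> bracket_span d (p + b)"
| diff: "bracket_monomial d b \<Longrightarrow> bracket_span d p \<Longrightarrow> bracket_span d (p - b)"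

lemma bracket_span_add: "bracket_span d p \<Longrightarrow> bracket_span d q \<Longrightarrow> bracket_span d (p + q)"
  by (induct rule: bracket_span.induct)
     (simp_all add: bracket_span.add bracket_span.diff add.assoc[symmetric] add.commute[of _ q] add_diff_eq)

lemma bracket_span_bracket:
  assumes "bracket_span d p" "fst y = fst z" "y \<noteq> z"
  shows "bracket_span (\<lambda>x. d x + of_bool (x = y) + of_bool (x = z)) (bracket y z * p)"
  using assms
  by (induct rule: bracket_span.induct)
     (auto simp: distrib_left right_diff_distrib intro: bracket_span.intros bracket_monomial.mult)

lemma bracket_monomial_props:
  assumes "bracket_monomial d p" shows "int_coeffs p \<and> sl_inv p \<and> multihom d p \<and> vars_in UV p"
  using assms
proof induct
  case (mult y z d p)
  have "multihom (\<lambda>x. of_bool (x = y) + of_bool (x = z) + d x) (bracket y z * p)"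
    by (rule multihom_mult[OF multihom_bracket]) (use mult in auto)
  moreover have "(\<lambda>x. of_bool (x = y) + of_bool (x = z) + d x)
    = (\<lambda>x. d x + of_bool (x = y) + of_bool (x = z))" by (simp add: add_ac)
  ultimately show ?case
    using mult by (auto intro: int_coeffs_mult int_coeffs_bracket sl_inv_mult sl_inv_bracket vars_in_mult vars_in_bracket)
qed simp

lemma bracket_span_props:
  assumes "bracket_span d p" shows "int_coeffs p \<and> sl_inv p \<and> multihom d p \<and> vars_in UV p"
  using assms
  by induct (auto dest!: bracket_monomial_props intro: int_coeffs_add sl_inv_add multihom_add vars_in_add
      int_coeffs_diff sl_inv_diff multihom_diff vars_in_diff)

definition merge_var :: "bool \<times> nat \<Rightarrow> bool \<times> nat \<Rightarrow> xvar \<Rightarrow> xvar" where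
  "merge_var y z v = (if v = vec_var z 0 then vec_var y 0 else if v = vec_var z 1 then vec_var y 1 else v)"

abbreviation merge :: "bool \<times> nat \<Rightarrow> bool \<times> nat \<Rightarrow> (xvar, rat) mpoly \<Rightarrow> (xvar, rat) mpoly" where
  "merge y z \<equiv> subst (\<lambda>v. MVar (merge_var y z v))"

lemma merge_var_vec_var: "i < 2 \<Longrightarrow> merge_var y z (vec_var x i) = vec_var (if x = z then y else x) i"
  by (auto simp: merge_var_def vec_var_eq_iff less_2_iff)

lemma merge_bracket: "merge y z (bracket a b) = bracket (if a = z then y else a) (if b = z then y else b)"
  by (simp add: bracket_def subst.hom_minus subst.hom_mult merge_var_vec_var)

lemma UV_iff: "(i, j, k) \<in> UV \<longleftrightarrow> i < 2 \<and> j = 2 \<or> i = 2 \<and> j < 2"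
proof
  assume "(i, j, k) \<in> UV"
  then obtain c l n where "(i, j, k) = vec_var (c, l) n" "n < 2" by (auto simp: UV_def)
  then show "i < 2 \<and> j = 2 \<or> i = 2 \<and> j < 2" by (cases c) auto
next
  assume "i < 2 \<and> j = 2 \<or> i = 2 \<and> j < 2"
  then show "(i, j, k) \<in> UV"
    using vec_var_in_UV[of i "(True, k)"] vec_var_in_UV[of j "(False, k)"] by auto
qed

lemma merge_sl_subst:
  assumes "fst y = fst z"
  shows "subst (sl_subst c \<alpha> \<beta> \<gamma> \<delta>) (MVar (merge_var y z v)) = merge y z (sl_subst c \<alpha> \<beta> \<gamma> \<delta> v)"
proof (cases "v \<in> UV")
  case True
  then show ?thesis
    by (rule UV_cases) (auto simp: merge_var_vec_var sl_subst_vec_var assms subst.hom_add subst.hom_mult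
        simp del: One_nat_def)
next
  case False
  have m: "merge_var y z u = u" if "u \<notin> UV" for u
    using that by (auto simp: merge_var_def)
  obtain i j k where v: "v = (i, j, k)" by (cases v)
  show ?thesis
    using False by (cases c) (auto simp: v m UV_iff subst.hom_add subst.hom_mult)
qed

text \<open>In a product of brackets of vectors other than \<open>z\<close>, any \<open>l\<close> of the occurrences of \<open>y\<close> may be replaced
  by \<open>z\<close>.  A bracket contains \<open>y\<close> at most once, so that the occurrences can be treated one bracket at a time.\<close>

lemma bracket_monomial_lift:
  assumes "bracket_monomial d p" "fst y = fst z" "y \<noteq> z" "d z = 0" "d y = k + l"
  shows "\<exists>q. bracket_monomial (d(y := k, z := l)) q \<and> merge y z q = p"
  using assms
proof (induct arbitrary: k l rule: bracket_monomial.induct)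
  case one
  then have "(\<lambda>_. 0)(y := k, z := l) = (\<lambda>_. 0)" by auto
  then show ?case by (metis bracket_monomial.one subst.hom_one)
next
  case (mult a b d p)
  let ?D = "\<lambda>x. d x + of_bool (x = a) + of_bool (x = b)"
  have ab: "a \<noteq> z" "b \<noteq> z" "d z = 0" using mult(7) by (auto split: if_splits)
  consider (none) "a \<noteq> y" "b \<noteq> y" | (keep) "a = y \<or> b = y" "k \<noteq> 0"
    | (a) "a = y" "k = 0" | (b) "b = y" "k = 0" by auto
  then show ?case
  proof cases
    case none
    then have "d y = (k) + (l)" using mult(2,8) by auto
    from mult(4)[OF mult(5,6) ab(3) this]
    obtain q where q: "bracket_monomial (d(y := k, z := l)) q" "merge y z q = p" by blast
    have eq: "(\<lambda>x. (d(y := k, z := l)) x + of_bool (x = a) + of_bool (x = b)) = ?D(y := k, z := l)"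
      using none ab by auto
    have "bracket_monomial (?D(y := k, z := l)) (bracket a b * q)"
      using bracket_monomial.mult[OF mult(1,2) q(1)] by (simp only: eq)
    moreover have "merge y z (bracket a b * q) = bracket a b * p"
      using q(2) ab by (simp add: subst.hom_mult merge_bracket)
    ultimately show ?thesis by blast
  next
    case keep
    then have "d y = (k - 1) + (l)" using mult(2,8) by auto
    from mult(4)[OF mult(5,6) ab(3) this]
    obtain q where q: "bracket_monomial (d(y := k - 1, z := l)) q" "merge y z q = p" by blast
    have eq: "(\<lambda>x. (d(y := k - 1, z := l)) x + of_bool (x = a) + of_bool (x = b)) = ?D(y := k, z := l)"
      using keep ab mult(2) by auto
    have "bracket_monomial (?D(y := k, z := l)) (bracket a b * q)"
      using bracket_monomial.mult[OF mult(1,2) q(1)] by (simp only: eq)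
    moreover have "merge y z (bracket a b * q) = bracket a b * p"
      using q(2) ab by (simp add: subst.hom_mult merge_bracket)
    ultimately show ?thesis by blast
  next
    case a
    then have "d y = (k) + (l - 1)" using mult(2,8) by auto
    from mult(4)[OF mult(5,6) ab(3) this]
    obtain q where q: "bracket_monomial (d(y := k, z := l - 1)) q" "merge y z q = p" by blast
    have eq: "(\<lambda>x. (d(y := k, z := l - 1)) x + of_bool (x = z) + of_bool (x = b)) = ?D(y := k, z := l)"
      using a ab mult(2,8) by auto
    have zf: "fst z = fst b" using mult(1,5) a by simp
    have "z \<noteq> b" using ab by simp
    from bracket_monomial.mult[OF zf this q(1)] have "bracket_monomial (?D(y := k, z := l)) (bracket z b * q)"
      by (simp only: eq)
    moreover have "merge y z (bracket z b * q) = bracket a b * p"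
      using q(2) ab a by (simp add: subst.hom_mult merge_bracket)
    ultimately show ?thesis by blast
  next
    case b
    then have "d y = (k) + (l - 1)" using mult(2,8) by auto
    from mult(4)[OF mult(5,6) ab(3) this]
    obtain q where q: "bracket_monomial (d(y := k, z := l - 1)) q" "merge y z q = p" by blast
    have eq: "(\<lambda>x. (d(y := k, z := l - 1)) x + of_bool (x = a) + of_bool (x = z)) = ?D(y := k, z := l)"
      using b ab mult(2,8) by auto
    have zf: "fst a = fst z" using mult(1,5) b by simp
    have "a \<noteq> z" using ab by simp
    from bracket_monomial.mult[OF zf this q(1)] have "bracket_monomial (?D(y := k, z := l)) (bracket a z * q)"
      by (simp only: eq)
    moreover have "merge y z (bracket a z * q) = bracket a b * p"
      using q(2) ab b by (simp add: subst.hom_mult merge_bracket)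
    ultimately show ?thesis by blast
  qed
qed

lemma bracket_span_lift:
  assumes "bracket_span d p" "fst y = fst z" "y \<noteq> z" "d z = 0" "d y = k + l"
  shows "\<exists>q. bracket_span (d(y := k, z := l)) q \<and> merge y z q = p"
  using assms
proof (induct rule: bracket_span.induct)
  case (zero d)
  then show ?case using bracket_span.zero subst.hom_zero by blast
next
  case (add d b p)
  then obtain q q' where "bracket_span (d(y := k, z := l)) q" "merge y z q = p"
    "bracket_monomial (d(y := k, z := l)) q'" "merge y z q' = b"
    using bracket_monomial_lift by meson
  then show ?case
    using bracket_span.add subst.hom_add by metis
next
  case (diff d b p)
  then obtain q q' where "bracket_span (d(y := k, z := l)) q" "merge y z q = p"
    "bracket_monomial (d(y := k, z := l)) q'" "merge y z q' = b"
    using bracket_monomial_lift by meson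
  then show ?case
    using bracket_span.diff subst.hom_minus by metis
qed

lemma homogeneous_add_weight: "homogeneous w n p \<Longrightarrow> homogeneous w' n' p \<Longrightarrow> homogeneous (\<lambda>v. w v + w' v) (n + n') p"
  by (auto simp: homogeneous_def weight_def sum.distrib distrib_right)

lemma multihom_merge:
  assumes "multihom d p" "vars_in UV p" "y \<noteq> z"
  shows "multihom (d(y := d y + d z, z := 0)) (merge y z p)"
  unfolding multihom_def
proof
  fix x
  have h: "homogeneous (label_weight x) (d x) p" for x using assms(1) unfolding multihom_def by blast
  consider "x = y" | "x = z" | "x \<noteq> y" "x \<noteq> z" by blast
  then show "homogeneous (label_weight x) ((d(y := d y + d z, z := 0)) x) (merge y z p)"
  proof cases
    case 1
    have "homogeneous (label_weight y) (d y + d z) (merge y z p)"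
      by (rule homogeneous_subst_on[OF homogeneous_add_weight[OF h h] assms(2)])
         (use assms(3) in \<open>auto elim!: UV_cases simp: merge_var_vec_var label_weight_vec_var\<close>)
    then show ?thesis using 1 assms(3) by simp
  next
    case 2
    have "homogeneous (\<lambda>_. 0) 0 p" by (simp add: homogeneous_def weight_def)
    then have "homogeneous (label_weight z) 0 (merge y z p)"
      by (rule homogeneous_subst_on[OF _ assms(2)])
         (use assms(3) in \<open>auto elim!: UV_cases simp: merge_var_vec_var label_weight_vec_var\<close>)
    then show ?thesis using 2 by simp
  next
    case 3
    have "homogeneous (label_weight x) (d x) (merge y z p)"
      by (rule homogeneous_subst_on[OF h assms(2)])
         (use 3 in \<open>auto elim!: UV_cases simp: merge_var_vec_var label_weight_vec_var\<close>)
    then show ?thesis using 3 by simp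
  qed
qed

lemma weight_label_weight_UV:
  assumes "keys t \<subseteq> UV"
  shows "weight (label_weight y) t = lookup t (vec_var y 0) + lookup t (vec_var y 1)"
proof -
  have "weight (label_weight y) t = (\<Sum>v\<in>{vec_var y 0, vec_var y 1}. label_weight y v * lookup t v)"
    by (rule weight_support) (use assms in \<open>auto elim!: UV_cases simp: label_weight_vec_var split: if_splits\<close>)
  then show ?thesis by (simp add: vec_var_eq_iff label_weight_vec_var)
qed

text \<open>Write \<open>y\<^sub>0, y\<^sub>1, z\<^sub>0, z\<^sub>1\<close> for the exponents of the four coordinates.  The degrees and the image give
  the row and column sums of this two-by-two array, and one of \<open>y\<^sub>0\<close> and \<open>z\<^sub>1\<close> vanishes; these data
  determine the array.\<close>

lemma merge_inj:
  assumes st: "keys s \<subseteq> UV" "keys t \<subseteq> UV" and yz: "y \<noteq> z"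
    and d: "\<And>x. weight (label_weight x) s = d x" "\<And>x. weight (label_weight x) t = d x"
    and std: "lookup s (vec_var y 0) = 0 \<or> lookup s (vec_var z 1) = 0"
      "lookup t (vec_var y 0) = 0 \<or> lookup t (vec_var z 1) = 0"
    and eq: "\<And>u. weight (\<lambda>v. lookup (single (merge_var y z v) 1) u) s
      = weight (\<lambda>v. lookup (single (merge_var y z v) 1) u) t"
  shows "s = t"
proof (rule poly_mapping_eqI)
  have "weight (\<lambda>v. lookup (single (merge_var y z v) 1) (vec_var y i)) r
      = lookup r (vec_var y i) + lookup r (vec_var z i)" if i: "i < 2" and r: "keys r \<subseteq> UV" for r i
  proof -
    have "weight (\<lambda>v. lookup (single (merge_var y z v) 1) (vec_var y i)) r
       = (\<Sum>v\<in>{vec_var y i, vec_var z i}. lookup (single (merge_var y z v) 1) (vec_var y i) * lookup r v)"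
      by (rule weight_support)
         (use r i in \<open>auto elim!: UV_cases simp: merge_var_vec_var vec_var_eq_iff lookup_single when_def split: if_splits\<close>)
    then show ?thesis using i yz by (simp add: vec_var_eq_iff merge_var_vec_var)
  qed
  note e = this[OF _ st(1)] this[OF _ st(2)]
  have sums: "lookup s (vec_var y i) + lookup s (vec_var z i) = lookup t (vec_var y i) + lookup t (vec_var z i)"
    if "i < 2" for i
    using eq[of "vec_var y i"] e[OF that] by simp
  note s0 = sums[of 0] and s1 = sums[of 1]
  have degs: "lookup s (vec_var x 0) + lookup s (vec_var x 1) = lookup t (vec_var x 0) + lookup t (vec_var x 1)" for x
    using d[of x] weight_label_weight_UV[OF st(1), of x] weight_label_weight_UV[OF st(2), of x] by simp
  have yz_eq: "lookup s (vec_var y 0) = lookup t (vec_var y 0)" "lookup s (vec_var y 1) = lookup t (vec_var y 1)"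
    "lookup s (vec_var z 0) = lookup t (vec_var z 0)" "lookup s (vec_var z 1) = lookup t (vec_var z 1)"
    using std s0 s1 degs[of y] degs[of z] by auto
  fix u
  show "lookup s u = lookup t u"
  proof (cases "u \<in> {vec_var y 0, vec_var y 1, vec_var z 0, vec_var z 1}")
    case True
    then show ?thesis using yz_eq by auto
  next
    case False
    have "weight (\<lambda>v. lookup (single (merge_var y z v) 1) u) r = lookup r u" for r
    proof -
      have "weight (\<lambda>v. lookup (single (merge_var y z v) 1) u) r
         = (\<Sum>v\<in>{u}. lookup (single (merge_var y z v) 1) u * lookup r v)"
        by (rule weight_support)
           (use False in \<open>auto simp: merge_var_def lookup_single when_def split: if_splits\<close>)
      then show ?thesis using False by (simp add: merge_var_def)
    qed
    then show ?thesis using eq[of u] by simp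
  qed
qed

text \<open>If \<open>y\<close> is the only vector of its kind, a shear moves it to a multiple of \<open>(1, 0)\<close> whenever its first
  coordinate is nonzero, and there the diagonal matrix with entries \<open>2\<close> and \<open>1/2\<close> multiplies the value by
  \<open>2 ^ d y\<close> without changing it.\<close>

lemma single_vector_invariant_0:
  assumes F: "sl_inv F" "multihom d F" "vars_in UV F" and y: "d y > 0"
    and only: "\<And>z. fst z = fst y \<Longrightarrow> z \<noteq> y \<Longrightarrow> d z = 0"
  shows "F = 0"
proof -
  define V where "V = {vec_var x i | x i. i < 2 \<and> (fst x = fst y \<longrightarrow> x = y)}"
  have V: "vars_in V F"
    unfolding vars_in_def
  proof (intro ballI subsetI)
    fix t v assume t: "t \<in> keys F" and v: "v \<in> keys t"
    then obtain x i where x: "v = vec_var x i" "i < 2" using F(3) unfolding vars_in_def UV_def by blast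
    have "weight (label_weight x) t \<noteq> 0" using v x label_weight_vec_var[OF x(2), of x x] by (auto simp: weight_eq_0_iff intro!: bexI[of _ v])
    then have "d x \<noteq> 0" using F(2) t unfolding multihom_def homogeneous_def by metis
    then have xy: "fst x = fst y \<longrightarrow> x = y" using only[of x] by auto
    show "v \<in> V" unfolding V_def mem_Collect_eq using x xy by blast
  qed
  have inv: "meval f F = meval (\<lambda>v. meval f (sl_subst (fst y) \<alpha> \<beta> \<gamma> \<delta> v)) F"
    if "\<alpha> * \<delta> - \<beta> * \<gamma> = 1" for f \<alpha> \<beta> \<gamma> \<delta>
  proof -
    have "subst (sl_subst (fst y) \<alpha> \<beta> \<gamma> \<delta>) F = F" using F(1) that unfolding sl_inv_def by blast
    then show ?thesis by (simp flip: meval_subst)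
  qed
  have V_cases: "(\<exists>x. v = vec_var x 0 \<and> fst x \<noteq> fst y \<and> y \<noteq> x) \<or> (\<exists>x. v = vec_var x 1 \<and> fst x \<noteq> fst y \<and> y \<noteq> x)
      \<or> v = vec_var y 0 \<or> v = vec_var y 1" if "v \<in> V" for v
    using that unfolding V_def mem_Collect_eq less_2_iff by blast
  note simps = sl_subst_vec_var vec_var_eq_iff label_weight_vec_var meval.hom_add meval.hom_mult
  have zero: "meval f F = 0" if f1: "f (vec_var y 1) = 0" for f
  proof -
    have "meval f F = meval (\<lambda>v. meval f (sl_subst (fst y) 2 0 0 (1/2) v)) F"
      by (rule inv) simp
    also have "\<dots> = meval (\<lambda>v. 2 ^ label_weight y v * f v) F"
      by (rule meval_cong_on[OF V], drule V_cases, elim disjE exE conjE)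
         (simp_all add: simps f1 del: One_nat_def)
    also have "\<dots> = 2 ^ d y * meval f F"
      by (rule meval_scale) (use F(2)[unfolded multihom_def] in blast)
    finally have "(2 ^ d y - 1) * meval f F = 0" by (simp add: algebra_simps)
    moreover have "(2::rat) ^ d y > 1" using y by (intro one_less_power) auto
    ultimately show ?thesis by auto
  qed
  have "meval f (MVar (vec_var y 0) * F) = 0" for f
  proof (cases "f (vec_var y 0) = 0")
    case False
    have "meval f F = meval (\<lambda>v. meval f (sl_subst (fst y) 1 0 (- f (vec_var y 1) / f (vec_var y 0)) 1 v)) F"
      by (rule inv) simp
    also have "\<dots> = 0"
      by (rule zero) (use False in \<open>simp add: simps del: One_nat_def\<close>)
    finally show ?thesis by (simp add: meval.hom_mult)
  qed (simp add: meval.hom_mult)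
  then have "MVar (vec_var y 0) * F = 0" by (rule meval_all_0)
  moreover have "MVar v \<noteq> (0 :: (xvar, rat) mpoly)" for v
    using meval_MVar[of "\<lambda>_. 1 :: rat" v] by (intro notI) simp
  ultimately show ?thesis by simp
qed

lemma bracket_span_int: "bracket_span (\<lambda>_. 0) (MConst (of_int n))"
proof (induct n rule: int_induct[where k = 0])
  case (step1 i)
  then show ?case using bracket_span.add[OF bracket_monomial.one step1(2)] by (simp add: MConst.hom_add)
next
  case (step2 i)
  then show ?case using bracket_span.diff[OF bracket_monomial.one step2(2)] by (simp add: MConst.hom_minus)
qed (simp add: bracket_span.zero)

lemma degree_0_UV:
  assumes "int_coeffs F" "multihom (\<lambda>_. 0) F" "vars_in UV F"
  shows "bracket_span (\<lambda>_. 0) F"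
proof -
  have "t = 0" if t: "t \<in> keys F" for t
  proof -
    have "v \<notin> keys t" for v
    proof
      assume v: "v \<in> keys t"
      then obtain x i where x: "v = vec_var x i" "i < 2" using assms(3) t unfolding vars_in_def UV_def by blast
      have "weight (label_weight x) t \<noteq> 0" using v x label_weight_vec_var[OF x(2), of x x] by (auto simp: weight_eq_0_iff intro!: bexI[of _ v])
      then show False using assms(2) t unfolding multihom_def homogeneous_def by metis
    qed
    then show ?thesis by (metis ex_in_conv keys_eq_empty)
  qed
  then have "F = MConst (lookup F 0)"
    by (intro poly_mapping_eqI) (auto simp: MConst_def lookup_single when_def in_keys_iff)
  moreover have "lookup F 0 \<in> \<int>" using assms(1) by (simp add: int_coeffs_def)
  ultimately show ?thesis using bracket_span_int by (metis Ints_cases)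
qed

lemma divide_by_bracket:
  assumes yz: "fst y = fst z" "y \<noteq> z"
    and F: "int_coeffs F" "sl_inv F" "multihom d F" "vars_in UV F" and zero: "merge y z F = 0"
  obtains q where "F = bracket y z * q" "int_coeffs q" "sl_inv q" "vars_in UV q"
    "\<And>x t. t \<in> keys q \<Longrightarrow> weight (label_weight x) t + of_bool (x = y) + of_bool (x = z) = d x"
proof -
  have "\<exists>q. F = bracket y z * q \<and> int_coeffs q \<and> sl_inv q \<and> vars_in UV q \<and>
    (\<forall>x t. t \<in> keys q \<longrightarrow> weight (label_weight x) t + (label_weight x (vec_var y 0) + label_weight x (vec_var z 1)) = d x)"
    unfolding bracket_def
  proof (rule divide_invariant[OF _ _ _ _ F, where f = "\<lambda>v. MVar (merge_var y z v)"
        and e = "\<lambda>v. single (merge_var y z v) 1"])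
    show "distinct [vec_var y 0, vec_var y 1, vec_var z 0, vec_var z 1]"
      using yz(2) by (simp add: vec_var_eq_iff)
    show "{vec_var y 0, vec_var y 1, vec_var z 0, vec_var z 1} \<subseteq> UV" by simp
    show "label_weight x (vec_var y 0) + label_weight x (vec_var z 1) = label_weight x (vec_var y 1) + label_weight x (vec_var z 0)" for x
      by (simp add: label_weight_vec_var)
    show "sl_inv (det4 (vec_var y 0) (vec_var y 1) (vec_var z 0) (vec_var z 1))"
      using sl_inv_bracket[OF yz(1)] by (simp add: bracket_def)
    show "merge y z (det4 (vec_var y 0) (vec_var y 1) (vec_var z 0) (vec_var z 1)) = 0"
      using merge_bracket[of y z y z] by (simp add: bracket_def algebra_simps)
    show "merge y z F = 0" by (fact zero)
    show "MVar (merge_var y z v) = (single (single (merge_var y z v) 1) 1 :: (xvar, rat) mpoly)" for v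
      by (simp add: MVar_def)
    show "s = t" if "keys s \<subseteq> UV" "keys t \<subseteq> UV" "\<And>x. weight (label_weight x) s = d x" "\<And>x. weight (label_weight x) t = d x"
      "lookup s (vec_var y 0) = 0 \<or> lookup s (vec_var z 1) = 0"
      "lookup t (vec_var y 0) = 0 \<or> lookup t (vec_var z 1) = 0"
      "\<And>u. weight (\<lambda>v. lookup (single (merge_var y z v) 1) u) s
        = weight (\<lambda>v. lookup (single (merge_var y z v) 1) u) t" for s t
      by (rule merge_inj[OF that(1,2) yz(2) that(3-7)])
  qed blast
  then show thesis using that by (auto simp: label_weight_vec_var add.assoc)
qed

text \<open>Let \<open>y\<close> and \<open>z\<close> be two vectors of the same kind.  Setting \<open>z = y\<close> leaves an invariant of fewer
  vectors, which is a combination of products of brackets by induction.  Redistributing the occurrences of \<open>y\<close> gives a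
  combination of products of brackets that agrees with \<open>F\<close> for \<open>z = y\<close>.  The difference is divisible by the
  bracket of \<open>y\<close> and \<open>z\<close>, and the quotient has lower degree.  No denominators arise.\<close>

lemma vector_invariants:
  assumes "finite Y" "int_coeffs F" "sl_inv F" "multihom d F" "vars_in UV F" "\<And>y. y \<notin> Y \<Longrightarrow> d y = 0"
  shows "bracket_span d F"
  using assms
proof (induct "card Y" arbitrary: Y F d rule: less_induct)
  case less
  show ?case
  proof (cases "\<exists>y\<in>Y. \<exists>z\<in>Y. fst y = fst z \<and> y \<noteq> z")
    case False
    show ?thesis
    proof (cases "d = (\<lambda>_. 0)")
      case True
      then show ?thesis using degree_0_UV less.prems by blast
    next
      case nz: False
      then obtain y where y: "d y > 0" by (metis neq0_conv)
      then have "y \<in> Y" using less.prems(6) by (metis neq0_conv)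
      then have "F = 0"
        by (intro single_vector_invariant_0[OF less.prems(3,4,5) y]) (use False less.prems(6) in blast)
      then show ?thesis by (simp add: bracket_span.zero)
    qed
  next
    case True
    then obtain y z where yz: "y \<in> Y" "z \<in> Y" "fst y = fst z" "y \<noteq> z" by blast
    have smaller: "card (Y - {z}) < card Y" using less.prems(1) yz(2) by (rule card_Diff1_less)
    note outer = less.hyps and fin = less.prems(1)
    show ?thesis
      using less.prems(2-6)
    proof (induct "d z" arbitrary: F d rule: less_induct)
      case (less d F)
      note F = less.prems(1-4) and supp = less.prems(5)
      let ?d = "d(y := d y + d z, z := 0)"
      have "bracket_span ?d (merge y z F)"
      proof (rule outer[OF smaller])
        show "int_coeffs (merge y z F)" by (rule int_coeffs_subst[OF F(1)]) simp
        show "sl_inv (merge y z F)" by (rule sl_inv_subst[OF F(2) merge_sl_subst[OF yz(3)]])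
        show "multihom ?d (merge y z F)" by (rule multihom_merge[OF F(3,4) yz(4)])
        show "vars_in UV (merge y z F)"
          by (rule vars_in_subst[OF F(4)]) (auto elim!: UV_cases simp: merge_var_vec_var)
        show "finite (Y - {z})" using fin by simp
        show "?d x = 0" if "x \<notin> Y - {z}" for x
          using that supp[of x] yz by (cases "x = z") auto
      qed
      moreover have "?d z = 0" "?d y = d y + d z" using yz(4) by simp_all
      ultimately obtain g where g: "bracket_span (?d(y := d y, z := d z)) g" "merge y z g = merge y z F"
        using bracket_span_lift[OF _ yz(3,4)] by blast
      have "?d(y := d y, z := d z) = d" by (rule ext) simp
      then have g1: "bracket_span d g" using g(1) by (simp only:)
      note gp = bracket_span_props[OF g1]
      have "int_coeffs (F - g)" "sl_inv (F - g)" "multihom d (F - g)" "vars_in UV (F - g)"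
        using F gp by (blast intro: int_coeffs_diff sl_inv_diff multihom_diff vars_in_diff)+
      moreover have "merge y z (F - g) = 0" using g(2) by (simp add: subst.hom_minus)
      ultimately obtain q where q: "F - g = bracket y z * q" "int_coeffs q" "sl_inv q" "vars_in UV q"
        and dq: "\<And>x t. t \<in> keys q \<Longrightarrow> weight (label_weight x) t + of_bool (x = y) + of_bool (x = z) = d x"
        by (rule divide_by_bracket[OF yz(3,4)]) blast
      have "bracket_span d (bracket y z * q)"
      proof (cases "q = 0")
        case True
        then show ?thesis by (simp add: bracket_span.zero)
      next
        case False
        then obtain t where t: "t \<in> keys q" by (metis ex_in_conv keys_eq_empty)
        define e where "e x = d x - of_bool (x = y) - of_bool (x = z)" for x
        have e: "(\<lambda>x. e x + of_bool (x = y) + of_bool (x = z)) = d"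
        proof (rule ext)
          fix x
          show "e x + of_bool (x = y) + of_bool (x = z) = d x"
            using dq[OF t, of x] unfolding e_def by linarith
        qed
        have w: "weight (label_weight x) s = e x" if "s \<in> keys q" for s x
          using dq[OF that, of x] unfolding e_def by linarith
        have ez: "e x + of_bool (x = y) + of_bool (x = z) = d x" for x
          using fun_cong[OF e, of x] by simp
        have "bracket_span e q"
        proof (rule less.hyps[OF _ q(2,3) _ q(4)])
          show "multihom e q" unfolding multihom_def homogeneous_def using w by blast
          show "e z < d z" using ez[of z] by simp
          show "e x = 0" if "x \<notin> Y" for x using ez[of x] supp[OF that] by simp
        qed
        from bracket_span_bracket[OF this yz(3,4)] show ?thesis by (simp only: e)
      qed
      from bracket_span_add[OF g1 this] show ?case by (simp flip: q(1))
    qed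
  qed
qed

section \<open>Balanced products of brackets and alternating closed walks\<close>

abbreviation bracket_u :: "nat \<Rightarrow> nat \<Rightarrow> (xvar, rat) mpoly" where
  "bracket_u a b \<equiv> bracket (True, a) (True, b)"

abbreviation bracket_v :: "nat \<Rightarrow> nat \<Rightarrow> (xvar, rat) mpoly" where
  "bracket_v a b \<equiv> bracket (False, a) (False, b)"

fun pairs :: "('a \<Rightarrow> 'a \<Rightarrow> 'b::comm_ring_1) \<Rightarrow> 'a list \<Rightarrow> 'b" where
  "pairs f (a # b # c) = f a b * pairs f c"
| "pairs f c = 1"

text \<open>The closed walk through the vertices \<open>c\<close>, whose edges are brackets of \<open>u\<close>-vectors and of
  \<open>v\<close>-vectors alternately.\<close>

definition walk :: "nat list \<Rightarrow> (xvar, rat) mpoly" where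
  "walk c = pairs bracket_u c * pairs bracket_v (rotate1 c)"

lemma pairs_append: "even (length c) \<Longrightarrow> pairs f (c @ d) = pairs f c * pairs f d"
  by (induct f c rule: pairs.induct) (simp_all add: mult.assoc)

lemma even_list_cases:
  assumes "even (length c)" obtains "c = []" | a b d where "c = a # b # d" "even (length d)"
  using assms by (cases c; cases "tl c") auto

lemma walk_rotate:
  assumes "even (length c)" "even (length d)" shows "walk (c @ d) = walk (d @ c)"
proof -
  have 1: "walk (x # y # s) = walk (s @ [x, y])" if s: "even (length s)" for x y s
  proof (cases s)
    case (Cons p s')
    then have "even (length (s' @ [x]))" using s by simp
    from pairs_append[OF this, of bracket_v "[y, p]"] show ?thesis
      using Cons pairs_append[OF s, of bracket_u "[x, y]"] by (simp add: walk_def mult_ac)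
  qed simp
  show ?thesis
    using assms
  proof (induct "length c" arbitrary: c d rule: less_induct)
    case less
    from less.prems(1) show ?case
    proof (cases rule: even_list_cases)
      case (2 x y s)
      have "walk (x # y # (s @ d)) = walk ((s @ d) @ [x, y])"
        by (rule 1) (use 2 less.prems in simp)
      also have "\<dots> = walk (s @ (d @ [x, y]))" by simp
      also have "\<dots> = walk ((d @ [x, y]) @ s)" by (rule less.hyps) (use 2 less.prems in simp_all)
      finally show ?thesis by (simp add: 2)
    qed simp
  qed
qed

lemma pluecker: "bracket a b * bracket c d = bracket a c * bracket b d - bracket a d * bracket b c"
  by (simp add: bracket_def algebra_simps)

text \<open>The Pluecker relation is applied to the two edges next to the edge \<open>{y, z}\<close> of the other kind.  In its third
  term this edge is doubled and splits off.\<close>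

lemma walk_swap_12:
  "walk (x # y # z # t # s) = - walk (x # z # y # t # s) - (bracket_u y z * bracket_v y z) * walk (x # t # s)"
proof -
  let ?V = "pairs bracket_v (t # s @ [x])" and ?U = "pairs bracket_u s"
  have "walk (x # y # z # t # s) = (bracket_u x y * bracket_u z t) * ?U * (bracket_v y z * ?V)"
    by (simp add: walk_def mult_ac)
  also have "bracket_u x y * bracket_u z t = bracket_u x z * bracket_u y t - bracket_u x t * bracket_u y z" by (rule pluecker)
  finally show ?thesis
    by (simp add: walk_def bracket_swap[of "(False, z)" "(False, y)"] algebra_simps)
qed

lemma walk_swap_23:
  "walk (x # y # z # t # s) = - walk (x # y # t # z # s) - (bracket_u z t * bracket_v z t) * walk (x # y # s)"
proof -
  obtain e r where er: "s @ [x] = e # r" by (cases s) auto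
  have "walk (x # y # z # t # s) = bracket_u x y * bracket_u z t * pairs bracket_u s * ((bracket_v y z * bracket_v t e) * pairs bracket_v r)"
    by (simp add: walk_def er mult_ac)
  also have "bracket_v y z * bracket_v t e = bracket_v y t * bracket_v z e - bracket_v y e * bracket_v z t" by (rule pluecker)
  finally show ?thesis
    by (simp add: walk_def er bracket_swap[of "(True, t)" "(True, z)"] algebra_simps)
qed

text \<open>A multigraph is given by its multiset of edges; \<open>ends\<close> counts the degrees of its vertices.\<close>

definition ends :: "(nat \<times> nat) multiset \<Rightarrow> nat multiset" where
  "ends G = image_mset fst G + image_mset snd G"

definition edges :: "(nat \<Rightarrow> nat \<Rightarrow> 'b) \<Rightarrow> (nat \<times> nat) multiset \<Rightarrow> 'b::comm_ring_1" where
  "edges f G = prod_mset (image_mset (\<lambda>(a, b). f a b) G)"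

lemma ends_add [simp]: "ends (add_mset (a, b) G) = {#a, b#} + ends G"
  and ends_empty [simp]: "ends {#} = {#}"
  by (simp_all add: ends_def)

lemma edges_add [simp]: "edges f (add_mset (a, b) G) = f a b * edges f G"
  and edges_empty [simp]: "edges f {#} = 1"
  by (simp_all add: edges_def)

lemma edge_at:
  assumes "a \<in># ends G"
  obtains b G' where "ends G = {#a, b#} + ends G'" "size G = Suc (size G')"
    "edges bracket_u G = bracket_u a b * edges bracket_u G' \<or> edges bracket_u G = - (bracket_u a b * edges bracket_u G')"
    "edges bracket_v G = bracket_v a b * edges bracket_v G' \<or> edges bracket_v G = - (bracket_v a b * edges bracket_v G')"
proof -
  from assms obtain x y where xy: "(x, y) \<in># G" "x = a \<or> y = a" by (auto simp: ends_def)
  from xy(1) obtain G' where G: "G = add_mset (x, y) G'" by (rule mset_add)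
  show thesis
  proof (cases "x = a")
    case True
    then show thesis using that[of y G'] by (simp add: G)
  next
    case False
    then have "y = a" using xy by simp
    then show thesis
      using that[of x G'] bracket_swap[of "(True, x)" "(True, y)"] bracket_swap[of "(False, x)" "(False, y)"]
      by (simp add: G add_mset_commute)
  qed
qed

lemma bracket_monomial_edges:
  assumes "bracket_monomial d p"
  shows "\<exists>G H. p = edges bracket_u G * edges bracket_v H \<and>
    (\<forall>k. d (True, k) = count (ends G) k) \<and> (\<forall>k. d (False, k) = count (ends H) k)"
  using assms
proof induct
  case one
  show ?case by (intro exI[of _ "{#}"]) simp
next
  case (mult y z d p)
  then obtain G H where GH: "p = edges bracket_u G * edges bracket_v H"
    "\<And>k. d (True, k) = count (ends G) k" "\<And>k. d (False, k) = count (ends H) k" by blast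
  obtain c a b where yz: "y = (c, a)" "z = (c, b)" using mult(1) by (cases y; cases z) auto
  show ?case
  proof (cases c)
    case True
    then show ?thesis
      by (intro exI[of _ "add_mset (a, b) G"] exI[of _ H]) (auto simp: yz GH mult_ac)
  next
    case False
    then show ?thesis
      by (intro exI[of _ G] exI[of _ "add_mset (a, b) H"]) (auto simp: yz GH mult_ac)
  qed
qed

lemma adjacent_swaps_perm:
  assumes swap: "\<And>p x y s. Q (p @ x # y # s) \<Longrightarrow> Q (p @ y # x # s)"
    and "mset c = mset c'" "Q c"
  shows "Q c'"
proof -
  have move: "Q (p @ a @ x # b) \<Longrightarrow> Q (p @ x # a @ b)" for p a x b
  proof (induct a arbitrary: b rule: rev_induct)
    case (snoc y a)
    then have "Q ((p @ a) @ y # x # b)" by simp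
    then have "Q ((p @ a) @ x # y # b)" by (rule swap)
    then show ?case using snoc(1)[of "y # b"] by simp
  qed simp
  have "Q (p @ c) \<Longrightarrow> mset c = mset c' \<Longrightarrow> Q (p @ c')" for p c c'
  proof (induct c' arbitrary: p c)
    case (Cons x r)
    then have "x \<in> set c" by (metis list.set_intros(1) set_mset_mset)
    then obtain a b where c: "c = a @ x # b" by (meson split_list)
    then have "Q (p @ x # a @ b)" using move Cons(2) by simp
    then have "Q ((p @ [x]) @ (a @ b))" by simp
    then have "Q ((p @ [x]) @ r)" by (rule Cons(1)) (use Cons(3) c in simp)
    then show ?case by simp
  qed simp
  from this[of "[]"] show ?thesis using assms by simp
qed

text \<open>Here \<open>A d p\<close> is meant to say that \<open>p\<close> is the value on matrices of rank one of some element of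
  degree \<open>d\<close> of a ring of invariants.  For every vertex set the walk in only one cyclic order is required to be of this
  kind.\<close>

locale bracket_ring =
  fixes M :: "nat set" and A :: "nat multiset \<Rightarrow> (xvar, rat) mpoly \<Rightarrow> bool"
  assumes A_0: "A d 0" and A_1: "A {#} 1"
    and A_diff: "A d p \<Longrightarrow> A d q \<Longrightarrow> A d (p - q)"
    and A_mult: "A d p \<Longrightarrow> A e q \<Longrightarrow> A (d + e) (p * q)"
    and A_edge: "a \<in> M \<Longrightarrow> b \<in> M \<Longrightarrow> a \<noteq> b \<Longrightarrow> A {#a, b#} (bracket_u a b * bracket_v a b)"
    and A_cycle: "finite K \<Longrightarrow> K \<subseteq> M \<Longrightarrow> even (card K) \<Longrightarrow> card K \<ge> 4 \<Longrightarrow>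
      \<exists>c. distinct c \<and> set c = K \<and> A (mset c) (walk c)"
begin

lemma A_uminus: "A d p \<Longrightarrow> A d (- p)"
  using A_diff[OF A_0] by fastforce

lemma A_edge': "a \<in> M \<Longrightarrow> b \<in> M \<Longrightarrow> A {#a, b#} (bracket_u a b * bracket_v a b)"
  using A_edge A_0 by (cases "a = b") auto

text \<open>Modulo products with shorter walks, exchanging two neighbours only changes the sign.  So a walk may be
  brought into the available order; if it visits a vertex twice, the visits can be made consecutive, and a bracket of equal
  vectors vanishes.\<close>

lemma A_walk:
  assumes "even (length c)" "c \<noteq> []" "set c \<subseteq> M"
  shows "A (mset c) (walk c)"
  using assms
proof (induct "length c" arbitrary: c rule: less_induct)
  case less
  note shorter = less.hyps
  show ?case
  proof (cases "length c = 2")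
    case True
    then obtain a b where c: "c = [a, b]" by (auto simp: length_Suc_conv numeral_2_eq_2)
    have "walk c = - (bracket_u a b * bracket_v a b)"
      using bracket_swap[of "(False, b)" "(False, a)"] by (simp add: walk_def c)
    then show ?thesis using A_uminus[OF A_edge'] less.prems(3) by (simp add: c)
  next
    case False
    then have n4: "length c \<ge> 4" proof -
      have "length c \<noteq> 0" using less.prems(2) by simp
      then show ?thesis using less.prems(1) False by presburger
    qed
    define Q where "Q e \<longleftrightarrow> mset e = mset c \<and> A (mset c) (walk e)" for e
    have swap: "Q (p @ y # x # s)" if Q: "Q (p @ x # y # s)" for p x y s
    proof -
      let ?e = "p @ x # y # s"
      have ms: "mset ?e = mset c" and A: "A (mset c) (walk ?e)" using Q by (auto simp: Q_def)
      have len: "length ?e = length c" using ms by (metis size_mset)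
      have M: "set ?e \<subseteq> M" using ms less.prems(3) by (metis set_mset_mset)
      have par: "even (length p + length s)" using len less.prems(1) by (metis even_add even_Suc length_Cons length_append add_Suc_right)
      have "A (mset c) (walk (p @ y # x # s))"
      proof (cases "even (length p)")
        case True
        then have s: "even (length s)" using par by simp
        have "length (s @ p) \<ge> 2" using len n4 by simp
        then obtain r v where "s @ p = r @ [v]" by (cases "s @ p" rule: rev_cases) auto
        moreover have "r \<noteq> []" using \<open>length (s @ p) \<ge> 2\<close> calculation by auto
        ultimately obtain r' u where r: "s @ p = r' @ [u, v]" by (cases r rule: rev_cases) auto
        have "length s + length p = length r' + 2" using arg_cong[OF r, of length] by simp
        then have par': "even (length r')" using par by presburger
        have w: "walk (p @ a # b # s) = walk (u # v # a # b # r')" for a b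
        proof -
          have "walk (p @ a # b # s) = walk ((a # b # s) @ p)"
            by (rule walk_rotate) (use True s in simp_all)
          also have "(a # b # s) @ p = (a # b # r') @ [u, v]" using r by simp
          also have "walk \<dots> = walk ([u, v] @ (a # b # r'))"
            by (rule walk_rotate) (use par' in simp_all)
          finally show ?thesis by simp
        qed
        have "A (mset (u # v # r')) (walk (u # v # r'))"
        proof (rule shorter)
          show "length (u # v # r') < length c" using len arg_cong[OF r, of length] by simp
          show "set (u # v # r') \<subseteq> M" using M arg_cong[OF r, of set] by auto
        qed (use par' in auto)
        moreover have "A {#x, y#} (bracket_u x y * bracket_v x y)" using A_edge' M by simp
        ultimately have "A (mset (u # v # r') + {#x, y#}) (bracket_u x y * bracket_v x y * walk (u # v # r'))"
          using A_mult by (metis add.commute)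
        moreover have "mset (u # v # r') + {#x, y#} = mset c"
          using arg_cong[OF r, of mset] by (simp flip: ms add: add_ac)
        ultimately have B: "A (mset c) (bracket_u x y * bracket_v x y * walk (u # v # r'))" by simp
        have "walk (p @ y # x # s) = - walk (p @ x # y # s) - bracket_u x y * bracket_v x y * walk (u # v # r')"
          unfolding w walk_swap_23[of u v x y r'] by simp
        then show ?thesis using A_diff[OF A_uminus[OF A] B] by simp
      next
        case False
        then obtain p' u where p: "p = p' @ [u]" by (cases p rule: rev_cases) auto
        have s: "odd (length s)" and p': "even (length p')" using False par p by simp_all
        then obtain t s' where s': "s = t # s'" by (cases s) auto
        have w: "walk (p @ a # b # s) = walk (u # a # b # t # s' @ p')" for a b
          using walk_rotate[OF p', of "u # a # b # s"] s by (simp add: p s')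
        have "A (mset (u # t # s' @ p')) (walk (u # t # s' @ p'))"
          by (rule shorter) (use len M s p' in \<open>auto simp: p s'\<close>)
        moreover have "A {#x, y#} (bracket_u x y * bracket_v x y)" using A_edge' M by simp
        ultimately have "A (mset (u # t # s' @ p') + {#x, y#}) (bracket_u x y * bracket_v x y * walk (u # t # s' @ p'))"
          using A_mult by (metis add.commute)
        moreover have "mset (u # t # s' @ p') + {#x, y#} = mset c"
          by (simp flip: ms add: p s' add_ac)
        ultimately have B: "A (mset c) (bracket_u x y * bracket_v x y * walk (u # t # s' @ p'))" by simp
        have "walk (p @ y # x # s) = - walk (p @ x # y # s) - bracket_u x y * bracket_v x y * walk (u # t # s' @ p')"
          unfolding w walk_swap_12[of u x y t] by simp
        then show ?thesis using A_diff[OF A_uminus[OF A] B] by simp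
      qed
      then show ?thesis using ms by (simp add: Q_def add_mset_commute)
    qed
    have "\<exists>e. Q e"
    proof (cases "distinct c")
      case True
      have "\<exists>e. distinct e \<and> set e = set c \<and> A (mset e) (walk e)"
        by (rule A_cycle) (use True n4 less.prems in \<open>auto simp: distinct_card\<close>)
      then obtain e where e: "distinct e" "set e = set c" "A (mset e) (walk e)" by blast
      then have "mset e = mset c" using True by (simp add: set_eq_iff_mset_eq_distinct)
      then show ?thesis using e(3) by (auto simp: Q_def)
    next
      case False
      then obtain xs ys zs y where c: "c = xs @ [y] @ ys @ [y] @ zs" using not_distinct_decomp by blast
      have "Q (y # y # xs @ ys @ zs)"
        by (simp add: Q_def c walk_def A_0)
      then show ?thesis ..
    qed
    then obtain e where e: "Q e" ..
    have "mset e = mset c" using e by (simp add: Q_def)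
    then have "Q c" using adjacent_swaps_perm[of Q, OF swap _ e] by blast
    then show ?thesis by (simp add: Q_def)
  qed
qed

text \<open>Two multigraphs \<open>G\<close> and \<open>H\<close> with the same degrees split into alternating closed walks.  The open
  trail \<open>c\<close> is extended by an edge of \<open>H\<close> and an edge of \<open>G\<close> until it closes up; balance of the degrees ensures that
  it never gets stuck.  The factor of \<open>c\<close> in the conclusion lists only the edges within the trail.\<close>

lemma A_trail:
  assumes "even (length c)" "set c \<subseteq> M" "set_mset (ends G) \<subseteq> M"
    "mset c + ends G = mset (butlast (tl c)) + ends H"
  shows "A (mset c + ends G)
    (pairs bracket_u c * pairs bracket_v (butlast (tl c)) * (edges bracket_u G * edges bracket_v H))"
  using assms
proof (induct "size G + size H" arbitrary: c G H rule: less_induct)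
  case less
  show ?case
  proof (cases "c = []")
    case True
    show ?thesis
    proof (cases G)
      case empty
      with less.prems(4) True have "ends H = {#}" by simp
      then have "H = {#}" by (simp add: ends_def)
      then show ?thesis using A_1 True empty by simp
    next
      case (add ab G')
      obtain a b where ab: "ab = (a, b)" by (cases ab)
      have "A (mset [a, b] + ends G')
        (pairs bracket_u [a, b] * pairs bracket_v (butlast (tl [a, b])) * (edges bracket_u G' * edges bracket_v H))"
        by (rule less.hyps) (use less.prems True add ab in auto)
      then show ?thesis using True by (simp add: add ab mult_ac)
    qed
  next
    case False
    then obtain x y d where "c = x # y # d" "even (length d)"
      using less.prems(1) by (auto elim: even_list_cases)
    moreover obtain m z where mz: "y # d = m @ [z]" by (cases "y # d" rule: rev_cases) auto
    moreover have "length m = length d" using arg_cong[OF mz, of length] by simp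
    ultimately have c: "c = x # m @ [z]" "even (length m)" by simp_all
    have balanced: "{#x#} + ends G + {#z#} = ends H"
      using less.prems(4) by (simp add: c)
    have "z \<in># ends H" by (simp flip: balanced)
    then obtain e H' where H: "ends H = {#z, e#} + ends H'" "size H = Suc (size H')"
      and eH: "edges bracket_v H = bracket_v z e * edges bracket_v H' \<or> edges bracket_v H = - (bracket_v z e * edges bracket_v H')"
      by (rule edge_at) blast
    have balanced': "{#x#} + ends G = {#e#} + ends H'" using balanced H(1) by (simp add: add_mset_commute)
    have tl: "butlast (tl c) = m" by (simp add: c)
    show ?thesis
    proof (cases "e = x")
      case True
      then have bal0: "ends G = ends H'" using balanced' by simp
      have "A (mset [] + ends G) (pairs bracket_u [] * pairs bracket_v (butlast (tl [])) * (edges bracket_u G * edges bracket_v H'))"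
        by (rule less.hyps) (use less.prems bal0 H in auto)
      moreover have "A (mset c) (walk c)"
        by (rule A_walk) (use less.prems c in auto)
      ultimately have *: "A (mset c + ends G) (walk c * (edges bracket_u G * edges bracket_v H'))"
        using A_mult by fastforce
      have "walk c = pairs bracket_u c * (pairs bracket_v m * bracket_v z e)"
        using pairs_append[OF c(2), of bracket_v "[z, x]"] True by (simp add: walk_def c(1))
      then have "pairs bracket_u c * pairs bracket_v m * (edges bracket_u G * edges bracket_v H) = walk c * (edges bracket_u G * edges bracket_v H')
        \<or> pairs bracket_u c * pairs bracket_v m * (edges bracket_u G * edges bracket_v H) = - (walk c * (edges bracket_u G * edges bracket_v H'))"
        using eH by (auto simp: mult_ac)
      then show ?thesis using * A_uminus[OF *] unfolding tl by (elim disjE) (simp_all only:)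
    next
      case False
      have "e \<in># {#x#} + ends G" unfolding balanced' by simp
      then have "e \<in># ends G" using False by simp
      then obtain f G' where G: "ends G = {#e, f#} + ends G'" "size G = Suc (size G')"
        and eG: "edges bracket_u G = bracket_u e f * edges bracket_u G' \<or> edges bracket_u G = - (bracket_u e f * edges bracket_u G')"
        by (rule edge_at) blast
      let ?c = "c @ [e, f]"
      have tl': "butlast (tl ?c) = m @ [z, e]" by (simp add: c butlast_append)
      have "A (mset ?c + ends G')
        (pairs bracket_u ?c * pairs bracket_v (butlast (tl ?c)) * (edges bracket_u G' * edges bracket_v H'))"
      proof (rule less.hyps)
        show "mset ?c + ends G' = mset (butlast (tl ?c)) + ends H'"
          unfolding tl' using balanced' G(1) by (simp add: c add_mset_commute)
      qed (use less.prems G H in auto)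
      moreover have deg: "mset ?c + ends G' = mset c + ends G" using G(1) by (simp add: add_ac)
      ultimately have *: "A (mset c + ends G) (pairs bracket_u c * bracket_u e f * (pairs bracket_v m * bracket_v z e) * (edges bracket_u G' * edges bracket_v H'))"
        using pairs_append[OF less.prems(1), of bracket_u "[e, f]"] pairs_append[OF c(2), of bracket_v "[z, e]"]
        unfolding tl' deg by simp
      have "pairs bracket_u c * pairs bracket_v m * (edges bracket_u G * edges bracket_v H)
          = pairs bracket_u c * bracket_u e f * (pairs bracket_v m * bracket_v z e) * (edges bracket_u G' * edges bracket_v H')
        \<or> pairs bracket_u c * pairs bracket_v m * (edges bracket_u G * edges bracket_v H)
          = - (pairs bracket_u c * bracket_u e f * (pairs bracket_v m * bracket_v z e) * (edges bracket_u G' * edges bracket_v H'))"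
        using eG eH by (auto simp: mult_ac)
      then show ?thesis using * A_uminus[OF *] unfolding tl by (elim disjE) (simp_all only:)
    qed
  qed
qed

text \<open>Together, these facts express every combination of products of brackets in which \<open>u\<^sub>k\<close> and \<open>v\<^sub>k\<close> occur
  equally often.\<close>

lemma A_bracket_span:
  assumes "bracket_span d p" "\<And>k. d (True, k) = count D k" "\<And>k. d (False, k) = count D k"
    "set_mset D \<subseteq> M"
  shows "A D p"
proof -
  have mon: "A D b" if mon_b: "bracket_monomial d b" for b
  proof -
    obtain G H where b: "b = edges bracket_u G * edges bracket_v H"
      and "\<And>k. d (True, k) = count (ends G) k" "\<And>k. d (False, k) = count (ends H) k"
      using bracket_monomial_edges[OF mon_b] by blast
    then have "ends G = D" "ends H = D" using assms(2,3) by (auto intro: multiset_eqI)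
    then show ?thesis using A_trail[of "[]" G H] assms(4) by (simp add: b)
  qed
  have plus: "A D (p + b)" if "A D p" "A D b" for p b
    using A_diff[OF that(1) A_uminus[OF that(2)]] by simp
  have "bracket_span e p \<Longrightarrow> e = d \<Longrightarrow> A D p" for e
    by (induct rule: bracket_span.induct) (auto intro: A_0 plus A_diff mon)
  then show ?thesis using assms(1) by blast
qed

end

section \<open>Specialising generic matrices to rank one\<close>

fun rank1 :: "nat set \<Rightarrow> xvar \<Rightarrow> (xvar, rat) mpoly" where
  "rank1 S (i, j, k) =
    (if k \<in> S \<and> i < 2 \<and> j < 2 then MVar (i, 2, k) * MVar (2, j, k) else MVar (i, j, k))"

fun rank1_exp :: "nat set \<Rightarrow> xvar \<Rightarrow> xvar \<Rightarrow>\<^sub>0 nat" where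
  "rank1_exp S (i, j, k) =
    (if k \<in> S \<and> i < 2 \<and> j < 2 then single (i, 2, k) 1 + single (2, j, k) 1 else single (i, j, k) 1)"

text \<open>The matrices with index in \<open>J\<close> are generic, the others have been specialised to
  \<open>u\<^sub>k v\<^sub>k\<^sup>T\<close>.\<close>

definition hybrid_vars :: "nat set \<Rightarrow> xvar set" where
  "hybrid_vars J = {(i, j, k). if k \<in> J then i < 2 \<and> j < 2 else (i, j, k) \<in> UV}"

abbreviation balanced :: "nat multiset \<Rightarrow> bool \<times> nat \<Rightarrow> nat" where
  "balanced D \<equiv> (\<lambda>y. count D (snd y))"

lemma rank1_monomial: "rank1 S v = single (rank1_exp S v) 1"
  by (cases v) (simp add: MVar_def mult_single)

lemma homogeneous_rank1: "homogeneous (label_weight y) (label_weight y v) (rank1 S v)"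
  by (cases y; cases v) (auto intro!: homogeneous_mult_eq)

lemma multihom_rank1: "multihom d p \<Longrightarrow> multihom d (subst (rank1 S) p)"
  by (auto simp: multihom_def intro: homogeneous_subst homogeneous_rank1)

lemma int_coeffs_rank1: "int_coeffs p \<Longrightarrow> int_coeffs (subst (rank1 S) p)"
proof (rule int_coeffs_subst)
  fix v show "int_coeffs (rank1 S v)" by (cases v) (auto intro: int_coeffs_mult)
qed

lemma rank1_sl_subst:
  "subst (sl_subst c \<alpha> \<beta> \<gamma> \<delta>) (rank1 S v) = subst (rank1 S) (sl_subst c \<alpha> \<beta> \<gamma> \<delta> v)"
proof (cases v)
  case (fields i j k)
  show ?thesis
    unfolding fields
    by (cases c) (auto simp: subst.hom_add subst.hom_mult less_2_iff algebra_simps)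
qed

lemma sl_inv_rank1: "sl_inv p \<Longrightarrow> sl_inv (subst (rank1 S) p)"
  by (rule sl_inv_subst[OF _ rank1_sl_subst])

lemma rank1_rank1:
  assumes "j \<notin> J"
  shows "subst (rank1 {j}) (subst (rank1 (- insert j J)) p) = subst (rank1 (- J)) p"
proof -
  have "subst (rank1 {j}) (rank1 (- insert j J) v) = rank1 (- J) v" for v
    using assms by (cases v) (auto simp: subst.hom_mult)
  then show ?thesis by (simp add: subst_subst)
qed

lemma hybrid_vars_empty: "hybrid_vars {} = UV" by (auto simp: hybrid_vars_def)

definition det_poly :: "nat \<Rightarrow> (xvar, rat) mpoly" where
  "det_poly k = det4 (0, 0, k) (0, 1, k) (1, 0, k) (1, 1, k)"

lemma sl_inv_det_poly: "sl_inv (det_poly k)"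
  unfolding sl_inv_def
proof (intro allI impI)
  fix c and \<alpha> \<beta> \<gamma> \<delta> :: rat assume "\<alpha> * \<delta> - \<beta> * \<gamma> = 1"
  show "subst (sl_subst c \<alpha> \<beta> \<gamma> \<delta>) (det_poly k) = det_poly k"
  proof (cases c)
    case True
    have "subst (sl_subst True \<alpha> \<beta> \<gamma> \<delta>) (det_poly k) = det_poly k"
      using two_by_two_det[OF MConst_det[OF \<open>\<alpha> * \<delta> - \<beta> * \<gamma> = 1\<close>], of "MVar (0, 0, k) :: (xvar, rat) mpoly"
          "MVar (1, 0, k)" "MVar (0, 1, k)" "MVar (1, 1, k)"]
      by (simp add: det_poly_def subst.hom_minus subst.hom_mult algebra_simps)
    then show ?thesis using True by simp
  next
    case False
    have "subst (sl_subst False \<alpha> \<beta> \<gamma> \<delta>) (det_poly k) = det_poly k"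
      using two_by_two_det[OF MConst_det[OF \<open>\<alpha> * \<delta> - \<beta> * \<gamma> = 1\<close>], of "MVar (0, 0, k) :: (xvar, rat) mpoly"
          "MVar (0, 1, k)" "MVar (1, 0, k)" "MVar (1, 1, k)"]
      by (simp add: det_poly_def subst.hom_minus subst.hom_mult algebra_simps)
    then show ?thesis using False by simp
  qed
qed

lemma weight_finite_eq:
  assumes "\<And>v. v \<in> keys s \<Longrightarrow> w v \<noteq> 0 \<Longrightarrow> v \<in> set S"
    and "distinct S"
  shows "weight w s = (\<Sum>v\<leftarrow>S. w v * lookup s v)"
  using weight_support[of "set S" s w] assms by (simp add: sum_list_distinct_conv_sum_set)

text \<open>The exponents of the coordinates of \<open>u\<^sub>k\<close> and \<open>v\<^sub>k\<close> in the specialised monomial are the row and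
  column sums of the exponents of the entries of \<open>x\<^sub>k\<close>.\<close>

lemma weight_rank1_exp:
  assumes k: "k \<in> S" and s: "keys s \<subseteq> hybrid_vars J" "k \<in> J"
  shows "i < 2 \<Longrightarrow> weight (\<lambda>v. lookup (rank1_exp S v) (i, 2, k)) s = lookup s (i, 0, k) + lookup s (i, 1, k)"
    and "j < 2 \<Longrightarrow> weight (\<lambda>v. lookup (rank1_exp S v) (2, j, k)) s = lookup s (0, j, k) + lookup s (1, j, k)"
proof -
  assume i: "i < 2"
  have "weight (\<lambda>v. lookup (rank1_exp S v) (i, 2, k)) s
    = (\<Sum>v\<leftarrow>[(i, 0, k), (i, 1, k)]. lookup (rank1_exp S v) (i, 2, k) * lookup s v)"
    by (rule weight_finite_eq)
       (use s i in \<open>auto simp: lookup_add lookup_single when_def hybrid_vars_def less_2_iff UV_iff split: if_splits\<close>)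
  then show "weight (\<lambda>v. lookup (rank1_exp S v) (i, 2, k)) s = lookup s (i, 0, k) + lookup s (i, 1, k)"
    using k i by (simp add: lookup_add lookup_single)
next
  assume j: "j < 2"
  have "weight (\<lambda>v. lookup (rank1_exp S v) (2, j, k)) s
    = (\<Sum>v\<leftarrow>[(0, j, k), (1, j, k)]. lookup (rank1_exp S v) (2, j, k) * lookup s v)"
    by (rule weight_finite_eq)
       (use s j in \<open>auto simp: lookup_add lookup_single when_def hybrid_vars_def less_2_iff UV_iff split: if_splits\<close>)
  then show "weight (\<lambda>v. lookup (rank1_exp S v) (2, j, k)) s = lookup s (0, j, k) + lookup s (1, j, k)"
    using k j by (simp add: lookup_add lookup_single)
qed

lemma weight_rank1_exp_other:
  assumes "k \<notin> S"
  shows "weight (\<lambda>v. lookup (rank1_exp S v) (i, j, k)) s = lookup s (i, j, k)"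
proof -
  have "weight (\<lambda>v. lookup (rank1_exp S v) (i, j, k)) s
    = (\<Sum>v\<leftarrow>[(i, j, k)]. lookup (rank1_exp S v) (i, j, k) * lookup s v)"
    by (rule weight_finite_eq) (use assms in \<open>auto simp: lookup_add lookup_single when_def split: if_splits\<close>)
  then show ?thesis using assms by simp
qed

text \<open>As for two vectors: the exponents of the four entries form an array with known row and column sums and
  with a zero in one of two opposite corners.\<close>

lemma rank1_inj:
  assumes s: "keys s \<subseteq> hybrid_vars (insert j J)" and t: "keys t \<subseteq> hybrid_vars (insert j J)"
    and std: "lookup s (0, 0, j) = 0 \<or> lookup s (1, 1, j) = 0"
      "lookup t (0, 0, j) = 0 \<or> lookup t (1, 1, j) = 0"
    and eq: "\<And>u. weight (\<lambda>v. lookup (rank1_exp {j} v) u) s = weight (\<lambda>v. lookup (rank1_exp {j} v) u) t"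
  shows "s = t"
proof (rule poly_mapping_eqI)
  fix u :: xvar
  obtain i l k where u: "u = (i, l, k)" by (cases u)
  show "lookup s u = lookup t u"
  proof (cases "k = j")
    case False
    then show ?thesis using eq[of "(i, l, k)"] by (simp add: weight_rank1_exp_other u)
  next
    case True
    have *: "j \<in> {j}" "j \<in> insert j J" by simp_all
    note w = weight_rank1_exp[OF *(1) s *(2)] weight_rank1_exp[OF *(1) t *(2)]
    have sums: "lookup s (0, 0, j) + lookup s (0, 1, j) = lookup t (0, 0, j) + lookup t (0, 1, j)"
      "lookup s (1, 0, j) + lookup s (1, 1, j) = lookup t (1, 0, j) + lookup t (1, 1, j)"
      "lookup s (0, 0, j) + lookup s (1, 0, j) = lookup t (0, 0, j) + lookup t (1, 0, j)"
      "lookup s (0, 1, j) + lookup s (1, 1, j) = lookup t (0, 1, j) + lookup t (1, 1, j)"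
      using eq[of "(0, 2, j)"] eq[of "(1, 2, j)"] eq[of "(2, 0, j)"] eq[of "(2, 1, j)"]
      by (simp_all only: w zero_less_numeral one_less_numeral_iff semiring_norm)
    then have e: "lookup s (0, 0, j) = lookup t (0, 0, j)" "lookup s (0, 1, j) = lookup t (0, 1, j)"
      "lookup s (1, 0, j) = lookup t (1, 0, j)" "lookup s (1, 1, j) = lookup t (1, 1, j)"
      using std by auto
    show ?thesis
    proof (cases "i < 2 \<and> l < 2")
      case True
      then show ?thesis using e \<open>k = j\<close> by (auto simp: u less_2_iff)
    next
      case False
      then have "(i, l, k) \<notin> hybrid_vars (insert j J)" using \<open>k = j\<close> by (simp add: hybrid_vars_def)
      then show ?thesis using s t unfolding u by (metis in_keys_iff subsetD)
    qed
  qed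
qed

text \<open>If a matrix contributes at most one factor to a monomial, then the row and column sums say which entry
  it is.  So identities between multilinear polynomials may be checked on matrices of rank one.\<close>

lemma rank1_determines_multilinear:
  assumes F: "vars_in (hybrid_vars UNIV) F" "multihom d F" "\<And>y. d y \<le> 1" and zero: "subst (rank1 UNIV) F = 0"
  shows "F = 0"
proof (rule monomial_subst_eq_0[OF rank1_monomial[of UNIV] _ zero])
  fix s t assume st: "s \<in> keys F" "t \<in> keys F"
    and eq: "\<And>u. weight (\<lambda>v. lookup (rank1_exp UNIV v) u) s = weight (\<lambda>v. lookup (rank1_exp UNIV v) u) t"
  have s: "keys s \<subseteq> hybrid_vars UNIV" and t: "keys t \<subseteq> hybrid_vars UNIV" using st F(1) by (auto simp: vars_in_def)
  show "s = t"
  proof (rule poly_mapping_eqI)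
    fix u :: xvar
    obtain i l k where u: "u = (i, l, k)" by (cases u)
    note w = weight_rank1_exp[OF UNIV_I s UNIV_I] weight_rank1_exp[OF UNIV_I t UNIV_I]
    have sums: "lookup s (0, 0, k) + lookup s (0, 1, k) = lookup t (0, 0, k) + lookup t (0, 1, k)"
      "lookup s (1, 0, k) + lookup s (1, 1, k) = lookup t (1, 0, k) + lookup t (1, 1, k)"
      "lookup s (0, 0, k) + lookup s (1, 0, k) = lookup t (0, 0, k) + lookup t (1, 0, k)"
      "lookup s (0, 1, k) + lookup s (1, 1, k) = lookup t (0, 1, k) + lookup t (1, 1, k)"
      using eq[of "(0, 2, k)"] eq[of "(1, 2, k)"] eq[of "(2, 0, k)"] eq[of "(2, 1, k)"]
      by (simp_all only: w zero_less_numeral one_less_numeral_iff semiring_norm)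
    have "weight (label_weight (True, k)) s = (\<Sum>v\<leftarrow>[(0, 0, k), (0, 1, k), (1, 0, k), (1, 1, k)]. label_weight (True, k) v * lookup s v)"
      by (rule weight_finite_eq) (use s in \<open>auto simp: hybrid_vars_def less_2_iff split: if_splits\<close>)
    moreover have "weight (label_weight (True, k)) s \<le> 1" using F(2,3) st(1) unfolding multihom_def homogeneous_def by metis
    ultimately have "lookup s (0, 0, k) + lookup s (0, 1, k) + lookup s (1, 0, k) + lookup s (1, 1, k) \<le> 1"
      by simp
    with sums have e: "lookup s (0, 0, k) = lookup t (0, 0, k)" "lookup s (0, 1, k) = lookup t (0, 1, k)"
      "lookup s (1, 0, k) = lookup t (1, 0, k)" "lookup s (1, 1, k) = lookup t (1, 1, k)"
      by linarith+
    show "lookup s u = lookup t u"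
    proof (cases "i < 2 \<and> l < 2")
      case True
      then show ?thesis using e by (auto simp: u less_2_iff)
    next
      case False
      then have "(i, l, k) \<notin> hybrid_vars UNIV" by (simp add: hybrid_vars_def)
      then show ?thesis using s t unfolding u by (metis in_keys_iff subsetD)
    qed
  qed
qed

section \<open>From matrices of rank one back to generic matrices\<close>

text \<open>Of the polarised determinants and of the elements \<open>xi\<close> only the multidegrees and the values on matrices of
  rank one enter.\<close>

locale invariant_subring =
  fixes m :: nat and R :: "(xvar, rat) mpoly set"
  assumes subring: "is_subring R"
    and R_props: "g \<in> R \<Longrightarrow> int_coeffs g \<and> sl_inv g \<and> vars_in ({0..<2} \<times> {0..<2} \<times> {1..m}) g"
    and det_poly_in: "k \<in> {1..m} \<Longrightarrow> det_poly k \<in> R"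
    and edge_in: "a \<in> {1..m} \<Longrightarrow> b \<in> {1..m} \<Longrightarrow> a \<noteq> b \<Longrightarrow>
      \<exists>g\<in>R. multihom (balanced {#a, b#}) g \<and> subst (rank1 UNIV) g = bracket_u a b * bracket_v a b"
    and cycle_in: "finite K \<Longrightarrow> K \<subseteq> {1..m} \<Longrightarrow> even (card K) \<Longrightarrow> card K \<ge> 4 \<Longrightarrow>
      \<exists>c. distinct c \<and> set c = K \<and> (\<exists>g\<in>R. multihom (balanced (mset c)) g \<and> subst (rank1 UNIV) g = walk c)"
begin

lemma R_1: "1 \<in> R" and R_diff: "a \<in> R \<Longrightarrow> b \<in> R \<Longrightarrow> a - b \<in> R"
  and R_mult: "a \<in> R \<Longrightarrow> b \<in> R \<Longrightarrow> a * b \<in> R"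
  using subring by (auto simp: is_subring_def)

lemma R_0: "0 \<in> R" using R_diff[OF R_1 R_1] by simp

lemma R_add: "a \<in> R \<Longrightarrow> b \<in> R \<Longrightarrow> a + b \<in> R"
  using R_diff[OF _ R_diff[OF R_0], of a b] by simp

text \<open>The degree of \<open>g\<close> is part of the condition because the descent in the next lemma is by degree.\<close>

definition liftable :: "nat set \<Rightarrow> nat multiset \<Rightarrow> (xvar, rat) mpoly \<Rightarrow> bool" where
  "liftable J D F \<longleftrightarrow> (\<exists>g\<in>R. multihom (balanced D) g \<and> subst (rank1 (- J)) g = F)"

sublocale bracket_ring "{1..m}" "liftable {}"
proof
  show "liftable {} d 0" for d
    unfolding liftable_def using R_0 by (intro bexI[of _ 0]) simp_all
  show "liftable {} {#} 1"
    unfolding liftable_def using R_1 by (intro bexI[of _ 1]) simp_all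
  show "liftable {} d (p - q)" if p: "liftable {} d p" and q: "liftable {} d q" for d p q
  proof -
    obtain g h where "g \<in> R" "multihom (balanced d) g" "subst (rank1 (- {})) g = p"
      "h \<in> R" "multihom (balanced d) h" "subst (rank1 (- {})) h = q" using p q unfolding liftable_def by blast
    then show ?thesis
      unfolding liftable_def by (intro bexI[of _ "g - h"]) (auto simp: subst.hom_minus intro: multihom_diff R_diff)
  qed
  show "liftable {} (d + e) (p * q)" if p: "liftable {} d p" and q: "liftable {} e q" for d e p q
  proof -
    obtain g h where "g \<in> R" "multihom (balanced d) g" "subst (rank1 (- {})) g = p"
      "h \<in> R" "multihom (balanced e) h" "subst (rank1 (- {})) h = q" using p q unfolding liftable_def by blast
    moreover have "multihom (balanced (d + e)) (g * h)" if "multihom (balanced d) g" "multihom (balanced e) h"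
      using multihom_mult[OF that] by simp
    ultimately show ?thesis
      unfolding liftable_def by (intro bexI[of _ "g * h"]) (auto simp: subst.hom_mult intro: R_mult)
  qed
  show "liftable {} {#a, b#} (bracket_u a b * bracket_v a b)" if "a \<in> {1..m}" "b \<in> {1..m}" "a \<noteq> b" for a b
    unfolding liftable_def using edge_in[OF that] by simp
  show "\<exists>c. distinct c \<and> set c = K \<and> liftable {} (mset c) (walk c)"
    if "finite K" "K \<subseteq> {1..m}" "even (card K)" "card K \<ge> 4" for K
    unfolding liftable_def using cycle_in[OF that] by simp
qed

text \<open>The specialised matrices are made generic one after the other.  If \<open>F\<close> becomes the value of some
  \<open>g\<close> in \<open>R\<close> when \<open>x\<^sub>j\<close> is specialised to rank one, then \<open>F - g\<close> is divisible by the determinant of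
  \<open>x\<^sub>j\<close>, and the quotient is an invariant of lower degree in \<open>x\<^sub>j\<close>.\<close>

lemma invariants_liftable:
  assumes "finite J" "J \<subseteq> {1..m}" "int_coeffs F" "sl_inv F" "multihom (balanced D) F" "vars_in (hybrid_vars J) F"
    "set_mset D \<subseteq> {1..m}"
  shows "liftable J D F"
  using assms
proof (induct J arbitrary: D F rule: finite_induct)
  case empty
  have "bracket_span (balanced D) F"
  proof (rule vector_invariants)
    show "finite (UNIV \<times> {1..m} :: (bool \<times> nat) set)" by simp
    show "balanced D y = 0" if "y \<notin> UNIV \<times> {1..m}" for y
      using that empty(6) by (cases y) (auto simp: count_eq_zero_iff)
  qed (use empty in \<open>simp_all add: hybrid_vars_empty\<close>)
  then show ?case by (rule A_bracket_span) (use empty in simp_all)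
next
  case (insert j J)
  note outer = insert.hyps(3) and j = insert.hyps(2) and J = insert.prems(1)
  show ?case
    using insert.prems(2-6)
  proof (induct "count D j" arbitrary: D F rule: less_induct)
    case (less D F)
    note F = less.prems(1-4) and D = less.prems(5)
    let ?S = "- insert j J"
    have "liftable J D (subst (rank1 {j}) F)"
    proof (rule outer)
      show "int_coeffs (subst (rank1 {j}) F)" by (rule int_coeffs_rank1[OF F(1)])
      show "sl_inv (subst (rank1 {j}) F)" by (rule sl_inv_rank1[OF F(2)])
      show "multihom (balanced D) (subst (rank1 {j}) F)" by (rule multihom_rank1[OF F(3)])
      show "vars_in (hybrid_vars J) (subst (rank1 {j}) F)"
        by (rule vars_in_subst[OF F(4)])
           (use j in \<open>auto simp: hybrid_vars_def UV_iff intro!: vars_in_mult split: if_splits\<close>)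
    qed (use J D in auto)
    then obtain g where g: "g \<in> R" "multihom (balanced D) g"
      and "subst (rank1 (- J)) g = subst (rank1 {j}) F" unfolding liftable_def by blast
    then have gF: "subst (rank1 {j}) (F - subst (rank1 ?S) g) = 0"
      by (simp add: subst.hom_minus rank1_rank1[OF j])
    let ?F = "F - subst (rank1 ?S) g"
    have gp: "int_coeffs g" "sl_inv g" "vars_in ({0..<2} \<times> {0..<2} \<times> {1..m}) g" using R_props[OF g(1)] by auto
    have Fp: "int_coeffs ?F" "sl_inv ?F" "multihom (balanced D) ?F" "vars_in (hybrid_vars (insert j J)) ?F"
    proof -
      show "int_coeffs ?F" by (intro int_coeffs_diff F int_coeffs_rank1 gp)
      show "sl_inv ?F" by (intro sl_inv_diff F sl_inv_rank1 gp)
      show "multihom (balanced D) ?F" by (intro multihom_diff F multihom_rank1 g)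
      have "vars_in (hybrid_vars (insert j J)) (subst (rank1 ?S) g)"
        by (rule vars_in_subst[OF gp(3)]) (auto simp: hybrid_vars_def UV_iff intro!: vars_in_mult)
      then show "vars_in (hybrid_vars (insert j J)) ?F" by (intro vars_in_diff F)
    qed
    obtain q where q: "?F = det_poly j * q" "int_coeffs q" "sl_inv q" "vars_in (hybrid_vars (insert j J)) q"
      and dq: "\<And>y t. t \<in> keys q \<Longrightarrow> weight (label_weight y) t + (label_weight y (0, 0, j) + label_weight y (1, 1, j)) = balanced D y"
      unfolding det_poly_def
    proof (rule divide_invariant[OF _ _ _ _ Fp rank1_monomial _ gF])
      show "distinct [(0, 0, j) :: xvar, (0, 1, j), (1, 0, j), (1, 1, j)]" by simp
      show "{(0, 0, j), (0, 1, j), (1, 0, j), (1, 1, j)} \<subseteq> hybrid_vars (insert j J)" by (simp add: hybrid_vars_def)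
      show "label_weight y (0, 0, j) + label_weight y (1, 1, j) = label_weight y (0, 1, j) + label_weight y (1, 0, j)" for y by (cases y) simp
      show "sl_inv (det4 (0, 0, j) (0, 1, j) (1, 0, j) (1, 1, j))"
        using sl_inv_det_poly[of j] by (simp add: det_poly_def)
      show "subst (rank1 {j}) (det4 (0, 0, j) (0, 1, j) (1, 0, j) (1, 1, j)) = 0"
        by (simp add: subst.hom_minus subst.hom_mult algebra_simps)
      show "s = t" if "keys s \<subseteq> hybrid_vars (insert j J)" "keys t \<subseteq> hybrid_vars (insert j J)"
        "\<And>y. weight (label_weight y) s = balanced D y" "\<And>y. weight (label_weight y) t = balanced D y"
        "lookup s (0, 0, j) = 0 \<or> lookup s (1, 1, j) = 0"
        "lookup t (0, 0, j) = 0 \<or> lookup t (1, 1, j) = 0"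
        "\<And>u. weight (\<lambda>v. lookup (rank1_exp {j} v) u) s = weight (\<lambda>v. lookup (rank1_exp {j} v) u) t" for s t
        by (rule rank1_inj[OF that(1,2,5,6,7)])
    qed blast
    have xF: "subst (rank1 ?S) (det_poly j) = det_poly j"
      by (simp add: det_poly_def subst.hom_minus subst.hom_mult)
    show ?case
    proof (cases "q = 0")
      case True
      then have "subst (rank1 ?S) g = F" using q(1) by simp
      then show ?thesis unfolding liftable_def using g by blast
    next
      case False
      then obtain t where t: "t \<in> keys q" by (metis ex_in_conv keys_eq_empty)
      have "count D j \<ge> 2" using dq[OF t, of "(True, j)"] by simp
      then have "{#j, j#} \<subseteq># D" by (simp add: subseteq_mset_def)
      then obtain E where E: "D = {#j, j#} + E" by (metis subset_mset.le_iff_add)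
      have "weight (label_weight y) s = balanced E y" if "s \<in> keys q" for s y
        using dq[OF that, of y] by (cases y) (auto simp: E split: if_splits)
      then have "multihom (balanced E) q" by (simp add: multihom_def homogeneous_def)
      have "liftable (insert j J) E q"
        by (rule less.hyps) (use q \<open>multihom (balanced E) q\<close> E D in auto)
      then obtain h where h: "h \<in> R" "multihom (balanced E) h" "subst (rank1 ?S) h = q" unfolding liftable_def by blast
      have "multihom (balanced {#j, j#}) (det_poly j)"
        unfolding multihom_def det_poly_def by (auto intro!: homogeneous_diff homogeneous_mult_eq)
      from multihom_mult[OF this h(2)] have "multihom (balanced D) (det_poly j * h)" by (simp only: E count_union)
      moreover have "subst (rank1 ?S) (g + det_poly j * h) = F"
        using q(1) by (simp add: subst.hom_add subst.hom_mult h xF flip: q(1))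
      moreover have "det_poly j \<in> R" using det_poly_in J by simp
      ultimately show ?thesis
        unfolding liftable_def using g h by (intro bexI[of _ "g + det_poly j * h"]) (auto intro: multihom_add R_add R_mult)
    qed
  qed
qed

end

section \<open>The elements xi as traces\<close>

lemma det_2x2: "det (mat 2 2 f) = f (0, 0) * f (1, 1) - f (0, 1) * (f (1, 0) :: 'a::comm_ring_1)"
proof -
  have "det (mat 2 2 f) = (\<Sum>j<2. mat 2 2 f $$ (0, j) * cofactor (mat 2 2 f) 0 j)"
    by (rule laplace_expansion_row) auto
  also have "\<dots> = f (0, 0) * cofactor (mat 2 2 f) 0 0 + f (0, 1) * cofactor (mat 2 2 f) 0 1"
    by (simp add: numeral_2_eq_2)
  also have "cofactor (mat 2 2 f) 0 0 = f (1, 1)"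
    by (simp add: cofactor_def det_single mat_delete_def)
  also have "cofactor (mat 2 2 f) 0 1 = - f (1, 0)"
    by (simp add: cofactor_def det_single mat_delete_def)
  finally show ?thesis by simp
qed

lemma det_blocks:
  fixes B :: "nat \<Rightarrow> nat \<Rightarrow> nat \<Rightarrow> 'a::idom"
  shows "det (mat (2 * q) (2 * q) (\<lambda>(a, b). if a div 2 = b div 2 then B (a div 2) (a mod 2) (b mod 2) else 0))
    = (\<Prod>r<q. B r 0 0 * B r 1 1 - B r 0 1 * B r 1 0)"
proof (induct q)
  case (Suc q)
  let ?f = "\<lambda>(a, b). if a div 2 = b div 2 then B (a div 2) (a mod 2) (b mod 2) else 0"
  have 0: "a div 2 = q \<and> a mod 2 = a - 2 * q" if "a < 2 * Suc q" "\<not> a < 2 * q" for a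
    using that by presburger
  have 1: "a div 2 < q" if "a < 2 * q" for a using that by presburger
  have "mat (2 * Suc q) (2 * Suc q) ?f
    = four_block_mat (mat (2 * q) (2 * q) ?f) (0\<^sub>m (2 * q) 2) (0\<^sub>m 2 (2 * q)) (mat 2 2 (\<lambda>(i, j). B q i j))"
    (is "?L = ?R")
  proof (rule eq_matI)
    fix a b assume "a < dim_row ?R" "b < dim_col ?R"
    then have ab: "a < 2 * Suc q" "b < 2 * Suc q" by simp_all
    show "?L $$ (a, b) = ?R $$ (a, b)"
      using ab 0[OF ab(1)] 0[OF ab(2)] 1[of a] 1[of b]
      by (cases "a < 2 * q"; cases "b < 2 * q") auto
  qed simp_all
  then have "det ?L = det (mat (2 * q) (2 * q) ?f) * det (mat 2 2 (\<lambda>(i, j). B q i j))"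
    by (simp add: det_four_block_mat_upper_right_zero[of _ "2 * q" _ 2])
  then show ?case by (simp add: Suc det_2x2)
qed simp

lemma lookup_coeff_map:
  assumes "comm_ring_hom h"
  shows "lookup (eval_with (\<lambda>c. MConst (h c)) MVar p) t = h (lookup p t)"
proof -
  interpret comm_ring_hom h by fact
  have "eval_with (\<lambda>c. MConst (h c)) MVar p = (\<Sum>s\<in>keys p. single s (h (lookup p s)))"
    unfolding eval_with_def by (rule sum.cong) (simp_all add: eval_monomial_MVar MConst_def mult_single)
  then have "lookup (eval_with (\<lambda>c. MConst (h c)) MVar p) t
      = (\<Sum>s\<in>keys p. if s = t then h (lookup p s) else 0)"
    by (auto simp: lookup_sum lookup_single when_def intro!: sum.cong)
  then show ?thesis by (simp add: sum.delta in_keys_iff)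
qed

lemma div_2_less: "a < 2 * q \<Longrightarrow> a div 2 < (q::nat)" by presburger

lemma xi_hom:
  assumes h: "comm_ring_hom h" and y: "\<And>s. s \<in> {1..2 * q} \<Longrightarrow> y s \<in> carrier_mat 2 2"
  shows "xi q (\<lambda>s. map_mat h (y s)) = h (xi q y)"
proof -
  interpret comm_ring_hom h by fact
  let ?H = "eval_with (\<lambda>c. MConst (h c)) MVar"
  have Hc: "comm_ring_hom (\<lambda>c. MConst (h c))" by (rule hom_compose[OF MConst_hom h])
  interpret H: comm_ring_hom ?H by (rule comm_ring_hom.eval_with_hom[OF Hc])
  have [simp]: "?H (MVar v) = MVar v" "?H (MConst c) = MConst (h c)" for v c
    by (rule comm_ring_hom.eval_with_MVar[OF Hc], rule comm_ring_hom.eval_with_MConst[OF Hc])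
  have y': "h (y s $$ (i mod 2, j mod 2)) = map_mat h (y s) $$ (i mod 2, j mod 2)" if "s \<in> {1..2 * q}" for s i j
    using y[OF that] by auto
  have "xi_mat q (\<lambda>s. map_mat h (y s)) = map_mat ?H (xi_mat q y)"
  proof (rule eq_matI)
    fix a b assume "a < dim_row (map_mat ?H (xi_mat q y))" "b < dim_col (map_mat ?H (xi_mat q y))"
    then have ab: "a < 2 * q" "b < 2 * q" by (simp_all add: xi_mat_def)
    have "a div 2 < q" "b div 2 < q" using ab by (simp_all add: div_2_less)
    then show "xi_mat q (\<lambda>s. map_mat h (y s)) $$ (a, b) = map_mat ?H (xi_mat q y) $$ (a, b)"
      using ab by (simp add: xi_mat_def Let_def H.hom_mult y')
  qed (simp_all add: xi_mat_def)
  then show ?thesis by (simp add: xi_def lookup_coeff_map[OF h])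
qed

definition xi_exp :: "nat \<Rightarrow> zwvar \<Rightarrow>\<^sub>0 nat" where
  "xi_exp q = (\<Sum>r\<in>{1..q}. single (Z r) 1 + single (W r) 1)"

lemma eval_monomial_sum: "eval_monomial f (\<Sum>x\<in>A. t x) = (\<Prod>x\<in>A. eval_monomial f (t x))"
  by (induct A rule: infinite_finite_induct) (simp_all add: eval_monomial_add)

text \<open>Multiplying one of the matrices by a scalar amounts to multiplying the variable next to it.\<close>

lemma xi_scale:
  assumes y: "\<And>s. s \<in> {1..2 * q} \<Longrightarrow> y s \<in> carrier_mat 2 2"
  shows "xi q (\<lambda>s. t s \<cdot>\<^sub>m y s) = xi q y * (\<Prod>r\<in>{1..q}. t r * t (q + r))"
proof -
  define c where "c v = (case v of Z r \<Rightarrow> t r | W r \<Rightarrow> t (q + r))" for v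
  let ?H = "subst (\<lambda>v. MConst (c v) * MVar v)"
  have y': "(t s \<cdot>\<^sub>m y s) $$ (i mod 2, j mod 2) = t s * y s $$ (i mod 2, j mod 2)" if "s \<in> {1..2 * q}" for s i j
    using y[OF that] by auto
  have "xi_mat q (\<lambda>s. t s \<cdot>\<^sub>m y s) = map_mat ?H (xi_mat q y)"
  proof (rule eq_matI)
    fix a b assume "a < dim_row (map_mat ?H (xi_mat q y))" "b < dim_col (map_mat ?H (xi_mat q y))"
    then have ab: "a < 2 * q" "b < 2 * q" by (simp_all add: xi_mat_def)
    have "a div 2 < q" "b div 2 < q" using ab by (simp_all add: div_2_less)
    then show "xi_mat q (\<lambda>s. t s \<cdot>\<^sub>m y s) $$ (a, b) = map_mat ?H (xi_mat q y) $$ (a, b)"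
      using ab by (simp add: xi_mat_def Let_def subst.hom_mult y' c_def MConst_mult mult_ac mult_2 mult_2_right)
  qed (simp_all add: xi_mat_def)
  then have "xi q (\<lambda>s. t s \<cdot>\<^sub>m y s) = xi q y * eval_monomial c (xi_exp q)"
    by (simp add: xi_def xi_exp_def lookup_subst_scale)
  also have "eval_monomial c (xi_exp q) = (\<Prod>r\<in>{1..q}. t r * t (q + r))"
    by (simp add: xi_exp_def eval_monomial_sum eval_monomial_add c_def)
  finally show ?thesis .
qed

text \<open>For matrices \<open>y\<^sub>s = u\<^sub>s v\<^sub>s\<^sup>T\<close> of rank one, the block matrix is a product of a block diagonal matrix
  built from the \<open>u\<^sub>s\<close>, a diagonal matrix of variables, and a matrix built from the \<open>v\<^sub>s\<close> which becomes
  block diagonal after a cyclic shift of its rows.  The sign of this shift is \<open>\<epsilon>\<close>.\<close>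

lemma xi_rank_one:
  assumes q: "q \<ge> 2"
  obtains \<epsilon> :: "'a::idom" where "\<epsilon> = 1 \<or> \<epsilon> = -1"
    "\<And>u v. xi q (\<lambda>s. mat 2 2 (\<lambda>(i, j). u s i * v s j)) = \<epsilon> *
      ((\<Prod>r<q. u (r + 1) 0 * u (q + r + 1) 1 - u (r + 1) 1 * u (q + r + 1) 0) *
       (\<Prod>r<q. v (q + r + 1) 0 * v ((r + 1) mod q + 1) 1 - v (q + r + 1) 1 * v ((r + 1) mod q + 1) 0))"
proof -
  let ?n = "2 * q"
  \<comment> \<open>The cyclic shift brings the two rows of \<open>v\<close>-vectors of each block column next to each other.\<close>
  define p where "p n = (if n < ?n then (if n = 0 then ?n - 1 else n - 1) else n)" for n
  have p: "p permutes {0..<?n}"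
  proof (rule bij_imp_permutes)
    have "inj_on p {0..<?n}" by (auto simp: inj_on_def p_def split: if_splits)
    moreover have "p ` {0..<?n} \<subseteq> {0..<?n}" by (auto simp: p_def)
    ultimately show "bij_betw p {0..<?n} {0..<?n}"
      by (simp add: bij_betw_def endo_inj_surj)
  qed (auto simp: p_def)
  define \<epsilon> :: 'a where "\<epsilon> = signof p"
  have \<epsilon>: "\<epsilon> = 1 \<or> \<epsilon> = -1" unfolding \<epsilon>_def by (auto simp: sign_def)
  show thesis
  proof
    show "\<epsilon> = 1 \<or> \<epsilon> = -1" by (fact \<epsilon>)
    fix u v :: "nat \<Rightarrow> nat \<Rightarrow> 'a"
    let ?y = "\<lambda>s. mat 2 2 (\<lambda>(i, j). u s i * v s j)"
    \<comment> \<open>Positions count from zero: position \<open>2r\<close> belongs to the variable \<open>Z (r + 1)\<close>, position \<open>2r + 1\<close> to \<open>W (r + 1)\<close>.\<close>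
    define idx where "idx n = (if even n then n div 2 + 1 else q + n div 2 + 1)" for n
    define var where "var n = (if even n then Z (n div 2 + 1) else W (n div 2 + 1))" for n
    define col where "col n = (if even n then n div 2 else (n div 2 + 1) mod q)" for n
    define P0 where "P0 = mat ?n ?n (\<lambda>(a, n). if a div 2 = n div 2 then u (idx n) (a mod 2) else 0)"
    define Q0 where "Q0 = mat ?n ?n (\<lambda>(n, b). if col n = b div 2 then v (idx n) (b mod 2) else 0)"
    define D where "D = mat ?n ?n (\<lambda>(a, b). if a = b then MVar (var a) else (0 :: (zwvar, 'a) mpoly))"
    define P where "P = mat ?n ?n (\<lambda>(a, n). MConst (P0 $$ (a, n)) * (MVar (var n) :: (zwvar, 'a) mpoly))"
    have PD: "P = map_mat MConst P0 * D"
    proof (rule eq_matI)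
      fix a n assume "a < dim_row (map_mat MConst P0 * D)" "n < dim_col (map_mat MConst P0 * D)"
      then have an: "a < ?n" "n < ?n" by (simp_all add: P0_def D_def)
      have "(map_mat MConst P0 * D) $$ (a, n) = (\<Sum>k<?n. MConst (P0 $$ (a, k)) * (if k = n then MVar (var k) else 0))"
        using an by (simp add: P0_def D_def scalar_prod_def lessThan_atLeast0)
      also have "\<dots> = (\<Sum>k<?n. if k = n then MConst (P0 $$ (a, k)) * MVar (var k) else 0)"
        by (rule sum.cong) auto
      also have "\<dots> = P $$ (a, n)" using an by (simp add: P_def)
      finally show "P $$ (a, n) = (map_mat MConst P0 * D) $$ (a, n)" ..
    qed (simp_all add: P_def P0_def D_def)
    have "xi_mat q ?y = P * map_mat MConst Q0"
    proof (rule eq_matI)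
      fix a b assume "a < dim_row (P * map_mat MConst Q0)" "b < dim_col (P * map_mat MConst Q0)"
      then have ab: "a < ?n" "b < ?n" by (simp_all add: P_def Q0_def)
      define r where "r = a div 2"
      define s where "s = b div 2"
      have rs: "r < q" "s < q" using ab by (simp_all add: r_def s_def div_2_less)
      have "(P * map_mat MConst Q0) $$ (a, b) = (\<Sum>n<?n. P $$ (a, n) * MConst (Q0 $$ (n, b)))"
        using ab by (simp add: P_def Q0_def scalar_prod_def lessThan_atLeast0)
      also have "\<dots> = (\<Sum>n\<in>{2 * r, 2 * r + 1}. P $$ (a, n) * MConst (Q0 $$ (n, b)))"
      proof (rule sum.mono_neutral_right)
        show "{2 * r, 2 * r + 1} \<subseteq> {..<?n}" using rs by auto
        show "\<forall>n\<in>{..<?n} - {2 * r, 2 * r + 1}. P $$ (a, n) * MConst (Q0 $$ (n, b)) = 0"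
        proof
          fix n assume n: "n \<in> {..<?n} - {2 * r, 2 * r + 1}"
          then have "r \<noteq> n div 2" by auto
          then show "P $$ (a, n) * MConst (Q0 $$ (n, b)) = 0"
            using n ab by (simp add: P_def P0_def r_def)
        qed
      qed simp
      also have "\<dots> = MVar (Z (r + 1)) * MConst (u (r + 1) (a mod 2)) * MConst (if s = r then v (r + 1) (b mod 2) else 0)
        + MVar (W (r + 1)) * MConst (u (q + r + 1) (a mod 2)) * MConst (if s = (r + 1) mod q then v (q + r + 1) (b mod 2) else 0)"
        using ab rs by (auto simp: P_def P0_def Q0_def r_def[symmetric] s_def[symmetric] var_def idx_def col_def mult_ac)
      also have "\<dots> = xi_mat q ?y $$ (a, b)"
      proof -
        consider "s = r" | "s = r + 1" | "s \<noteq> r" "s \<noteq> r + 1" by blast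
        then show ?thesis
        proof cases
          case 1
          then have "s \<noteq> (r + 1) mod q" using q rs by (cases "r + 1 = q") auto
          then show ?thesis using ab 1
            by (simp add: xi_mat_def Let_def r_def[symmetric] s_def[symmetric] MConst_mult mult_ac)
        next
          case 2
          then have "s = (r + 1) mod q" using rs by simp
          then show ?thesis using ab 2
            by (simp add: xi_mat_def Let_def r_def[symmetric] s_def[symmetric] MConst_mult mult_ac)
        next
          case 3
          then have "s = (r + 1) mod q \<longleftrightarrow> r + 1 = q \<and> s = 0" using rs by (cases "r + 1 = q") auto
          then show ?thesis using ab 3
            by (auto simp: xi_mat_def Let_def r_def[symmetric] s_def[symmetric] MConst_mult mult_ac mult_2 mult_2_right)
        qed
      qed
      finally show "xi_mat q ?y $$ (a, b) = (P * map_mat MConst Q0) $$ (a, b)" ..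
    qed (simp_all add: xi_mat_def P_def Q0_def)
    then have "det (xi_mat q ?y) = det P * det (map_mat MConst Q0)"
      by (simp add: det_mult[of _ ?n] P_def Q0_def)
    also have "det P = det (map_mat MConst P0) * det D"
      unfolding PD by (rule det_mult[of _ ?n]) (simp_all add: P0_def D_def)
    finally have det: "det (xi_mat q ?y) = MConst (det P0 * det Q0) * det D"
      by (simp add: MConst_mult mult_ac)
    have "det D = (\<Prod>n<?n. MVar (var n))"
    proof -
      have "det D = prod_list (diag_mat D)"
        by (rule det_upper_triangular[of _ ?n]) (auto simp: D_def)
      also have "diag_mat D = map (\<lambda>n. MVar (var n)) [0..<?n]"
        by (auto simp: diag_mat_def D_def)
      finally show ?thesis by (simp add: prod.distinct_set_conv_list lessThan_atLeast0 flip: set_upt)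
    qed
    also have "\<dots> = (\<Prod>r<q. MVar (Z (r + 1)) * MVar (W (r + 1)))"
    proof -
      have "(\<Prod>n<2 * k. MVar (var n)) = (\<Prod>r<k. MVar (Z (r + 1)) * (MVar (W (r + 1)) :: (zwvar, 'a) mpoly))" for k
        by (induct k) (simp_all add: var_def mult_ac)
      then show ?thesis .
    qed
    also have "\<dots> = (\<Prod>r\<in>{1..q}. MVar (Z r) * MVar (W r))"
      by (rule prod.reindex_bij_witness[of _ "\<lambda>r. r - 1" "\<lambda>r. r + 1"]) auto
    also have "\<dots> = single (xi_exp q) 1"
    proof -
      have "(\<Prod>r\<in>A. MVar (Z r) * (MVar (W r) :: (zwvar, 'a) mpoly)) = single (\<Sum>r\<in>A. single (Z r) 1 + single (W r) 1) 1"
        if "finite A" for A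
        using that by induct (simp_all add: MVar_def mult_single)
      then show ?thesis by (simp add: xi_exp_def)
    qed
    finally have "xi q ?y = det P0 * det Q0"
      unfolding xi_def det by (simp add: MConst_def mult_single xi_exp_def)
    moreover have "det P0 = (\<Prod>r<q. u (r + 1) 0 * u (q + r + 1) 1 - u (r + 1) 1 * u (q + r + 1) 0)"
    proof -
      have "P0 = mat ?n ?n (\<lambda>(a, b). if a div 2 = b div 2
          then u (if b mod 2 = 0 then a div 2 + 1 else q + a div 2 + 1) (a mod 2) else 0)"
        unfolding P0_def by (rule cong_mat) (auto simp: idx_def even_iff_mod_2_eq_zero)
      then show ?thesis
        using det_blocks[of q "\<lambda>r i j. u (if j = 0 then r + 1 else q + r + 1) i"]
        by (simp add: mult_ac)
    qed
    moreover have "det Q0 = \<epsilon> * (\<Prod>r<q. v (q + r + 1) 0 * v ((r + 1) mod q + 1) 1 - v (q + r + 1) 1 * v ((r + 1) mod q + 1) 0)"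
    proof -
      define B where "B r i j = v (if i = 0 then (if r = 0 then q + q else q + r) else r + 1) j" for r i j :: nat
      have Q0: "Q0 \<in> carrier_mat ?n ?n" by (simp add: Q0_def)
      have "mat ?n ?n (\<lambda>(n, b). Q0 $$ (p n, b))
        = mat ?n ?n (\<lambda>(a, b). if a div 2 = b div 2 then B (a div 2) (a mod 2) (b mod 2) else 0)"
      proof (rule cong_mat)
        fix n b assume nb: "n < ?n" "b < ?n"
        then have pn: "p n < ?n" by (auto simp: p_def)
        have "col (p n) = n div 2 \<and> idx (p n) = (if n mod 2 = 0 then (if n div 2 = 0 then q + q else q + n div 2) else n div 2 + 1)"
        proof (cases "even n")
          case True
          then obtain k where k: "n = 2 * k" by blast
          show ?thesis
          proof (cases k)
            case 0
            have "odd (?n - 1)" "(?n - 1) div 2 = q - 1" using q by auto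
            then show ?thesis using 0 k q by (simp add: p_def col_def idx_def)
          next
            case (Suc l)
            have "n - 1 = 2 * l + 1" using k Suc by simp
            then show ?thesis using k nb Suc by (simp add: p_def col_def idx_def)
          qed
        next
          case False
          then obtain k where k: "n = 2 * k + 1" by (auto elim: oddE)
          then show ?thesis using nb by (simp add: p_def col_def idx_def)
        qed
        then show "(\<lambda>(n, b). Q0 $$ (p n, b)) (n, b) = (\<lambda>(a, b). if a div 2 = b div 2 then B (a div 2) (a mod 2) (b mod 2) else 0) (n, b)"
          using nb pn by (simp add: Q0_def B_def)
      qed simp_all
      then have "signof p * det Q0 = (\<Prod>r<q. B r 0 0 * B r 1 1 - B r 0 1 * B r 1 0)"
        using det_permute_rows[OF Q0 p] det_blocks[of q B] by simp
      moreover have "\<epsilon> * \<epsilon> = 1" using \<epsilon> by auto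
      then have "det Q0 = \<epsilon> * (\<epsilon> * det Q0)" by (simp flip: mult.assoc)
      ultimately have "det Q0 = \<epsilon> * (\<Prod>r<q. B r 0 0 * B r 1 1 - B r 0 1 * B r 1 0)"
        by (simp only: \<epsilon>_def)
      also have "(\<Prod>r<q. B r 0 0 * B r 1 1 - B r 0 1 * B r 1 0)
        = (\<Prod>r<q. v (q + r + 1) 0 * v ((r + 1) mod q + 1) 1 - v (q + r + 1) 1 * v ((r + 1) mod q + 1) 0)"
      proof -
        obtain k where k: "q = Suc k" using q by (cases q) auto
        define g where "g r = B r 0 0 * B r 1 1 - B r 0 1 * B r 1 0" for r
        define h where "h r = v (q + r + 1) 0 * v ((r + 1) mod q + 1) 1
          - v (q + r + 1) 1 * v ((r + 1) mod q + 1) 0" for r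
        have "(\<Prod>r<Suc k. g r) = g 0 * (\<Prod>r<k. g (Suc r))"
          by (rule prod.lessThan_Suc_shift)
        also have "(\<Prod>r<k. g (Suc r)) = (\<Prod>r<k. h r)"
          by (rule prod.cong) (auto simp: g_def h_def B_def k)
        also have "g 0 = h k" by (simp add: g_def h_def B_def k)
        also have "h k * (\<Prod>r<k. h r) = (\<Prod>r<Suc k. h r)" by simp
        finally show ?thesis by (simp only: g_def h_def k)
      qed
      finally show ?thesis .
    qed
    ultimately show "xi q ?y = \<epsilon> *
      ((\<Prod>r<q. u (r + 1) 0 * u (q + r + 1) 1 - u (r + 1) 1 * u (q + r + 1) 0) *
       (\<Prod>r<q. v (q + r + 1) 0 * v ((r + 1) mod q + 1) 1 - v (q + r + 1) 1 * v ((r + 1) mod q + 1) 0))"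
      by (simp add: mult_ac)
  qed
qed

text \<open>The sign is chosen so that the trace words below specialise to closed walks without a sign.\<close>

fun neg_adjugate :: "nat \<Rightarrow> nat \<Rightarrow> nat \<Rightarrow> (xvar, rat) mpoly" where
  "neg_adjugate k i j = (if i = j then - MVar (1 - i, 1 - j, k) else MVar (i, j, k))"

fun trace_word :: "nat list \<Rightarrow> nat \<Rightarrow> nat \<Rightarrow> (xvar, rat) mpoly" where
  "trace_word (a # b # c) i j = (\<Sum>k<2. \<Sum>l<2. neg_adjugate a i k * MVar (k, l, b) * trace_word c l j)"
| "trace_word c i j = of_bool (i = j)"

text \<open>For a list of indices \<open>a, b, c, d, \<dots>\<close> this is the trace of
  \<open>(- adj x\<^sub>a) x\<^sub>b (- adj x\<^sub>c) x\<^sub>d \<dots>\<close>.  Up to sign the elements \<open>xi\<close> are such traces, whose values on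
  matrices of rank one and on scalar matrices are evident.\<close>

definition trace_poly :: "nat list \<Rightarrow> (xvar, rat) mpoly" where
  "trace_poly c = trace_word c 0 0 + trace_word c 1 1"

lemma sum_less_2: "(\<Sum>k<2. f k) = f 0 + f (1::nat)"
  by (simp add: numeral_2_eq_2)

lemma int_coeffs_trace_poly: "int_coeffs (trace_poly c)"
proof -
  have "int_coeffs (neg_adjugate k i j)" for k i j by simp
  moreover have "int_coeffs (of_bool b :: (xvar, rat) mpoly)" for b by (cases b) simp_all
  ultimately have "int_coeffs (trace_word c i j)" for i j
    by (induct c i j rule: trace_word.induct)
       (auto intro!: int_coeffs_sum int_coeffs_mult simp del: neg_adjugate.simps)
  then show ?thesis by (simp add: trace_poly_def int_coeffs_add)
qed

lemma multihom_MVar: "i < 2 \<Longrightarrow> j < 2 \<Longrightarrow> multihom (balanced {#k#}) (MVar (i, j, k))"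
  by (auto simp: multihom_def)

lemma multihom_mult_balanced: "multihom (balanced D) p \<Longrightarrow> multihom (balanced E) q \<Longrightarrow> multihom (balanced (D + E)) (p * q)"
  using multihom_mult by fastforce

lemma diff_1_less_2: "1 - i < (2::nat)" by simp

lemma multihom_neg_adjugate: "i < 2 \<Longrightarrow> j < 2 \<Longrightarrow> multihom (balanced {#k#}) (neg_adjugate k i j)"
  by (cases "i = j") (simp_all only: neg_adjugate.simps if_True if_False simp_thms multihom_uminus multihom_MVar diff_1_less_2)

lemma multihom_sum: "(\<And>x. x \<in> A \<Longrightarrow> multihom d (f x)) \<Longrightarrow> multihom d (sum f A)"
  by (auto simp: multihom_def intro: homogeneous_sum)

lemma multihom_trace_poly:
  assumes "even (length c)" shows "multihom (balanced (mset c)) (trace_poly c)"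
proof -
  have "i < 2 \<Longrightarrow> j < 2 \<Longrightarrow> multihom (balanced (mset c)) (trace_word c i j)" for i j
    using assms
  proof (induct c i j rule: trace_word.induct)
    case (1 a b c i j)
    have *: "multihom (balanced (mset (a # b # c))) (neg_adjugate a i k * MVar (k, l, b) * trace_word c l j)"
      if "k < 2" "l < 2" for k l
    proof -
      have "multihom (balanced {#a#}) (neg_adjugate a i k)" using 1(2) that(1) by (rule multihom_neg_adjugate)
      moreover have "multihom (balanced (mset c)) (trace_word c l j)" using 1(1)[of k l] that 1(3,4) by simp
      ultimately have "multihom (balanced ({#a#} + {#b#} + mset c)) (neg_adjugate a i k * MVar (k, l, b) * trace_word c l j)"
        by (intro multihom_mult_balanced multihom_MVar that)
      moreover have "{#a#} + {#b#} + mset c = mset (a # b # c)" by simp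
      ultimately show ?thesis by (simp only:)
    qed
    then show ?case by (auto intro!: multihom_sum simp del: neg_adjugate.simps)
  next
    case ("2_1" i j)
    then show ?case by (cases "i = j") simp_all
  qed simp
  then show ?thesis by (simp add: trace_poly_def multihom_add)
qed

lemma vars_in_trace_poly:
  assumes "set c \<subseteq> K" shows "vars_in ({0..<2} \<times> {0..<2} \<times> K) (trace_poly c)"
proof -
  have "i < 2 \<Longrightarrow> j < 2 \<Longrightarrow> vars_in ({0..<2} \<times> {0..<2} \<times> K) (trace_word c i j)" for i j
    using assms
  proof (induct c i j rule: trace_word.induct)
    case (1 a b c i j)
    then show ?case by (auto intro!: vars_in_sum vars_in_mult)
  next
    case ("2_1" i j)
    then show ?case by (cases "i = j") simp_all
  next
    case ("2_2" x i j)
    then show ?case by (cases "i = j") simp_all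
  qed
  then show ?thesis by (simp add: trace_poly_def vars_in_add)
qed

text \<open>The negative adjugate of \<open>u v\<^sup>T\<close> is again a product of a column and a row, namely of the vectors
  \<open>v'\<close> and \<open>u'\<close> below, which are \<open>v\<close> and \<open>u\<close> rotated by a right angle.  So the product telescopes into
  brackets.\<close>

lemma rank1_trace_poly:
  assumes "even (length c)" "c \<noteq> []"
  shows "subst (rank1 UNIV) (trace_poly c) = walk c"
proof -
  let ?\<phi> = "subst (rank1 UNIV)"
  define v where "v k j = (MVar (2, j, k) :: (xvar, rat) mpoly)" for k j :: nat
  define v' where "v' k j = (if j = 0 then - v k 1 else v k 0)" for k j :: nat
  define u where "u k i = (MVar (i, 2, k) :: (xvar, rat) mpoly)" for k i :: nat
  define u' where "u' k i = (if i = 0 then u k 1 else - u k 0)" for k i :: nat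
  have x: "?\<phi> (MVar (i, j, k)) = u k i * v k j" if "i < 2" "j < 2" for i j k
    using that by (simp add: u_def v_def)
  have ad: "?\<phi> (neg_adjugate k i j) = v' k i * u' k j" if "i < 2" "j < 2" for i j k
    using that by (auto simp: less_2_iff u_def v_def u'_def v'_def subst.hom_uminus)
  have uu: "u' a 0 * u b 0 + u' a 1 * u b 1 = - bracket_u a b" for a b
    by (simp add: bracket_def u'_def u_def algebra_simps)
  have vv: "v b 0 * v' e 0 + v b 1 * v' e 1 = - bracket_v b e" for b e
    by (simp add: bracket_def v'_def v_def algebra_simps)
  have key: "?\<phi> (trace_word c i j) = - (pairs bracket_u c * pairs bracket_v (butlast (tl c)) * v' (hd c) i * v (last c) j)"
    if "i < 2" "j < 2" for i j
    using assms that
  proof (induct c i j rule: trace_word.induct)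
    case (1 a b c i j)
    show ?case
    proof (cases "c = []")
      case True
      have "?\<phi> (trace_word (a # b # c) i j) = v' a i * (u' a 0 * u b 0 + u' a 1 * u b 1) * v b j"
        using 1(4,5) by (auto simp: True sum_less_2 subst.hom_add subst.hom_mult x ad less_2_iff algebra_simps simp del: neg_adjugate.simps eval_with_def rank1.simps subst_MVar)
      then show ?thesis by (simp only: uu) (simp add: True mult_ac)
    next
      case False
      let ?p = "pairs bracket_u c * pairs bracket_v (butlast (tl c))"
      have IH: "?\<phi> (trace_word c l j) = - (?p * v' (hd c) l * v (last c) j)" if "l < 2" for l
        using 1(1)[of _ l] that 1(2,5) False by simp
      have "?\<phi> (trace_word (a # b # c) i j)
        = - (v' a i * (u' a 0 * u b 0 + u' a 1 * u b 1) * (v b 0 * v' (hd c) 0 + v b 1 * v' (hd c) 1) * ?p * v (last c) j)"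
        using 1(4,5) by (simp add: sum_less_2 subst.hom_add subst.hom_mult x ad IH algebra_simps del: neg_adjugate.simps subst_MVar)
      also have "\<dots> = - (v' a i * bracket_u a b * bracket_v b (hd c) * ?p * v (last c) j)"
        by (simp only: uu vv) simp
      also have "\<dots> = - (pairs bracket_u (a # b # c) * pairs bracket_v (butlast (tl (a # b # c))) * v' a i * v (last c) j)"
      proof -
        obtain e c' where c: "c = e # c'" using False by (cases c) auto
        have "c' \<noteq> []" using 1(2) c by auto
        then show ?thesis by (simp add: c mult_ac)
      qed
      finally show ?thesis using False by simp
    qed
  qed simp_all
  obtain x d where c: "c = x # d" using assms(2) by (cases c) auto
  then have d: "d \<noteq> []" using assms(1) by auto
  define z where "z = last c"
  have "subst (rank1 UNIV) (trace_poly c) = - (pairs bracket_u c * pairs bracket_v (butlast (tl c)) * (v z 0 * v' x 0 + v z 1 * v' x 1))"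
    using key[of 0 0] key[of 1 1] by (simp add: trace_poly_def subst.hom_add c z_def algebra_simps)
  also have "\<dots> = pairs bracket_u c * (pairs bracket_v (butlast (tl c)) * bracket_v z x)"
    by (simp only: vv) simp
  also have "\<dots> = walk c"
  proof -
    have "rotate1 c = butlast (tl c) @ [z, x]" using d by (simp add: c z_def)
    moreover have "even (length (butlast (tl c)))" using assms(1) d by (simp add: c)
    ultimately show ?thesis by (simp add: walk_def pairs_append)
  qed
  finally show ?thesis .
qed

lemma sl_inv_pairs:
  assumes "\<And>a b. sl_inv (f a b)" shows "sl_inv (pairs f c)"
  using assms by (induct f c rule: pairs.induct) (auto intro!: sl_inv_mult)

lemma sl_inv_walk: "sl_inv (walk c)"
  unfolding walk_def by (intro sl_inv_mult sl_inv_pairs sl_inv_bracket) simp_all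

lemma hybrid_vars_UNIV: "hybrid_vars UNIV = {0..<2} \<times> {0..<2} \<times> UNIV"
  by (auto simp: hybrid_vars_def)

lemma vars_in_sl_subst:
  assumes "vars_in (hybrid_vars UNIV) p" shows "vars_in (hybrid_vars UNIV) (subst (sl_subst c \<alpha> \<beta> \<gamma> \<delta>) p)"
  using assms
proof (rule vars_in_subst)
  fix v assume "v \<in> hybrid_vars UNIV"
  then show "vars_in (hybrid_vars UNIV) (sl_subst c \<alpha> \<beta> \<gamma> \<delta> v)"
    by (cases v; cases c) (auto simp: hybrid_vars_def intro!: vars_in_add vars_in_mult)
qed

text \<open>Both sides of the invariance are multilinear, and on matrices of rank one the value is a product of
  brackets.\<close>

lemma sl_inv_trace_poly:
  assumes c: "even (length c)" "c \<noteq> []" "distinct c" shows "sl_inv (trace_poly c)"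
  unfolding sl_inv_def
proof (intro allI impI)
  fix g and \<alpha> \<beta> \<gamma> \<delta> :: rat assume det: "\<alpha> * \<delta> - \<beta> * \<gamma> = 1"
  let ?l = "subst (sl_subst g \<alpha> \<beta> \<gamma> \<delta>)"
  have "?l (trace_poly c) - trace_poly c = 0"
  proof (rule rank1_determines_multilinear)
    have "vars_in (hybrid_vars UNIV) (trace_poly c)" using vars_in_trace_poly[of c UNIV] by (simp add: hybrid_vars_UNIV)
    then show "vars_in (hybrid_vars UNIV) (?l (trace_poly c) - trace_poly c)" by (intro vars_in_diff vars_in_sl_subst)
    show "multihom (balanced (mset c)) (?l (trace_poly c) - trace_poly c)" by (intro multihom_diff multihom_sl_subst multihom_trace_poly c)
    show "balanced (mset c) y \<le> 1" for y using c(3) by (simp add: distinct_count_atmost_1)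
    have "subst (rank1 UNIV) (?l (trace_poly c)) = ?l (walk c)"
      using subst_commute[OF rank1_sl_subst] rank1_trace_poly[OF c(1,2)] by metis
    also have "\<dots> = walk c" using sl_inv_walk[of c] det by (simp add: sl_inv_def)
    finally show "subst (rank1 UNIV) (?l (trace_poly c) - trace_poly c) = 0"
      by (simp add: subst.hom_minus rank1_trace_poly[OF c(1,2)])
  qed
  then show "?l (trace_poly c) = trace_poly c" by simp
qed

text \<open>The target has one variable \<open>\<epsilon>\<^sub>k\<close> for each generic matrix, which is specialised to
  \<open>\<epsilon>\<^sub>k I\<close>.\<close>

definition scalar_spec :: "xvar \<Rightarrow> (nat, rat) mpoly" where
  "scalar_spec = (\<lambda>(i, j, k). if i = j then MVar k else 0)"

lemma scalar_spec_simp: "scalar_spec (i, j, k) = (if i = j then MVar k else 0)"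
  by (simp add: scalar_spec_def)

text \<open>At scalar matrices a trace word is a scalar matrix of size two, whence the factor \<open>2\<close>.\<close>

lemma scalar_spec_trace_poly:
  assumes "even (length c)"
  shows "subst scalar_spec (trace_poly c) = 2 * (-1) ^ (length c div 2) * prod_list (map MVar c)"
proof -
  have "subst scalar_spec (trace_word c i j) = of_bool (i = j) * ((-1) ^ (length c div 2) * prod_list (map MVar c))"
    if "i < 2" "j < 2" for i j
    using assms that
  proof (induct c i j rule: trace_word.induct)
    case (1 a b c i j)
    have IH: "subst scalar_spec (trace_word c l j) = of_bool (l = j) * ((-1) ^ (length c div 2) * prod_list (map MVar c))"
      if "l < 2" for l using 1(1)[of _ l] that 1(2,4) by simp
    show ?case
      using 1(3,4) by (auto simp: sum_less_2 subst.hom_add subst.hom_mult subst.hom_uminus IH scalar_spec_simp less_2_iff mult_ac)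
  qed (simp_all add: of_bool_def)
  then show ?thesis by (simp add: trace_poly_def subst.hom_add)
qed

section \<open>The generators\<close>

text \<open>The order in which the closed walk attached to the block matrix of \<open>xi\<close> visits the matrices.\<close>

definition cycle_order :: "nat \<Rightarrow> (nat \<Rightarrow> nat) \<Rightarrow> nat list" where
  "cycle_order q \<kappa> = concat (map (\<lambda>r. [\<kappa> (r + 1), \<kappa> (q + r + 1)]) [0..<q])"

lemma pairs_concat: "pairs f (concat (map (\<lambda>r. [a r, b r]) [0..<n])) = (\<Prod>r<n. f (a r) (b r))"
proof (induct n)
  case (Suc n)
  have "length (concat (map (\<lambda>r. [a r, b r]) [0..<n])) = 2 * n" by (induct n) simp_all
  then have "even (length (concat (map (\<lambda>r. [a r, b r]) [0..<n])))" by simp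
  from pairs_append[OF this, of f "[a n, b n]"] show ?case by (simp add: Suc)
qed simp

lemma shift_concat:
  "concat (map (\<lambda>r. [a r, b r]) [0..<n]) @ [a n] = a 0 # concat (map (\<lambda>r. [b r, a (Suc r)]) [0..<n])"
  by (induct n) simp_all

lemma cycle_order_props:
  "length (cycle_order q \<kappa>) = 2 * q" "set (cycle_order q \<kappa>) = \<kappa> ` {1..2 * q}"
proof -
  show "length (cycle_order q \<kappa>) = 2 * q"
  proof -
    have "length (concat (map (\<lambda>r. [\<kappa> (r + 1), \<kappa> (q + r + 1)]) [0..<n])) = 2 * n" for n
      by (induct n) simp_all
    then show ?thesis by (simp only: cycle_order_def)
  qed
  have "set (cycle_order q \<kappa>) = \<kappa> ` ((\<lambda>r. r + 1) ` {0..<q} \<union> (\<lambda>r. q + r + 1) ` {0..<q})"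
  proof -
    have "set (cycle_order q \<kappa>) = (\<Union>r\<in>{0..<q}. {\<kappa> (r + 1), \<kappa> (q + r + 1)})" by (simp add: cycle_order_def)
    then show ?thesis by blast
  qed
  also have "(\<lambda>r. r + 1) ` {0..<q} \<union> (\<lambda>r. q + r + 1) ` {0..<q} = {1..2 * q}"
  proof -
    have "x \<in> (\<lambda>r. r + 1) ` {0..<q} \<union> (\<lambda>r. q + r + 1) ` {0..<q}" if "x \<in> {1..2 * q}" for x
    proof (cases "x \<le> q")
      case True
      then show ?thesis using that by (intro UnI1 image_eqI[of _ _ "x - 1"]) auto
    next
      case False
      then show ?thesis using that by (intro UnI2 image_eqI[of _ _ "x - q - 1"]) auto
    qed
    moreover have "(\<lambda>r. r + 1) ` {0..<q} \<union> (\<lambda>r. q + r + 1) ` {0..<q} \<subseteq> {1..2 * q}" by auto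
    ultimately show ?thesis by blast
  qed
  finally show "set (cycle_order q \<kappa>) = \<kappa> ` {1..2 * q}" .
qed

lemma distinct_cycle_order: "inj_on \<kappa> {1..2 * q} \<Longrightarrow> distinct (cycle_order q \<kappa>)"
  by (rule card_distinct) (simp add: cycle_order_props card_image)

lemma walk_cycle_order:
  assumes "q \<ge> 1"
  shows "walk (cycle_order q \<kappa>) = (\<Prod>r<q. bracket_u (\<kappa> (r + 1)) (\<kappa> (q + r + 1))) *
    (\<Prod>r<q. bracket_v (\<kappa> (q + r + 1)) (\<kappa> ((r + 1) mod q + 1)))"
proof -
  define a where "a r = \<kappa> (r mod q + 1)" for r
  define b where "b r = \<kappa> (q + r + 1)" for r
  have cycle_order: "cycle_order q \<kappa> = concat (map (\<lambda>r. [a r, b r]) [0..<q])"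
    unfolding cycle_order_def by (rule arg_cong[of _ _ concat], rule map_cong) (auto simp: a_def b_def)
  have "a q = a 0" by (simp add: a_def)
  obtain x d where xd: "cycle_order q \<kappa> = x # d" using assms cycle_order_props(1)[of q \<kappa>] by (cases "cycle_order q \<kappa>") auto
  have *: "cycle_order q \<kappa> @ [a 0] = a 0 # concat (map (\<lambda>r. [b r, a (Suc r)]) [0..<q])"
    using shift_concat[of a b q] \<open>a q = a 0\<close> by (simp add: cycle_order)
  then have "x = a 0" by (simp add: xd)
  then have "rotate1 (cycle_order q \<kappa>) = concat (map (\<lambda>r. [b r, a (Suc r)]) [0..<q])"
    using * by (simp add: xd)
  then have "walk (cycle_order q \<kappa>) = (\<Prod>r<q. bracket_u (a r) (b r)) * (\<Prod>r<q. bracket_v (b r) (a (Suc r)))"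
    unfolding walk_def by (simp only: cycle_order pairs_concat)
  then show ?thesis by (simp add: a_def b_def)
qed

lemma generic_mat_carrier: "generic_mat k \<in> carrier_mat 2 2"
  by (simp add: generic_mat_def)

lemma det_generic: "det (generic_mat k) = det_poly k"
  by (simp add: generic_mat_def det_2x2 det_poly_def)

lemma polar_2x2:
  "polar (mat 2 2 f) (mat 2 2 g) =
    f (0, 0) * g (1, 1) + g (0, 0) * f (1, 1) - f (0, 1) * g (1, 0) - g (0, 1) * (f (1, 0) :: 'a::comm_ring_1)"
proof -
  let ?z = "single (Z 1) (1::nat)" and ?w = "single (W 1) (1::nat)"
  have *: "lookup (det (mat 2 2 (\<lambda>ij. single z (f ij) + single w (g ij)))) (z + w)
    = f (0, 0) * g (1, 1) + g (0, 0) * f (1, 1) - f (0, 1) * g (1, 0) - g (0, 1) * f (1, 0)"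
    if "z \<noteq> w" for z w :: "zwvar \<Rightarrow>\<^sub>0 nat"
  proof -
    have "z + z \<noteq> z + w" "w + w \<noteq> z + w" using that by simp_all
    then show ?thesis
      by (simp add: det_2x2 distrib_left distrib_right mult_single lookup_add lookup_minus
        lookup_single when_def add.commute[of w z])
  qed
  have zw: "?z \<noteq> ?w"
    by (metis lookup_single_eq lookup_single_not_eq zwvar.distinct(1) zero_neq_one)
  have "MVar (Z 1) \<cdot>\<^sub>m map_mat MConst (mat 2 2 f) + MVar (W 1) \<cdot>\<^sub>m map_mat MConst (mat 2 2 g)
    = mat 2 2 (\<lambda>ij. single ?z (f ij) + single ?w (g ij))"
    by (rule eq_matI) (auto simp: MVar_def MConst_def mult_single)
  then show ?thesis
    unfolding polar_def by (simp only: *[OF zw])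
qed

lemma polar_generic: "polar (generic_mat l) (generic_mat r) = - trace_poly [l, r]"
  by (simp add: generic_mat_def polar_2x2 trace_poly_def sum_less_2)

text \<open>A weight which is constant on the entries of each matrix scales the matrices as a whole.  The case
  \<open>\<tau> = 0\<close> shows that only entries of matrices occur.\<close>

lemma generic_weight:
  fixes w :: "xvar \<Rightarrow> nat"
  assumes w: "\<And>i j k. i < 2 \<Longrightarrow> j < 2 \<Longrightarrow> w (i, j, k) = \<tau> k"
  shows "homogeneous w (\<Sum>r\<in>{1..q}. \<tau> (\<kappa> r) + \<tau> (\<kappa> (q + r))) (xi q (\<lambda>s. generic_mat (\<kappa> s)))"
proof (rule homogeneous_if_scale)
  let ?\<sigma> = "subst (\<lambda>v. MConst (2 ^ w v) * MVar v)" and ?\<xi> = "xi q (\<lambda>s. generic_mat (\<kappa> s))"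
  have scale: "map_mat ?\<sigma> (generic_mat (\<kappa> s)) = MConst (2 ^ \<tau> (\<kappa> s)) \<cdot>\<^sub>m generic_mat (\<kappa> s)" for s
    by (rule eq_matI) (auto simp: generic_mat_def w)
  have "?\<sigma> ?\<xi> = xi q (\<lambda>s. map_mat ?\<sigma> (generic_mat (\<kappa> s)))"
    by (rule xi_hom[symmetric]) (rule subst.comm_ring_hom_axioms generic_mat_carrier)+
  also have "\<dots> = xi q (\<lambda>s. MConst (2 ^ \<tau> (\<kappa> s)) \<cdot>\<^sub>m generic_mat (\<kappa> s))"
    by (simp only: scale)
  also have "\<dots> = ?\<xi> * (\<Prod>r\<in>{1..q}. MConst (2 ^ \<tau> (\<kappa> r)) * MConst (2 ^ \<tau> (\<kappa> (q + r))))"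
    by (rule xi_scale) (rule generic_mat_carrier)
  also have "(\<Prod>r\<in>{1..q}. MConst (2 ^ \<tau> (\<kappa> r)) * MConst (2 ^ \<tau> (\<kappa> (q + r))))
      = (MConst (2 ^ (\<Sum>r\<in>{1..q}. \<tau> (\<kappa> r) + \<tau> (\<kappa> (q + r)))) :: (xvar, rat) mpoly)"
    by (simp add: power_sum power_add MConst.hom_prod MConst.hom_mult)
  finally show "?\<sigma> ?\<xi> = MConst (2 ^ (\<Sum>r\<in>{1..q}. \<tau> (\<kappa> r) + \<tau> (\<kappa> (q + r)))) * ?\<xi>"
    by (simp add: mult.commute)
qed

lemma count_cycle_order:
  "count (mset (cycle_order q \<kappa>)) k = (\<Sum>r\<in>{1..q}. of_bool (\<kappa> r = k) + of_bool (\<kappa> (q + r) = k))"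
proof -
  have "count (mset (concat (map (\<lambda>r. [\<kappa> (r + 1), \<kappa> (q + r + 1)]) [0..<n]))) k
    = (\<Sum>r\<in>{1..n}. of_bool (\<kappa> r = k) + of_bool (\<kappa> (q + r) = k))" for n
    by (induct n) auto
  then show ?thesis by (simp only: cycle_order_def)
qed

text \<open>Both sides are linear in each of the matrices, and they agree up to sign on matrices of rank one.\<close>

lemma xi_generic:
  assumes q: "q \<ge> 2" and inj: "inj_on \<kappa> {1..2 * q}"
  shows "xi q (\<lambda>s. generic_mat (\<kappa> s)) = trace_poly (cycle_order q \<kappa>) \<or> xi q (\<lambda>s. generic_mat (\<kappa> s)) = - trace_poly (cycle_order q \<kappa>)"
proof -
  let ?\<xi> = "xi q (\<lambda>s. generic_mat (\<kappa> s))" and ?\<phi> = "subst (rank1 UNIV)"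
  obtain \<epsilon> :: "(xvar, rat) mpoly" where \<epsilon>: "\<epsilon> = 1 \<or> \<epsilon> = -1"
    and xi: "\<And>u v. xi q (\<lambda>s. mat 2 2 (\<lambda>(i, j). u s i * v s j)) = \<epsilon> *
      ((\<Prod>r<q. u (r + 1) 0 * u (q + r + 1) 1 - u (r + 1) 1 * u (q + r + 1) 0) *
       (\<Prod>r<q. v (q + r + 1) 0 * v ((r + 1) mod q + 1) 1 - v (q + r + 1) 1 * v ((r + 1) mod q + 1) 0))"
    by (rule xi_rank_one[OF q]) blast
  have spec: "map_mat ?\<phi> (generic_mat (\<kappa> s)) = mat 2 2 (\<lambda>(i, j). MVar (i, 2, \<kappa> s) * MVar (2, j, \<kappa> s))" for s
    by (rule eq_matI) (auto simp: generic_mat_def)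
  have "?\<phi> ?\<xi> = xi q (\<lambda>s. map_mat ?\<phi> (generic_mat (\<kappa> s)))"
    by (rule xi_hom[symmetric]) (rule subst.comm_ring_hom_axioms generic_mat_carrier)+
  also have "\<dots> = xi q (\<lambda>s. mat 2 2 (\<lambda>(i, j). MVar (i, 2, \<kappa> s) * MVar (2, j, \<kappa> s)))"
    by (simp only: spec)
  also have "\<dots> = \<epsilon> * walk (cycle_order q \<kappa>)"
    using xi[of "\<lambda>s i. MVar (i, 2, \<kappa> s)" "\<lambda>s j. MVar (2, j, \<kappa> s)"] q
    by (simp add: walk_cycle_order bracket_def)
  finally have \<phi>\<xi>: "?\<phi> ?\<xi> = \<epsilon> * walk (cycle_order q \<kappa>)" .
  have len: "even (length (cycle_order q \<kappa>))" "cycle_order q \<kappa> \<noteq> []"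
    using cycle_order_props(1)[of q \<kappa>] q by auto
  note \<phi>trace_poly = rank1_trace_poly[OF len]
  have "homogeneous (label_weight y) (balanced (mset (cycle_order q \<kappa>)) y) ?\<xi>" for y
    unfolding count_cycle_order by (rule generic_weight) (cases y; auto)
  then have multihom_xi: "multihom (balanced (mset (cycle_order q \<kappa>))) ?\<xi>" by (simp add: multihom_def)
  have vars_in_xi: "vars_in (hybrid_vars UNIV) ?\<xi>"
    using generic_weight[where w = "\<lambda>v. if v \<in> hybrid_vars UNIV then 0 else 1" and \<tau> = "\<lambda>_. 0" and q = q and \<kappa> = \<kappa>]
    by (simp add: vars_in_iff_homogeneous hybrid_vars_def)
  have vars_in_trace_poly': "vars_in (hybrid_vars UNIV) (trace_poly (cycle_order q \<kappa>))"
    using vars_in_trace_poly[of "cycle_order q \<kappa>" UNIV] by (simp add: hybrid_vars_UNIV)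
  have "?\<xi> - \<epsilon> * trace_poly (cycle_order q \<kappa>) = 0"
  proof (rule rank1_determines_multilinear)
    show "balanced (mset (cycle_order q \<kappa>)) y \<le> 1" for y
      using distinct_cycle_order[OF inj] by (simp add: distinct_count_atmost_1)
    show "vars_in (hybrid_vars UNIV) (?\<xi> - \<epsilon> * trace_poly (cycle_order q \<kappa>))"
      using \<epsilon> vars_in_xi vars_in_trace_poly' by (auto intro: vars_in_diff vars_in_add)
    show "multihom (balanced (mset (cycle_order q \<kappa>))) (?\<xi> - \<epsilon> * trace_poly (cycle_order q \<kappa>))"
      using \<epsilon> multihom_xi multihom_trace_poly[OF len(1)] by (auto intro: multihom_diff multihom_add)
    show "?\<phi> (?\<xi> - \<epsilon> * trace_poly (cycle_order q \<kappa>)) = 0"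
      using \<epsilon> by (auto simp: subst.hom_minus subst.hom_mult subst.hom_uminus subst.hom_add \<phi>\<xi> \<phi>trace_poly)
  qed
  then show ?thesis using \<epsilon> by auto
qed

lemma xi_cong:
  assumes "\<And>s. s \<in> {1..2 * q} \<Longrightarrow> y s = y' s" shows "xi q y = xi q y'"
proof -
  have "xi_mat q y = xi_mat q y'"
    unfolding xi_mat_def
  proof (rule cong_mat, goal_cases)
    case (3 a b)
    then have "a div 2 < q" "b div 2 < q" by (simp_all add: div_2_less)
    then show ?case using assms by (simp add: Let_def)
  qed simp_all
  then show ?thesis by (simp add: xi_def)
qed

definition increasing :: "nat set \<Rightarrow> nat \<Rightarrow> nat" where
  "increasing K s = sorted_list_of_set K ! (s - 1)"

lemma increasing_unique:
  assumes "strict_mono_on {1..n} \<kappa>" "\<kappa> ` {1..n} = K" "s \<in> {1..n}"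
  shows "\<kappa> s = increasing K s"
proof -
  have "sorted_wrt (\<lambda>x y. \<kappa> x \<le> \<kappa> y) [1..<n + 1]"
  proof (rule sorted_wrt_mono_rel)
    show "sorted_wrt (<) [1..<n + 1]" by (rule sorted_wrt_upt)
    show "\<kappa> x \<le> \<kappa> y" if "x \<in> set [1..<n + 1]" "y \<in> set [1..<n + 1]" "x < y" for x y
      using strict_mono_onD[OF assms(1), of x y] that by (simp del: upt_Suc)
  qed
  then have "sorted (map \<kappa> [1..<n + 1])" by (simp only: sorted_wrt_map)
  moreover have set: "set [1..<n + 1] = {1..n}"
    by (simp only: set_upt atLeastLessThanSuc_atLeastAtMost Suc_eq_plus1[symmetric])
  have "distinct (map \<kappa> [1..<n + 1])"
    using strict_mono_on_imp_inj_on[OF assms(1)] by (simp only: distinct_map distinct_upt set)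
  moreover have "set (map \<kappa> [1..<n + 1]) = K" using assms(2) by (simp only: set_map set)
  moreover have "finite K" using assms(2) by blast
  ultimately have "map \<kappa> [1..<n + 1] = sorted_list_of_set K"
    by (intro sorted_distinct_set_unique) (simp_all only: set_sorted_list_of_set
      sorted_sorted_list_of_set distinct_sorted_list_of_set)
  then have "increasing K s = map \<kappa> [1..<n + 1] ! (s - 1)" by (simp add: increasing_def del: upt_Suc)
  moreover have s: "1 \<le> s" "s \<le> n" using assms(3) by simp_all
  then have "s - 1 < length [1..<n + 1]" unfolding length_upt by linarith
  moreover have "[1..<n + 1] ! (s - 1) = 1 + (s - 1)" by (rule nth_upt) (use s in linarith)
  then have "[1..<n + 1] ! (s - 1) = s" using s by linarith
  ultimately show ?thesis by (simp only: nth_map)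
qed

lemma increasing_props:
  assumes "finite K" "card K = n"
  shows "strict_mono_on {1..n} (increasing K)" "increasing K ` {1..n} = K"
proof -
  have len: "length (sorted_list_of_set K) = n" using assms by simp
  show "strict_mono_on {1..n} (increasing K)"
    unfolding increasing_def
    by (rule strict_mono_onI, rule sorted_wrt_nth_less[of "(<)"])
       (use len in \<open>auto\<close>)
  have "increasing K ` {1..n} = (\<lambda>i. sorted_list_of_set K ! i) ` {0..<n}"
  proof -
    have "{0..<n} = (\<lambda>s. s - 1) ` {1..n}"
    proof (intro equalityI subsetI)
      fix x assume "x \<in> {0..<n}"
      then show "x \<in> (\<lambda>s. s - 1) ` {1..n}" by (intro image_eqI[of _ _ "x + 1"]) auto
    qed auto
    then show ?thesis by (simp add: image_image increasing_def)
  qed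
  also have "\<dots> = set (sorted_list_of_set K)" using len by (auto simp: set_conv_nth)
  finally show "increasing K ` {1..n} = K" using assms(1) by simp
qed

text \<open>The polarised determinants and the elements \<open>xi\<close> are indexed uniformly by the sets of matrices that they
  involve.  In particular such a generator is determined by its multidegree.\<close>

definition cycle_gen :: "nat set \<Rightarrow> (xvar, rat) mpoly" where
  "cycle_gen K = (if card K = 2 then polar (generic_mat (Min K)) (generic_mat (Max K))
    else xi (card K div 2) (\<lambda>s. generic_mat (increasing K s)))"

definition cycle_set :: "nat \<Rightarrow> nat set \<Rightarrow> bool" where
  "cycle_set m K \<longleftrightarrow> K \<subseteq> {1..m} \<and> even (card K) \<and> card K \<ge> 2"

lemma cycle_gen_trace_poly:
  assumes "cycle_set m K"
  obtains c where "distinct c" "set c = K" "even (length c)" "length c \<ge> 2"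
    "cycle_gen K = trace_poly c \<or> cycle_gen K = - trace_poly c"
    "card K = 2 \<Longrightarrow> c = [Min K, Max K] \<and> cycle_gen K = - trace_poly c"
proof -
  have K: "finite K" "even (card K)" "card K \<ge> 2" using assms by (auto simp: cycle_set_def intro: finite_subset)
  show thesis
  proof (cases "card K = 2")
    case True
    then obtain a b where ab: "K = {a, b}" "a < b" by (metis card_2_iff insert_commute nat_neq_iff)
    then have "Min K = a" "Max K = b" by auto
    then show thesis
      by (intro that[of "[a, b]"]) (use ab True in \<open>simp_all add: cycle_gen_def polar_generic\<close>)
  next
    case False
    define q where "q = card K div 2"
    have q: "card K = 2 * q" "q \<ge> 2" using K False by (auto simp: q_def)
    have inc: "strict_mono_on {1..2 * q} (increasing K)" "increasing K ` {1..2 * q} = K"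
      using increasing_props[OF K(1) q(1)] by auto
    have inj: "inj_on (increasing K) {1..2 * q}" using strict_mono_on_imp_inj_on[OF inc(1)] .
    show thesis
    proof (rule that[of "cycle_order q (increasing K)"])
      show "cycle_gen K = trace_poly (cycle_order q (increasing K)) \<or> cycle_gen K = - trace_poly (cycle_order q (increasing K))"
        using xi_generic[OF q(2) inj] False by (simp add: cycle_gen_def q_def)
    qed (use distinct_cycle_order[OF inj] inc q False in \<open>simp_all add: cycle_order_props\<close>)
  qed
qed

lemma generators_eq: "generators m = det_poly ` {1..m} \<union> cycle_gen ` {K. cycle_set m K}"
proof (intro equalityI subsetI)
  fix g assume "g \<in> generators m"
  then consider (det) k where "1 \<le> k" "k \<le> m" "g = det (generic_mat k)"
    | (polar) l r where "1 \<le> l" "l < r" "r \<le> m" "g = polar (generic_mat l) (generic_mat r)"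
    | (xi) q \<kappa> where "2 \<le> q" "strict_mono_on {1..2 * q} \<kappa>" "\<kappa> ` {1..2 * q} \<subseteq> {1..m}"
      "g = xi q (\<lambda>s. generic_mat (\<kappa> s))"
    unfolding generators_def by blast
  then show "g \<in> det_poly ` {1..m} \<union> cycle_gen ` {K. cycle_set m K}"
  proof cases
    case det
    then show ?thesis by (simp add: det_generic)
  next
    case polar
    then have "card {l, r} = 2" "Min {l, r} = l" "Max {l, r} = r" by auto
    then have "g = cycle_gen {l, r}" "cycle_set m {l, r}"
      using polar by (simp_all add: cycle_gen_def cycle_set_def)
    then show ?thesis by blast
  next
    case xi
    define K where "K = \<kappa> ` {1..2 * q}"
    have card: "card K = 2 * q"
      using strict_mono_on_imp_inj_on[OF xi(2)] by (simp add: K_def card_image)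
    have "g = xi q (\<lambda>s. generic_mat (increasing K s))"
      unfolding xi(4) by (rule xi_cong) (simp add: increasing_unique[OF xi(2) K_def[symmetric]])
    then have "g = cycle_gen K" using xi(1) by (simp add: cycle_gen_def card)
    moreover have "cycle_set m K" using xi(1,3) card by (simp add: cycle_set_def K_def)
    ultimately show ?thesis by blast
  qed
next
  fix g assume "g \<in> det_poly ` {1..m} \<union> cycle_gen ` {K. cycle_set m K}"
  then consider k where "k \<in> {1..m}" "g = det_poly k" | K where "cycle_set m K" "g = cycle_gen K" by blast
  then show "g \<in> generators m"
  proof cases
    case 1
    then show ?thesis unfolding generators_def det_generic by auto
  next
    case 2
    then have K: "finite K" "K \<subseteq> {1..m}" "even (card K)" "card K \<ge> 2"
      by (auto simp: cycle_set_def intro: finite_subset)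
    show ?thesis
    proof (cases "card K = 2")
      case True
      then obtain a b where ab: "K = {a, b}" "a < b" by (metis card_2_iff insert_commute nat_neq_iff)
      then have "Min K = a" "Max K = b" by auto
      then have "g = polar (generic_mat a) (generic_mat b)" using True 2 by (simp add: cycle_gen_def)
      moreover have "1 \<le> a" "b \<le> m" using ab K by auto
      ultimately show ?thesis unfolding generators_def using ab by blast
    next
      case False
      define q where "q = card K div 2"
      have q: "card K = 2 * q" "q \<ge> 2" using K False by (auto simp: q_def)
      have inc: "strict_mono_on {1..2 * q} (increasing K)" "increasing K ` {1..2 * q} = K"
        using increasing_props[OF K(1) q(1)] by auto
      have "g = xi q (\<lambda>s. generic_mat (increasing K s))"
        using 2 False by (simp add: cycle_gen_def q_def)
      moreover have "2 * q \<le> m" using card_mono[OF _ K(2)] q(1) by simp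
      ultimately show ?thesis unfolding generators_def using q(2) inc K(2) by blast
    qed
  qed
qed

section \<open>Comparison with the invariants of the group of rational points\<close>

lemma is_subring_hull: "is_subring (is_subring hull S)"
proof -
  have "is_subring (\<Inter> T)" if "\<forall>R\<in>T. is_subring R" for T :: "'a set set"
    using that by (auto simp: is_subring_def)
  then show ?thesis unfolding hull_def by auto
qed

lemma is_subring_diff: "is_subring R \<Longrightarrow> a \<in> R \<Longrightarrow> b \<in> R \<Longrightarrow> a - b \<in> R"
  by (simp add: is_subring_def)

definition coord_vars :: "nat \<Rightarrow> xvar set" where
  "coord_vars m = {0..<2} \<times> {0..<2} \<times> {1..m}"

definition int_inv :: "nat \<Rightarrow> (xvar, rat) mpoly set" where
  "int_inv m = {p. int_coeffs p \<and> sl_inv p \<and> vars_in (coord_vars m) p}"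

lemma is_subring_int_inv: "is_subring (int_inv m)"
  by (simp add: is_subring_def int_inv_def int_coeffs_diff int_coeffs_mult sl_inv_diff
      sl_inv_mult vars_in_diff vars_in_mult)

lemma sl_inv_uminus: "sl_inv p \<Longrightarrow> sl_inv (- p)"
  using sl_inv_diff[OF sl_inv_0] by fastforce

lemma generators_int_inv: "generators m \<subseteq> int_inv m"
proof
  fix g assume "g \<in> generators m"
  then consider k where "k \<in> {1..m}" "g = det_poly k" | K where "cycle_set m K" "g = cycle_gen K"
    unfolding generators_eq by blast
  then show "g \<in> int_inv m"
  proof cases
    case 1
    then show ?thesis
      by (auto simp: int_inv_def sl_inv_det_poly coord_vars_def det_poly_def intro!: int_coeffs_diff int_coeffs_mult vars_in_diff vars_in_mult)
         (use sl_inv_det_poly[of k] in \<open>simp add: det_poly_def\<close>)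
  next
    case 2
    obtain c where c: "distinct c" "set c = K" "even (length c)" "length c \<ge> 2"
      "cycle_gen K = trace_poly c \<or> cycle_gen K = - trace_poly c" using cycle_gen_trace_poly[OF 2(1)] by metis
    have "c \<noteq> []" using c(4) by auto
    then have "sl_inv (trace_poly c)" using sl_inv_trace_poly c by blast
    moreover have "vars_in (coord_vars m) (trace_poly c)"
      unfolding coord_vars_def by (rule vars_in_trace_poly) (use 2(1) c(2) in \<open>simp add: cycle_set_def\<close>)
    ultimately show ?thesis
      using c(5) int_coeffs_trace_poly[of c] 2(2) by (auto simp: int_inv_def sl_inv_uminus)
  qed
qed

lemma hull_int_inv: "is_subring hull generators m \<subseteq> int_inv m"
  by (rule hull_minimal) (rule generators_int_inv is_subring_int_inv)+

text \<open>A polarised determinant specialises to a product of two brackets, and \<open>xi\<close> to a closed walk, in both cases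
  up to sign.\<close>

lemma invariant_subring_hull: "invariant_subring m (is_subring hull generators m)"
proof
  let ?R = "is_subring hull generators m"
  have gen: "g \<in> ?R" if "g \<in> generators m" for g using that by (rule hull_inc)
  have sub: "is_subring ?R" by (rule is_subring_hull)
  show "is_subring ?R" by (fact sub)
  show "int_coeffs g \<and> sl_inv g \<and> vars_in ({0..<2} \<times> {0..<2} \<times> {1..m}) g" if "g \<in> ?R" for g
    using hull_int_inv that unfolding int_inv_def coord_vars_def by blast
  show "det_poly k \<in> ?R" if "k \<in> {1..m}" for k
    using that by (intro gen) (simp add: generators_eq)
  have neg: "- p \<in> ?R" if "p \<in> ?R" for p
  proof -
    have "1 - 1 \<in> ?R" using sub unfolding is_subring_def by blast
    from is_subring_diff[OF sub this that] have "1 - 1 - p \<in> ?R" .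
    then show ?thesis by simp
  qed
  have edge: "\<exists>g\<in>?R. multihom (balanced {#a, b#}) g \<and> subst (rank1 UNIV) g = bracket_u a b * bracket_v a b"
    if "a \<in> {1..m}" "b \<in> {1..m}" "a < b" for a b
  proof -
    have ab: "cycle_set m {a, b}" "card {a, b} = 2" "Min {a, b} = a" "Max {a, b} = b"
      using that by (auto simp: cycle_set_def)
    have "cycle_gen {a, b} = - trace_poly [a, b]"
      using ab by (simp add: cycle_gen_def polar_generic)
    moreover have "cycle_gen {a, b} \<in> ?R"
      using ab(1) by (intro gen) (simp add: generators_eq)
    ultimately have "- trace_poly [a, b] \<in> ?R" by simp
    moreover have "multihom (balanced {#a, b#}) (- trace_poly [a, b])"
      using multihom_trace_poly[of "[a, b]"] by simp
    moreover have "subst (rank1 UNIV) (- trace_poly [a, b]) = bracket_u a b * bracket_v a b"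
      using rank1_trace_poly[of "[a, b]"] bracket_swap[of "(False, b)" "(False, a)"]
      by (simp add: subst.hom_uminus walk_def)
    ultimately show ?thesis by blast
  qed
  show "\<exists>g\<in>?R. multihom (balanced {#a, b#}) g \<and> subst (rank1 UNIV) g = bracket_u a b * bracket_v a b"
    if "a \<in> {1..m}" "b \<in> {1..m}" "a \<noteq> b" for a b
  proof (cases "a < b")
    case True
    then show ?thesis using edge that by blast
  next
    case False
    then have "b < a" using that by simp
    moreover have "bracket_u b a * bracket_v b a = bracket_u a b * bracket_v a b"
      using bracket_swap[of "(False, b)" "(False, a)"] bracket_swap[of "(True, b)" "(True, a)"] by simp
    ultimately show ?thesis using edge[of b a] that by (simp add: add_mset_commute)
  qed
  show "\<exists>c. distinct c \<and> set c = K \<and> (\<exists>g\<in>?R. multihom (balanced (mset c)) g \<and> subst (rank1 UNIV) g = walk c)"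
    if K: "finite K" "K \<subseteq> {1..m}" "even (card K)" "card K \<ge> 4" for K
  proof -
    have cs: "cycle_set m K" using K by (simp add: cycle_set_def)
    then obtain c where c: "distinct c" "set c = K" "even (length c)" "length c \<ge> 2"
      "cycle_gen K = trace_poly c \<or> cycle_gen K = - trace_poly c" using cycle_gen_trace_poly by metis
    have "cycle_gen K \<in> ?R" using cs by (intro gen) (simp add: generators_eq)
    then have "trace_poly c \<in> ?R" using c(5) neg[of "- trace_poly c"] by auto
    moreover have "c \<noteq> []" using c(4) by auto
    ultimately show ?thesis using c multihom_trace_poly[OF c(3)] rank1_trace_poly[OF c(3)] by blast
  qed
qed

lemma mult_mat_2x2:
  assumes "A \<in> carrier_mat 2 2" "B \<in> carrier_mat 2 2" "i < 2" "j < 2"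
  shows "(A * B) $$ (i, j) = A $$ (i, 0) * B $$ (0, j) + A $$ (i, 1) * B $$ (1, j)"
proof -
  have "(A * B) $$ (i, j) = (\<Sum>k = 0..<2. A $$ (i, k) * B $$ (k, j))"
    using assms by (simp add: scalar_prod_def)
  then show ?thesis by (simp add: numeral_2_eq_2)
qed

lemma det_2x2_carrier:
  assumes "A \<in> carrier_mat 2 2"
  shows "det A = A $$ (0, 0) * A $$ (1, 1) - A $$ (0, 1) * (A $$ (1, 0) :: rat)"
proof -
  have "A = mat 2 2 (\<lambda>(i, j). A $$ (i, j))" using assms by (intro eq_matI) auto
  then have "det A = det (mat 2 2 (\<lambda>(i, j). A $$ (i, j)))" by simp
  then show ?thesis by (simp add: det_2x2)
qed

lemma mat_inverse_unique:
  fixes h k :: "rat mat"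
  assumes "h \<in> carrier_mat 2 2" "k \<in> carrier_mat 2 2" "h * k = 1\<^sub>m 2" "k * h = 1\<^sub>m 2"
  shows "the (mat_inverse h) = k"
proof (cases "mat_inverse h")
  case None
  have "h \<in> Units (ring_mat TYPE(rat) 2 ())"
    using assms unfolding Units_def ring_mat_def by auto
  then show ?thesis using mat_inverse(1)[OF assms(1) None, of "()"] by simp
next
  case (Some k')
  have k': "k' * h = 1\<^sub>m 2" "k' \<in> carrier_mat 2 2" using mat_inverse(2)[OF assms(1) Some] by auto
  have "k' = k' * (h * k)" using k' assms by simp
  also have "\<dots> = (k' * h) * k" using k'(2) assms(1,2) by (simp add: assoc_mult_mat[of _ 2 2 _ 2 _ 2])
  also have "\<dots> = k" using k' assms by simp
  finally show ?thesis using Some by simp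
qed

text \<open>The group acts on the right through inverses; for determinant one the inverse is the adjugate.\<close>

lemma SL2_inverse:
  assumes h: "h \<in> SL2"
  shows "the (mat_inverse h) = mat 2 2 (\<lambda>(i, j). if i = j then h $$ (1 - i, 1 - j) else - h $$ (i, j))"
    (is "_ = ?k")
proof (rule mat_inverse_unique)
  have c: "h \<in> carrier_mat 2 2" and d: "h $$ (0, 0) * h $$ (1, 1) - h $$ (0, 1) * h $$ (1, 0) = 1"
    using h det_2x2_carrier[of h] by (auto simp: SL2_def)
  have k: "?k \<in> carrier_mat 2 2" by simp
  show "h \<in> carrier_mat 2 2" "?k \<in> carrier_mat 2 2" by (fact c, fact k)
  show "h * ?k = 1\<^sub>m 2"
  proof (rule eq_matI)
    fix i j assume "i < dim_row (1\<^sub>m 2 :: rat mat)" "j < dim_col (1\<^sub>m 2 :: rat mat)"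
    then have ij: "i < 2" "j < 2" by simp_all
    show "(h * ?k) $$ (i, j) = 1\<^sub>m 2 $$ (i, j)"
      using ij d unfolding mult_mat_2x2[OF c k ij] by (auto simp: less_2_iff algebra_simps)
  qed (use c in auto)
  show "?k * h = 1\<^sub>m 2"
  proof (rule eq_matI)
    fix i j assume "i < dim_row (1\<^sub>m 2 :: rat mat)" "j < dim_col (1\<^sub>m 2 :: rat mat)"
    then have ij: "i < 2" "j < 2" by simp_all
    show "(?k * h) $$ (i, j) = 1\<^sub>m 2 $$ (i, j)"
      using ij d unfolding mult_mat_2x2[OF k c ij] by (auto simp: less_2_iff algebra_simps)
  qed (use c in auto)
qed

definition entries :: "(nat \<Rightarrow> rat mat) \<Rightarrow> xvar \<Rightarrow> rat" where
  "entries A = (\<lambda>(i, j, k). A k $$ (i, j))"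

lemma value_at_eq: "value_at p A = meval (entries A) p"
  by (simp add: value_at_def entries_def)

lemma meval_act:
  assumes A: "\<And>k. k \<in> {1..m} \<Longrightarrow> A k \<in> carrier_mat 2 2" and g: "g \<in> carrier_mat 2 2"
    and h: "h \<in> SL2" and p: "vars_in (coord_vars m) p"
  shows "value_at p (act g h A) = meval (entries A) (subst (sl_subst True (g $$ (0, 0)) (g $$ (0, 1)) (g $$ (1, 0)) (g $$ (1, 1)))
    (subst (sl_subst False (h $$ (1, 1)) (- h $$ (1, 0)) (- h $$ (0, 1)) (h $$ (0, 0))) p))"
  unfolding value_at_eq meval_subst subst_subst
proof (rule meval_cong_on[OF p])
  fix v assume "v \<in> coord_vars m"
  then obtain i j k where v: "v = (i, j, k)" and ij: "i < 2" "j < 2" and k: "k \<in> {1..m}"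
    by (auto simp: coord_vars_def)
  let ?h = "mat 2 2 (\<lambda>(i, j). if i = j then h $$ (1 - i, 1 - j) else - h $$ (i, j))"
  have gA: "g * A k \<in> carrier_mat 2 2" using g A[OF k] by auto
  have h': "?h \<in> carrier_mat 2 2" by simp
  have "act g h A k = g * A k * ?h" by (simp add: act_def SL2_inverse[OF h])
  then have "entries (act g h A) v = (g * A k * ?h) $$ (i, j)" by (simp add: entries_def v)
  also have "\<dots> = (g $$ (i, 0) * A k $$ (0, 0) + g $$ (i, 1) * A k $$ (1, 0)) * ?h $$ (0, j)
    + (g $$ (i, 0) * A k $$ (0, 1) + g $$ (i, 1) * A k $$ (1, 1)) * ?h $$ (1, j)"
    by (simp add: mult_mat_2x2[OF gA h' ij] mult_mat_2x2[OF g A[OF k] ij(1)] del: index_mult_mat)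
  also have "\<dots> = meval (entries A) (subst (sl_subst True (g $$ (0, 0)) (g $$ (0, 1)) (g $$ (1, 0)) (g $$ (1, 1)))
      (sl_subst False (h $$ (1, 1)) (- h $$ (1, 0)) (- h $$ (0, 1)) (h $$ (0, 0)) v))"
    using ij by (auto simp: v less_2_iff subst.hom_add subst.hom_mult meval.hom_add meval.hom_mult entries_def algebra_simps)
  finally show "entries (act g h A) v = meval
      (\<lambda>v. meval (entries A) (sl_subst True (g $$ (0, 0)) (g $$ (0, 1)) (g $$ (1, 0)) (g $$ (1, 1)) v))
      (sl_subst False (h $$ (1, 1)) (- h $$ (1, 0)) (- h $$ (0, 1)) (h $$ (0, 0)) v)"
    unfolding meval_subst .
qed

lemma sl_subst_id: "sl_subst c 1 0 0 1 v = MVar v"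
  by (cases v; cases c) auto

lemma subst_sl_subst_id: "subst (sl_subst c 1 0 0 1) p = p"
  by (rule subst_id_on[of UNIV]) (simp_all add: sl_subst_id)

lemma vars_in_sl_subst_coord_vars: "vars_in (coord_vars m) p \<Longrightarrow> vars_in (coord_vars m) (subst (sl_subst c \<alpha> \<beta> \<gamma> \<delta>) p)"
proof (rule vars_in_subst)
  fix v assume "v \<in> coord_vars m"
  then show "vars_in (coord_vars m) (sl_subst c \<alpha> \<beta> \<gamma> \<delta> v)"
    by (cases v; cases c) (auto simp: coord_vars_def intro!: vars_in_add vars_in_mult)
qed

text \<open>Values at all rational points determine a polynomial, so that invariance of the values is invariance of
  the polynomial.  Choosing one of the two group elements to be the identity separates the two factors.\<close>

lemma invariants_iff: "p \<in> invariants m \<longleftrightarrow> vars_in (coord_vars m) p \<and> sl_inv p"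
proof -
  have vars_in: "p \<in> coord_ring m \<longleftrightarrow> vars_in (coord_vars m) p" by (simp add: coord_ring_def vars_in_def coord_vars_def)
  have "sl_inv p" if p: "vars_in (coord_vars m) p"
    and inv: "\<forall>g\<in>SL2. \<forall>h\<in>SL2. \<forall>A. (\<forall>k\<in>{1..m}. A k \<in> carrier_mat 2 2) \<longrightarrow> value_at p (act g h A) = value_at p A"
  proof -
    have main: "subst (sl_subst True (g $$ (0, 0)) (g $$ (0, 1)) (g $$ (1, 0)) (g $$ (1, 1)))
      (subst (sl_subst False (h $$ (1, 1)) (- h $$ (1, 0)) (- h $$ (0, 1)) (h $$ (0, 0))) p) = p"
      (is "?q = p") if g: "g \<in> SL2" and h: "h \<in> SL2" for g h
    proof (rule poly_eq_if_meval_eq)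
      fix f :: "xvar \<Rightarrow> rat"
      define A where "A k = mat 2 2 (\<lambda>(i, j). f (i, j, k))" for k
      have f: "entries A v = f v" if "v \<in> coord_vars m" for v using that by (auto simp: entries_def A_def coord_vars_def)
      have "meval f ?q = meval (entries A) ?q"
        by (rule meval_cong_on[of "coord_vars m"]) (use f p in \<open>simp_all add: vars_in_sl_subst_coord_vars\<close>)
      also have "\<dots> = value_at p (act g h A)"
        by (rule meval_act[symmetric]) (use g h p in \<open>simp_all add: A_def SL2_def\<close>)
      also have "\<dots> = value_at p A" using inv g h by (simp add: A_def)
      also have "\<dots> = meval f p"
        unfolding value_at_eq by (rule meval_cong_on[OF p f])
      finally show "meval f ?q = meval f p" .
    qed
    have one: "mat 2 2 (\<lambda>(i, j). if i = j then 1 else 0) \<in> SL2"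
      by (simp add: SL2_def det_2x2)
    show ?thesis
      unfolding sl_inv_def
    proof (intro allI impI)
      fix c and \<alpha> \<beta> \<gamma> \<delta> :: rat assume det: "\<alpha> * \<delta> - \<beta> * \<gamma> = 1"
      show "subst (sl_subst c \<alpha> \<beta> \<gamma> \<delta>) p = p"
      proof (cases c)
        case True
        have "mat 2 2 (\<lambda>(i, j). if i = 0 then if j = 0 then \<alpha> else \<beta> else if j = 0 then \<gamma> else \<delta>) \<in> SL2"
          using det by (simp add: SL2_def det_2x2)
        from main[OF this one] show ?thesis using True by (simp add: subst_sl_subst_id)
      next
        case False
        have "mat 2 2 (\<lambda>(i, j). if i = 0 then if j = 0 then \<delta> else - \<gamma> else if j = 0 then - \<beta> else \<alpha>) \<in> SL2"
          using det by (simp add: SL2_def det_2x2 algebra_simps)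
        from main[OF one this] show ?thesis using False by (simp add: subst_sl_subst_id)
      qed
    qed
  qed
  moreover have "value_at p (act g h A) = value_at p A"
    if p: "vars_in (coord_vars m) p" "sl_inv p" and g: "g \<in> SL2" and h: "h \<in> SL2"
      and A: "\<forall>k\<in>{1..m}. A k \<in> carrier_mat 2 2" for g h A
  proof -
    have dg: "g $$ (0, 0) * g $$ (1, 1) - g $$ (0, 1) * g $$ (1, 0) = 1"
      using g det_2x2_carrier[of g] by (simp add: SL2_def)
    have dh: "h $$ (1, 1) * h $$ (0, 0) - (- h $$ (1, 0)) * (- h $$ (0, 1)) = 1"
      using h det_2x2_carrier[of h] by (simp add: SL2_def algebra_simps)
    have "g \<in> carrier_mat 2 2" using g by (simp add: SL2_def)
    from meval_act[OF _ this h p(1), of A] show ?thesis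
      using A p(2) dg dh unfolding sl_inv_def value_at_eq by simp
  qed
  ultimately show ?thesis unfolding invariants_def vars_in mem_Collect_eq by blast
qed

lemma int_coord_ring_iff: "int_coord_ring m \<inter> invariants m = int_inv m"
  by (auto simp: int_coord_ring_def int_inv_def invariants_iff int_coeffs_def coord_ring_def vars_in_def coord_vars_def)

section \<open>The generators generate\<close>

definition mdeg :: "(xvar \<Rightarrow>\<^sub>0 nat) \<Rightarrow> nat multiset" where
  "mdeg t = (\<Sum>v\<in>keys t. replicate_mset (lookup t v) (snd (snd v)))"

lemma weight_mdeg: "keys t \<subseteq> coord_vars m \<Longrightarrow> weight (label_weight y) t = count (mdeg t) (snd y)"
proof -
  assume t: "keys t \<subseteq> coord_vars m"
  obtain c k where y: "y = (c, k)" by (cases y)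
  have "weight (label_weight y) t = (\<Sum>v\<in>keys t. if k = snd (snd v) then lookup t v else 0)"
    unfolding weight_def
  proof (rule sum.cong[OF refl])
    fix v assume "v \<in> keys t"
    then have "v \<in> coord_vars m" using t by blast
    then show "label_weight y v * lookup t v = (if k = snd (snd v) then lookup t v else 0)"
      by (cases v; cases c) (auto simp: y coord_vars_def)
  qed
  then show ?thesis by (simp add: mdeg_def count_sum y)
qed

lemma set_mdeg: "keys t \<subseteq> coord_vars m \<Longrightarrow> set_mset (mdeg t) \<subseteq> {1..m}"
  by (auto simp: mdeg_def coord_vars_def set_mset_sum split: if_splits)

definition component :: "nat multiset \<Rightarrow> (xvar, rat) mpoly \<Rightarrow> (xvar, rat) mpoly" where
  "component D p = (\<Sum>t\<in>{t \<in> keys p. mdeg t = D}. single t (lookup p t))"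

lemma lookup_component: "lookup (component D p) t = (if mdeg t = D then lookup p t else 0)"
proof -
  have "lookup (component D p) t = (\<Sum>s\<in>{t \<in> keys p. mdeg t = D}. if s = t then lookup p s else 0)"
    by (auto simp: component_def lookup_sum lookup_single when_def intro!: sum.cong)
  also have "\<dots> = (if mdeg t = D then lookup p t else 0)"
    by (subst sum.delta) (auto simp: in_keys_iff)
  finally show ?thesis .
qed

lemma sum_component: "(\<Sum>D\<in>mdeg ` keys p. component D p) = p"
proof (rule poly_mapping_eqI)
  fix t
  have "lookup (\<Sum>D\<in>mdeg ` keys p. component D p) t = (\<Sum>D\<in>mdeg ` keys p. if D = mdeg t then lookup p t else 0)"
    by (auto simp: lookup_sum lookup_component intro!: sum.cong)
  also have "\<dots> = lookup p t" by (subst sum.delta) (auto simp: in_keys_iff)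
  finally show "lookup (\<Sum>D\<in>mdeg ` keys p. component D p) t = lookup p t" .
qed

text \<open>The action preserves the multidegree, so that the components of an invariant are invariants.\<close>

lemma component_props:
  assumes p: "p \<in> int_inv m"
  shows "int_coeffs (component D p)" "vars_in (coord_vars m) (component D p)" "multihom (balanced D) (component D p)" "sl_inv (component D p)"
proof -
  show "int_coeffs (component D p)" using p by (auto simp: int_inv_def int_coeffs_def lookup_component)
  have sub: "keys (component E p) \<subseteq> keys p" for E by (auto simp: in_keys_iff lookup_component split: if_splits)
  have vars_in: "vars_in (coord_vars m) (component E p)" for E using p sub[of E] by (auto simp: int_inv_def vars_in_def)
  then show "vars_in (coord_vars m) (component D p)" .
  have multihom: "multihom (balanced E) (component E p)" for E
  proof -
    have "weight (label_weight y) t = balanced E y" if "t \<in> keys (component E p)" for t y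
    proof -
      have "mdeg t = E" using that by (auto simp: in_keys_iff lookup_component split: if_splits)
      then show ?thesis using weight_mdeg[of t m y] vars_in[of E] that by (simp add: vars_in_def)
    qed
    then show ?thesis by (simp add: multihom_def homogeneous_def)
  qed
  then show "multihom (balanced D) (component D p)" .
  show "sl_inv (component D p)"
    unfolding sl_inv_def
  proof (intro allI impI)
    fix c and \<alpha> \<beta> \<gamma> \<delta> :: rat assume det: "\<alpha> * \<delta> - \<beta> * \<gamma> = 1"
    let ?l = "subst (sl_subst c \<alpha> \<beta> \<gamma> \<delta>)"
    have vl: "vars_in (coord_vars m) (?l (component E p))" for E by (rule vars_in_sl_subst_coord_vars[OF vars_in])
    have ml: "mdeg t = E" if "t \<in> keys (?l (component E p))" for t E
    proof (rule multiset_eqI)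
      fix k
      have "homogeneous (label_weight (True, k)) (count E k) (?l (component E p))"
        using multihom_sl_subst[OF multihom[of E]] unfolding multihom_def by (metis snd_conv)
      then have "weight (label_weight (True, k)) t = count E k" using that by (simp add: homogeneous_def)
      moreover have "keys t \<subseteq> coord_vars m" using vl[of E] that by (simp add: vars_in_def)
      ultimately show "count (mdeg t) k = count E k" using weight_mdeg[of t m "(True, k)"] by simp
    qed
    have inv: "?l p = p" using p det by (simp add: int_inv_def sl_inv_def)
    have "?l p = (\<Sum>E\<in>mdeg ` keys p. ?l (component E p))"
      unfolding subst.hom_sum[symmetric] sum_component ..
    then have expand: "p = (\<Sum>E\<in>mdeg ` keys p. ?l (component E p))"
      by (rule trans[OF inv[symmetric]])
    show "?l (component D p) = component D p"
    proof (rule poly_mapping_eqI)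
      fix t
      have z: "lookup (?l (component E p)) t = 0" if "E \<noteq> mdeg t" for E
        using ml[of t E] that by (auto simp: in_keys_iff)
      show "lookup (?l (component D p)) t = lookup (component D p) t"
      proof (cases "mdeg t = D")
        case False
        then show ?thesis using z by (simp add: lookup_component)
      next
        case True
        have "lookup p t = (\<Sum>E\<in>mdeg ` keys p. lookup (?l (component E p)) t)"
          using arg_cong[OF expand, of "\<lambda>q. lookup q t"] by (simp only: lookup_sum)
        also have "\<dots> = (\<Sum>E\<in>mdeg ` keys p. if E = mdeg t then lookup (?l (component E p)) t else 0)"
          by (rule sum.cong) (auto simp: z)
        also have "\<dots> = (if mdeg t \<in> mdeg ` keys p then lookup (?l (component D p)) t else 0)"
          using True by (simp add: sum.delta)
        also have "\<dots> = lookup (?l (component D p)) t"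
        proof -
          have "component D p = 0" if "D \<notin> mdeg ` keys p"
          proof -
            have "{t \<in> keys p. mdeg t = D} = {}" using that by auto
            then show ?thesis by (simp only: component_def sum.empty)
          qed
          then show ?thesis using True by auto
        qed
        finally show ?thesis using True by (simp add: lookup_component)
      qed
    qed
  qed
qed

lemma int_inv_generated: "int_inv m \<subseteq> is_subring hull generators m"
proof
  fix p assume p: "p \<in> int_inv m"
  interpret invariant_subring m "is_subring hull generators m" by (rule invariant_subring_hull)
  have component_in: "component D p \<in> is_subring hull generators m" if D: "D \<in> mdeg ` keys p" for D
  proof -
    have "liftable {1..m} D (component D p)"
    proof (rule invariants_liftable)
      show "vars_in (hybrid_vars {1..m}) (component D p)"
        using component_props(2)[OF p, of D] by (rule vars_in_mono) (auto simp: coord_vars_def hybrid_vars_def)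
      show "set_mset D \<subseteq> {1..m}"
        using D p set_mdeg by (auto simp: int_inv_def vars_in_def)
    qed (use component_props[OF p] in simp_all)
    then obtain g where g: "g \<in> is_subring hull generators m" "subst (rank1 (- {1..m})) g = component D p"
      unfolding liftable_def by blast
    have "subst (rank1 (- {1..m})) g = g"
      by (rule subst_id_on[of "coord_vars m"]) (use R_props[OF g(1)] in \<open>auto simp: coord_vars_def\<close>)
    then show ?thesis using g by simp
  qed
  have "(\<Sum>D\<in>A. component D p) \<in> is_subring hull generators m" if "finite A" "A \<subseteq> mdeg ` keys p" for A
    using that by (induct rule: finite_induct) (auto intro: R_0 R_add component_in)
  from this[of "mdeg ` keys p"] show "p \<in> is_subring hull generators m" by (simp add: sum_component)
qed

section \<open>Minimality: the values at scalar matrices modulo four\<close>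

text \<open>Only the coefficients of the divisors \<open>s\<close> of the monomial \<open>e\<close> matter.  A product of two elements without
  constant term, all of whose coefficients at such divisors are even, has a coefficient at \<open>e\<close> divisible by \<open>4\<close>.
  This makes the condition stable under multiplication even when constant terms are allowed.\<close>

definition small_at :: "(nat \<Rightarrow>\<^sub>0 nat) \<Rightarrow> (nat, rat) mpoly \<Rightarrow> bool" where
  "small_at e p \<longleftrightarrow> (\<forall>s t. s + t = e \<longrightarrow> lookup p s \<in> \<int> \<and>
    (s \<noteq> 0 \<longrightarrow> lookup p s / 2 \<in> \<int>) \<and> (s = e \<longrightarrow> lookup p s / 4 \<in> \<int>))"

lemma small_at_top: "small_at e p \<Longrightarrow> lookup p e / 4 \<in> \<int>"
  unfolding small_at_def by (drule spec[of _ e], drule spec[of _ 0]) simp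

lemma lookup_mult_sum:
  fixes p q :: "('v, rat) mpoly"
  shows "lookup (p * q) e = (\<Sum>s\<in>keys p. \<Sum>t\<in>keys q. if s + t = e then lookup p s * lookup q t else 0)"
proof -
  have "p * q = (\<Sum>s\<in>keys p. \<Sum>t\<in>keys q. single (s + t) (lookup p s * lookup q t))"
    by (subst mpoly_single_sum[of p], subst mpoly_single_sum[of q])
       (simp add: sum_product mult_single)
  then have "lookup (p * q) e = lookup (\<Sum>s\<in>keys p. \<Sum>t\<in>keys q. single (s + t) (lookup p s * lookup q t)) e"
    by (rule arg_cong)
  then show ?thesis by (auto simp: lookup_sum lookup_single when_def intro!: sum.cong)
qed

lemma small_at_mult:
  assumes e: "e \<noteq> 0" and p: "small_at e p" and q: "small_at e q"
  shows "small_at e (p * q)"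
  unfolding small_at_def
proof (intro allI impI)
  fix f f' assume f: "f + f' = e"
  have P: "lookup p s \<in> \<int>" "s \<noteq> 0 \<longrightarrow> lookup p s / 2 \<in> \<int>" "s = e \<longrightarrow> lookup p s / 4 \<in> \<int>"
    and Q: "lookup q t \<in> \<int>" "t \<noteq> 0 \<longrightarrow> lookup q t / 2 \<in> \<int>" "t = e \<longrightarrow> lookup q t / 4 \<in> \<int>"
    if "s + t = f" for s t
  proof -
    have "s + (t + f') = e" "t + (s + f') = e" using that f by (auto simp: add_ac)
    then show "lookup p s \<in> \<int>" "s \<noteq> 0 \<longrightarrow> lookup p s / 2 \<in> \<int>" "s = e \<longrightarrow> lookup p s / 4 \<in> \<int>"
      "lookup q t \<in> \<int>" "t \<noteq> 0 \<longrightarrow> lookup q t / 2 \<in> \<int>" "t = e \<longrightarrow> lookup q t / 4 \<in> \<int>"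
      using p q unfolding small_at_def by blast+
  qed
  have sum: "lookup (p * q) f / c \<in> \<int>" if "\<And>s t. s + t = f \<Longrightarrow> lookup p s * lookup q t / c \<in> \<int>" for c
    unfolding lookup_mult_sum sum_divide_distrib by (intro Ints_sum) (use that in auto)
  have 1: "lookup (p * q) f / 1 \<in> \<int>" by (rule sum) (use P Q in auto)
  have 2: "lookup (p * q) f / 2 \<in> \<int>" if "f \<noteq> 0"
  proof (rule sum)
    fix s t assume st: "s + t = f"
    show "lookup p s * lookup q t / 2 \<in> \<int>"
    proof (cases "s = 0")
      case True
      then have "t \<noteq> 0" using st that by simp
      then have "lookup p s * (lookup q t / 2) \<in> \<int>" using P(1)[OF st] Q(2)[OF st] by (intro Ints_mult) auto
      then show ?thesis by simp
    next
      case False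
      then have "(lookup p s / 2) * lookup q t \<in> \<int>" using P(2)[OF st] Q(1)[OF st] by (intro Ints_mult) auto
      then show ?thesis by simp
    qed
  qed
  have 4: "lookup (p * q) f / 4 \<in> \<int>" if "f = e"
  proof (rule sum)
    fix s t assume st: "s + t = f"
    consider "s = 0" | "t = 0" | "s \<noteq> 0" "t \<noteq> 0" by blast
    then show "lookup p s * lookup q t / 4 \<in> \<int>"
    proof cases
      case 1
      then have "lookup p s * (lookup q t / 4) \<in> \<int>" using P(1)[OF st] Q(3)[OF st] st that by (intro Ints_mult) auto
      then show ?thesis by simp
    next
      case 2
      then have "(lookup p s / 4) * lookup q t \<in> \<int>" using P(3)[OF st] Q(1)[OF st] st that by (intro Ints_mult) auto
      then show ?thesis by simp
    next
      case 3
      then have "(lookup p s / 2) * (lookup q t / 2) \<in> \<int>" using P(2)[OF st] Q(2)[OF st] by (intro Ints_mult) auto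
      then show ?thesis by simp
    qed
  qed
  show "lookup (p * q) f \<in> \<int> \<and> (f \<noteq> 0 \<longrightarrow> lookup (p * q) f / 2 \<in> \<int>) \<and> (f = e \<longrightarrow> lookup (p * q) f / 4 \<in> \<int>)"
    using 1 2 4 by simp
qed

lemma small_at_subring:
  assumes e: "e \<noteq> 0" shows "is_subring {p. small_at e (subst scalar_spec p)}"
proof -
  have "small_at e 1"
    using e by (auto simp: small_at_def lookup_one when_def)
  moreover have "small_at e (p - q)" if "small_at e p" "small_at e q" for p q
    using that by (auto simp: small_at_def lookup_minus diff_divide_distrib)
  ultimately show ?thesis
    by (auto simp: is_subring_def subst.hom_minus subst.hom_mult small_at_mult[OF e])
qed

lemma scalar_spec_det_poly: "subst scalar_spec (det_poly k) = single (single k 2) 1"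
proof -
  have "subst scalar_spec (det_poly k) = MVar k * MVar k"
    by (simp add: det_poly_def subst.hom_minus subst.hom_mult scalar_spec_simp)
  then show ?thesis by (simp add: MVar_def mult_single numeral_2_eq_2 flip: single_add)
qed

definition squarefree_exp :: "nat set \<Rightarrow> nat \<Rightarrow>\<^sub>0 nat" where
  "squarefree_exp K = (\<Sum>k\<in>K. single k 1)"

lemma lookup_squarefree_exp: "finite K \<Longrightarrow> lookup (squarefree_exp K) k = of_bool (k \<in> K)"
proof -
  assume K: "finite K"
  have "lookup (squarefree_exp K) k = (\<Sum>x\<in>K. if x = k then 1 else 0)"
    by (auto simp: squarefree_exp_def lookup_sum lookup_single when_def intro!: sum.cong)
  then show ?thesis using K by (simp add: sum.delta)
qed

lemma scalar_spec_cycle_gen: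
  assumes "cycle_set m K"
  obtains a where "a = 2 \<or> a = -2" "subst scalar_spec (cycle_gen K) = single (squarefree_exp K) a"
proof -
  obtain c where c: "distinct c" "set c = K" "even (length c)" "length c \<ge> 2"
    "cycle_gen K = trace_poly c \<or> cycle_gen K = - trace_poly c" using cycle_gen_trace_poly[OF assms] by metis
  have "prod_list (map MVar c) = (single (\<Sum>k\<in>set c. single k 1) 1 :: (nat, rat) mpoly)"
    using c(1) by (induct c) (simp_all add: MVar_def mult_single)
  then have pl: "prod_list (map MVar c) = (single (squarefree_exp K) 1 :: (nat, rat) mpoly)"
    by (simp add: c(2) squarefree_exp_def)
  have two: "(2 :: (nat, rat) mpoly) = single 0 2" by simp
  have "subst scalar_spec (trace_poly c) = single (squarefree_exp K) 2 \<or> subst scalar_spec (trace_poly c) = single (squarefree_exp K) (-2)"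
    unfolding scalar_spec_trace_poly[OF c(3)] pl
    by (cases "even (length c div 2)") (simp_all add: two mult_single single_uminus del: single_numeral)
  then show thesis
    using c(5) that[of 2] that[of "-2"] by (auto simp: subst.hom_uminus simp flip: single_uminus)
qed

lemma small_at_single:
  assumes "s \<noteq> e \<or> a / 4 \<in> \<int>" "a / 2 \<in> \<int> \<or> (\<forall>t. s + t \<noteq> e)"
  shows "small_at e (single s a)"
proof -
  have "a \<in> \<int>" if "a / 2 \<in> \<int>"
    using Ints_mult[OF that, of 2] by simp
  then show ?thesis
    using assms by (auto simp: small_at_def lookup_single when_def)
qed

text \<open>At scalar matrices a generator becomes a single monomial, with coefficient \<open>1\<close> for a determinant and \<open>\<plusminus>2\<close>
  otherwise, and these monomials are distinct.  The witness is the monomial of \<open>g\<close> itself: there the coefficient of \<open>g\<close>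
  is not divisible by \<open>4\<close>.  The monomial of a determinant divides the monomial of no other generator, and the
  remaining generators have even coefficients.\<close>

lemma generator_not_small_at:
  assumes g: "g \<in> generators m"
  shows "\<exists>e. e \<noteq> 0 \<and> \<not> small_at e (subst scalar_spec g) \<and> (\<forall>f\<in>generators m. f \<noteq> g \<longrightarrow> small_at e (subst scalar_spec f))"
proof -
  have fin: "finite K" "K \<noteq> {}" if "cycle_set m K" for K
    using that by (auto simp: cycle_set_def intro: finite_subset)
  have squarefree_exp_inj: "K = L" if "squarefree_exp K = squarefree_exp L" "finite K" "finite L" for K L
  proof (rule Set.set_eqI)
    fix k show "k \<in> K \<longleftrightarrow> k \<in> L"
      using arg_cong[OF that(1), of "\<lambda>e. lookup e k"] that(2,3)
      by (simp add: lookup_squarefree_exp of_bool_def split: if_splits)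
  qed
  from g consider k where "k \<in> {1..m}" "g = det_poly k" | K where "cycle_set m K" "g = cycle_gen K"
    unfolding generators_eq by blast
  then show ?thesis
  proof cases
    case 1
    let ?e = "single k (2::nat)"
    have "\<not> small_at ?e (subst scalar_spec g)"
    proof
      assume "small_at ?e (subst scalar_spec g)"
      then have "lookup (subst scalar_spec g) ?e / 4 \<in> \<int>" by (rule small_at_top)
      then have "(1/4 :: rat) \<in> \<int>" by (simp add: 1(2) scalar_spec_det_poly)
      then obtain n :: int where "1 / 4 = (of_int n :: rat)" by (auto elim: Ints_cases)
      then have "of_int (4 * n) = (of_int 1 :: rat)" by simp
      then have "4 * n = 1" by (simp only: of_int_eq_iff)
      then show False by presburger
    qed
    moreover have "small_at ?e (subst scalar_spec f)" if f: "f \<in> generators m" "f \<noteq> g" for f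
    proof -
      from f(1) consider l where "l \<in> {1..m}" "f = det_poly l" | K where "cycle_set m K" "f = cycle_gen K"
        unfolding generators_eq by blast
      then show ?thesis
      proof cases
        case l: 1
        then have "l \<noteq> k" using f(2) 1(2) by auto
        then have ne: "single l 2 + t \<noteq> ?e" for t
        proof -
          have "lookup (single l 2 + t) l \<noteq> lookup ?e l" using \<open>l \<noteq> k\<close> by (simp add: lookup_add lookup_single)
          then show ?thesis by (intro notI) simp
        qed
        show ?thesis
          unfolding l(2) scalar_spec_det_poly by (rule small_at_single) (use ne ne[of 0] in simp_all)
      next
        case K: 2
        obtain a where a: "a = 2 \<or> a = -2" "subst scalar_spec (cycle_gen K) = single (squarefree_exp K) a"
          using scalar_spec_cycle_gen[OF K(1)] by blast
        have "card K \<ge> 2" using K(1) by (simp add: cycle_set_def)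
        then have "\<not> K \<subseteq> {k}" using card_mono[of "{k}" K] by auto
        then obtain l where l: "l \<in> K" "l \<noteq> k" by auto
        then have "lookup (squarefree_exp K) l \<noteq> lookup ?e l" using fin[OF K(1)] by (simp add: lookup_squarefree_exp lookup_single)
        then have "squarefree_exp K \<noteq> ?e" by (intro notI) simp
        then show ?thesis
          unfolding K(2) a(2) by (intro small_at_single) (use a(1) in auto)
      qed
    qed
    moreover have "?e \<noteq> 0" using lookup_single_eq[of k "2::nat"] by (intro notI) simp
    ultimately show ?thesis by blast
  next
    case 2
    let ?e = "squarefree_exp K"
    obtain a where a: "a = 2 \<or> a = -2" "subst scalar_spec (cycle_gen K) = single ?e a"
      using scalar_spec_cycle_gen[OF 2(1)] by blast
    have "\<not> small_at ?e (subst scalar_spec g)"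
    proof
      assume "small_at ?e (subst scalar_spec g)"
      then have "lookup (subst scalar_spec g) ?e / 4 \<in> \<int>" by (rule small_at_top)
      then have "a / 4 \<in> \<int>" by (simp add: 2(2) a(2))
      then obtain n :: int where "a / 4 = of_int n" by (auto elim: Ints_cases)
      then have "of_int (4 * n) = (of_int 2 :: rat) \<or> of_int (4 * n) = (of_int (-2) :: rat)" using a(1) by auto
      then have "4 * n = 2 \<or> 4 * n = -2" by (simp only: of_int_eq_iff)
      then show False by presburger
    qed
    moreover have "small_at ?e (subst scalar_spec f)" if f: "f \<in> generators m" "f \<noteq> g" for f
    proof -
      from f(1) consider l where "l \<in> {1..m}" "f = det_poly l" | L where "cycle_set m L" "f = cycle_gen L"
        unfolding generators_eq by blast
      then show ?thesis
      proof cases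
        case l: 1
        have ne: "single l 2 + t \<noteq> ?e" for t
        proof -
          have "lookup (single l 2 + t) l \<ge> 2" by (simp add: lookup_add)
          moreover have "lookup ?e l \<le> 1" using fin[OF 2(1)] by (simp add: lookup_squarefree_exp)
          ultimately show ?thesis by (intro notI) simp
        qed
        show ?thesis
          unfolding l(2) scalar_spec_det_poly by (rule small_at_single) (use ne ne[of 0] in simp_all)
      next
        case L: 2
        obtain b where b: "b = 2 \<or> b = -2" "subst scalar_spec (cycle_gen L) = single (squarefree_exp L) b"
          using scalar_spec_cycle_gen[OF L(1)] by blast
        have "squarefree_exp L \<noteq> ?e"
        proof
          assume "squarefree_exp L = ?e"
          then have "L = K" by (rule squarefree_exp_inj) (rule fin(1)[OF L(1)], rule fin(1)[OF 2(1)])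
          then show False using f(2) 2(2) L(2) by simp
        qed
        then show ?thesis
          unfolding L(2) b(2) by (intro small_at_single) (use b(1) in auto)
      qed
    qed
    moreover have "?e \<noteq> 0"
    proof
      assume z: "?e = 0"
      obtain k where "k \<in> K" using fin(2)[OF 2(1)] by blast
      then show False using lookup_squarefree_exp[OF fin(1)[OF 2(1)], of k] z by simp
    qed
    ultimately show ?thesis by blast
  qed
qed

theorem theorem2p2:
  fixes m :: nat
  assumes "m \<ge> 1"
  shows "minimally_generates (generators m) (int_coord_ring m \<inter> invariants m)"
proof -
  have gen: "is_subring hull generators m = int_inv m"
    using hull_int_inv int_inv_generated by blast
  moreover have "is_subring hull T \<noteq> int_inv m" if T: "T \<subset> generators m" for T
  proof
    assume eq: "is_subring hull T = int_inv m"
    from T obtain g where g: "g \<in> generators m" "g \<notin> T" by blast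
    obtain e where e: "e \<noteq> 0" "\<not> small_at e (subst scalar_spec g)"
      and others: "\<forall>f\<in>generators m. f \<noteq> g \<longrightarrow> small_at e (subst scalar_spec f)"
      using generator_not_small_at[OF g(1)] by blast
    have "T \<subseteq> {p. small_at e (subst scalar_spec p)}"
    proof
      fix f assume "f \<in> T"
      then have "f \<in> generators m" "f \<noteq> g" using T g(2) by auto
      then show "f \<in> {p. small_at e (subst scalar_spec p)}" using others by simp
    qed
    then have "is_subring hull T \<subseteq> {p. small_at e (subst scalar_spec p)}"
      by (rule hull_minimal) (rule small_at_subring[OF e(1)])
    moreover have "g \<in> is_subring hull T" using g(1) generators_int_inv eq by blast
    ultimately show False using e(2) by blast
  qed
  ultimately show ?thesis unfolding minimally_generates_def int_coord_ring_iff by blast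
qed

end
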